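(* Let $X$ be a locally compact Hausdorff space, $\kappa$ a perfect kernel on $X$ satisfying the first and the second maximum principles, $A\subset X$ a set such that $\mathcal E^+(A)$ is closed in the strong topology on $\mathcal E^+$, and $f=-U^\zeta$, where $\zeta\in\mathcal E^+$ and $\zeta(X)\leqslant1$. Assume $-\infty<w_f(A)<\infty$ and ${\rm cap}_*(A)=\infty$. Then a minimizer $\lambda_{A,f}\in\breve{\mathcal E}^+_f(A)$ with $I_f(\lambda_{A,f})=w_f(A)$ does not exist if $\zeta(X)<1$, and it exists if $\zeta$ is a measure of unit total mass concentrated on $A$. In the latter case, $\lambda_{A,f}=\zeta$.
   Context: Measures: $\mathfrak M$ is the space of real-valued (signed) Radon measures on $X$ with the vague (weak$^*$) topology of pointwise convergence on continuous functions of compact support; $\mathfrak M^+$ is the cone of positive ones. A measure $\mu\in\mathfrak M^+$ is concentrated on $A\subset X$ if $X\setminus A$ is locally $\mu$-negligible. $S(\mu)$ is the support of $\mu$. $\Phi(Y)$ is the set of lower semicontinuous functions $g:Y\to(-\infty,\infty]$ which are $\geqslant0$ unless the topological space $Y$ is compact. A kernel is a symmetric function $\kappa\in\Phi(X\times X)$. For $\mu\in\mathfrak M$, $U^\mu(x)=\int\kappa(x,y)\,d\mu(y)$ is the potential, $I(\mu,\nu)=\int\kappa\,d(\mu\otimes\nu)$ the mutual energy, $I(\mu)=I(\mu,\mu)$ the energy, whenever well defined. Energy principle: $I(\mu)\geqslant0$ for all $\mu\in\mathfrak M$ for which $I(\mu)$ is well defined, and $I(\mu)=0$ only for $\mu=0$.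 Then $\mathcal E=\{\mu\in\mathfrak M: I(\mu)\text{ well defined},\ I(\mu)<\infty\}$ is a pre-Hilbert space with inner product $I(\mu,\nu)$ and norm $\|\mu\|=\sqrt{I(\mu)}$; the norm topology is called strong. $\mathcal E^+=\mathcal E\cap\mathfrak M^+$. The kernel is perfect if it satisfies the energy principle, $\mathcal E^+$ is strongly complete, and the strong topology on $\mathcal E^+$ is finer than the vague topology. First (Frostman's) maximum principle: for any $\mu\in\mathcal E^+$ with $U^\mu\leqslant1$ on $S(\mu)$, $U^\mu\leqslant1$ on $X$. Second maximum (domination) principle: for any $\mu,\nu\in\mathcal E^+$ with $U^\mu\leqslant U^\nu$ $\mu$-a.e., $U^\mu\leqslant U^\nu$ on $X$. $\mathcal E^+(A)$ is the set of $\mu\in\mathcal E^+$ concentrated on $A$; $\breve{\mathcal E}^+(A)=\{\mu\in\mathcal E^+(A):\mu(X)=1\}$. ${\rm cap}_*(A)=1/w(A)$ with $w(A)=\inf_{\mu\in\breve{\mathcal E}^+(A)}I(\mu)$ is the inner capacity (conventions: $\inf\varnothing=+\infty$, $1/(+\infty)=0$, $1/0=+\infty$). $\breve{\mathcal E}^+_f(A)$ is the set of $\mu\in\breve{\mathcal E}^+(A)$ for which $f$ is $\mu$-integrable; $I_f(\mu)=I(\mu)+2\int f\,d\mu$; $w_f(A)=\inf_{\mu\in\breve{\mathcal E}^+_f(A)}I_f(\mu)$. A minimizer is unique if it exists. *)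

theory Defs
  imports "HOL-Analysis.Analysis"
begin

text \<open>
  Radon measures are taken in the sense of Bourbaki: a signed Radon measure on a locally compact
  Hausdorff space is a real linear form on the space of continuous functions of compact support
  that is bounded on the functions supported in any fixed compact set.  (On a noncompact space, two positive Radon
  measures may both have infinite mass, and then their difference is not a set function on the
  Borel sets, so the library type of measures cannot represent signed Radon measures.)
\<close>

definition Cc :: "('a::topological_space \<Rightarrow> real) set" where
  "Cc = {\<phi>. continuous_on UNIV \<phi> \<and> compact (closure {x. \<phi> x \<noteq> 0})}"

text \<open>The last clause only normalises the value outside \<^const>\<open>Cc\<close>, so that equality of
  measures is equality of functions.\<close>

definition radon :: "(('a::topological_space \<Rightarrow> real) \<Rightarrow> real) set" where
  "radon = {\<mu>.
     (\<forall>\<phi>\<in>Cc. \<forall>\<psi>\<in>Cc. \<mu> (\<lambda>x. \<phi> x + \<psi> x) = \<mu> \<phi> + \<mu> \<psi>) \<and>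
     (\<forall>c. \<forall>\<phi>\<in>Cc. \<mu> (\<lambda>x. c * \<phi> x) = c * \<mu> \<phi>) \<and>
     (\<forall>K. compact K \<longrightarrow> (\<exists>M. \<forall>\<phi>\<in>Cc. \<forall>b. (\<forall>x. x \<notin> K \<longrightarrow> \<phi> x = 0) \<longrightarrow> (\<forall>x. \<bar>\<phi> x\<bar> \<le> b)
         \<longrightarrow> \<bar>\<mu> \<phi>\<bar> \<le> M * b)) \<and>
     (\<forall>\<phi>. \<phi> \<notin> Cc \<longrightarrow> \<mu> \<phi> = 0)}"

definition radon_pos :: "(('a::topological_space \<Rightarrow> real) \<Rightarrow> real) set" where
  "radon_pos = {\<mu> \<in> radon. \<forall>\<phi>\<in>Cc. (\<forall>x. 0 \<le> \<phi> x) \<longrightarrow> 0 \<le> \<mu> \<phi>}"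

text \<open>Jordan decomposition: on nonnegative \<open>\<phi>\<close>, \<open>\<mu>\<^sup>+(\<phi>) = sup {\<mu>(\<psi>) | 0 \<le> \<psi> \<le> \<phi>}\<close>.\<close>

definition pos_variation :: "(('a::topological_space \<Rightarrow> real) \<Rightarrow> real) \<Rightarrow> ('a \<Rightarrow> real) \<Rightarrow> real" where
  "pos_variation \<mu> \<phi> = (SUP \<psi>\<in>{\<psi>\<in>Cc. \<forall>x. 0 \<le> \<psi> x \<and> \<psi> x \<le> \<phi> x}. \<mu> \<psi>)"

definition pos_part :: "(('a::topological_space \<Rightarrow> real) \<Rightarrow> real) \<Rightarrow> ('a \<Rightarrow> real) \<Rightarrow> real" where
  "pos_part \<mu> \<phi> = (if \<phi> \<in> Cc
     then pos_variation \<mu> (\<lambda>x. max 0 (\<phi> x)) - pos_variation \<mu> (\<lambda>x. max 0 (- \<phi> x)) else 0)"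

definition neg_part :: "(('a::topological_space \<Rightarrow> real) \<Rightarrow> real) \<Rightarrow> ('a \<Rightarrow> real) \<Rightarrow> real" where
  "neg_part \<mu> = pos_part (\<lambda>\<phi>. - \<mu> \<phi>)"

text \<open>The product measure, given by Bourbaki's iterated formula.\<close>

definition radon_prod :: "(('a::topological_space \<Rightarrow> real) \<Rightarrow> real) \<Rightarrow>
    (('b::topological_space \<Rightarrow> real) \<Rightarrow> real) \<Rightarrow> ('a \<times> 'b \<Rightarrow> real) \<Rightarrow> real" where
  "radon_prod \<mu> \<nu> \<Phi> = (if \<Phi> \<in> Cc then \<mu> (\<lambda>x. \<nu> (\<lambda>y. \<Phi> (x, y))) else 0)"

definition lower_semicont :: "('a::topological_space \<Rightarrow> ereal) \<Rightarrow> bool" where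
  "lower_semicont g \<longleftrightarrow> (\<forall>a. open {x. a < g x})"

text \<open>Upper integral of a function \<open>f \<ge> 0\<close> with respect to a positive measure (for other
  arguments the value is meaningless).\<close>

definition lsc_integral :: "(('a::topological_space \<Rightarrow> real) \<Rightarrow> real) \<Rightarrow> ('a \<Rightarrow> ereal) \<Rightarrow> ereal" where
  "lsc_integral \<mu> h = (SUP \<phi>\<in>{\<phi>\<in>Cc. \<forall>x. 0 \<le> \<phi> x \<and> ereal (\<phi> x) \<le> h x}. ereal (\<mu> \<phi>))"

definition upper_integral :: "(('a::topological_space \<Rightarrow> real) \<Rightarrow> real) \<Rightarrow> ('a \<Rightarrow> ereal) \<Rightarrow> ereal" where
  "upper_integral \<mu> f = (INF h\<in>{h. lower_semicont h \<and> (\<forall>x. f x \<le> h x)}. lsc_integral \<mu> h)"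

definition outer_meas :: "(('a::topological_space \<Rightarrow> real) \<Rightarrow> real) \<Rightarrow> 'a set \<Rightarrow> ereal" where
  "outer_meas \<mu> S = upper_integral \<mu> (indicator S)"

abbreviation total_mass :: "(('a::topological_space \<Rightarrow> real) \<Rightarrow> real) \<Rightarrow> ereal" where
  "total_mass \<mu> \<equiv> outer_meas \<mu> UNIV"

text \<open>\<open>f\<close> is integrable with respect to the positive measure \<open>\<mu>\<close> iff it lies in the closure of
  \<^const>\<open>Cc\<close> for the seminorm \<open>f \<mapsto> \<integral>\<^sup>* |f| d\<mu>\<close>.\<close>

definition radon_integrable :: "(('a::topological_space \<Rightarrow> real) \<Rightarrow> real) \<Rightarrow> ('a \<Rightarrow> ereal) \<Rightarrow> bool" where
  "radon_integrable \<mu> f \<longleftrightarrow>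
     (\<forall>e>0. \<exists>\<phi>\<in>Cc. upper_integral \<mu> (\<lambda>x. \<bar>f x - ereal (\<phi> x)\<bar>) < ereal e)"

text \<open>The integral with respect to a signed measure is only formed below for functions that are
  integrable or semicontinuous.  The two parts collect the positive and the negative
  contributions; the integral is well defined unless both are infinite.\<close>

definition integral_pos :: "(('a::topological_space \<Rightarrow> real) \<Rightarrow> real) \<Rightarrow> ('a \<Rightarrow> ereal) \<Rightarrow> ereal" where
  "integral_pos \<mu> f = upper_integral (pos_part \<mu>) (\<lambda>x. max 0 (f x))
                    + upper_integral (neg_part \<mu>) (\<lambda>x. max 0 (- f x))"

definition integral_neg :: "(('a::topological_space \<Rightarrow> real) \<Rightarrow> real) \<Rightarrow> ('a \<Rightarrow> ereal) \<Rightarrow> ereal" where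
  "integral_neg \<mu> f = upper_integral (pos_part \<mu>) (\<lambda>x. max 0 (- f x))
                    + upper_integral (neg_part \<mu>) (\<lambda>x. max 0 (f x))"

definition integral_defined :: "(('a::topological_space \<Rightarrow> real) \<Rightarrow> real) \<Rightarrow> ('a \<Rightarrow> ereal) \<Rightarrow> bool" where
  "integral_defined \<mu> f \<longleftrightarrow> \<not> (integral_pos \<mu> f = \<infinity> \<and> integral_neg \<mu> f = \<infinity>)"

definition radon_integral :: "(('a::topological_space \<Rightarrow> real) \<Rightarrow> real) \<Rightarrow> ('a \<Rightarrow> ereal) \<Rightarrow> ereal" where
  "radon_integral \<mu> f = integral_pos \<mu> f - integral_neg \<mu> f"

definition msupport :: "(('a::topological_space \<Rightarrow> real) \<Rightarrow> real) \<Rightarrow> 'a set" where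
  "msupport \<mu> = - \<Union>{V. open V \<and> (\<forall>\<phi>\<in>Cc. closure {x. \<phi> x \<noteq> 0} \<subseteq> V \<longrightarrow> \<mu> \<phi> = 0)}"

definition negligible_for :: "(('a::topological_space \<Rightarrow> real) \<Rightarrow> real) \<Rightarrow> 'a set \<Rightarrow> bool" where
  "negligible_for \<mu> N \<longleftrightarrow> outer_meas \<mu> N = 0"

definition locally_negligible_for :: "(('a::topological_space \<Rightarrow> real) \<Rightarrow> real) \<Rightarrow> 'a set \<Rightarrow> bool" where
  "locally_negligible_for \<mu> N \<longleftrightarrow> (\<forall>K. compact K \<longrightarrow> negligible_for \<mu> (N \<inter> K))"

definition concentrated_on :: "(('a::topological_space \<Rightarrow> real) \<Rightarrow> real) \<Rightarrow> 'a set \<Rightarrow> bool" where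
  "concentrated_on \<mu> A \<longleftrightarrow> locally_negligible_for \<mu> (UNIV - A)"

definition Phi :: "('b::topological_space \<Rightarrow> ereal) set" where
  "Phi = {g. lower_semicont g \<and> (\<forall>y. g y \<noteq> -\<infinity>) \<and> (compact (UNIV :: 'b set) \<or> (\<forall>y. 0 \<le> g y))}"

definition kernel :: "('a::topological_space \<times> 'a \<Rightarrow> ereal) \<Rightarrow> bool" where
  "kernel \<kappa> \<longleftrightarrow> \<kappa> \<in> Phi \<and> (\<forall>x y. \<kappa> (x, y) = \<kappa> (y, x))"

definition potential ::
    "('a::topological_space \<times> 'a \<Rightarrow> ereal) \<Rightarrow> (('a \<Rightarrow> real) \<Rightarrow> real) \<Rightarrow> 'a \<Rightarrow> ereal" where
  "potential \<kappa> \<mu> x = radon_integral \<mu> (\<lambda>y. \<kappa> (x, y))"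

definition mutual_energy ::
    "('a::topological_space \<times> 'a \<Rightarrow> ereal) \<Rightarrow> (('a \<Rightarrow> real) \<Rightarrow> real) \<Rightarrow> (('a \<Rightarrow> real) \<Rightarrow> real) \<Rightarrow> ereal" where
  "mutual_energy \<kappa> \<mu> \<nu> = radon_integral (radon_prod \<mu> \<nu>) \<kappa>"

definition energy :: "('a::topological_space \<times> 'a \<Rightarrow> ereal) \<Rightarrow> (('a \<Rightarrow> real) \<Rightarrow> real) \<Rightarrow> ereal" where
  "energy \<kappa> \<mu> = mutual_energy \<kappa> \<mu> \<mu>"

definition energy_defined :: "('a::topological_space \<times> 'a \<Rightarrow> ereal) \<Rightarrow> (('a \<Rightarrow> real) \<Rightarrow> real) \<Rightarrow> bool" where
  "energy_defined \<kappa> \<mu> \<longleftrightarrow> integral_defined (radon_prod \<mu> \<mu>) \<kappa>"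

definition energy_principle :: "('a::topological_space \<times> 'a \<Rightarrow> ereal) \<Rightarrow> bool" where
  "energy_principle \<kappa> \<longleftrightarrow> (\<forall>\<mu>\<in>radon. energy_defined \<kappa> \<mu> \<longrightarrow>
     0 \<le> energy \<kappa> \<mu> \<and> (energy \<kappa> \<mu> = 0 \<longrightarrow> \<mu> = (\<lambda>_. 0)))"

definition fin_energy :: "('a::topological_space \<times> 'a \<Rightarrow> ereal) \<Rightarrow> (('a \<Rightarrow> real) \<Rightarrow> real) set" where
  "fin_energy \<kappa> = {\<mu>\<in>radon. energy_defined \<kappa> \<mu> \<and> energy \<kappa> \<mu> < \<infinity>}"

definition fin_energy_pos :: "('a::topological_space \<times> 'a \<Rightarrow> ereal) \<Rightarrow> (('a \<Rightarrow> real) \<Rightarrow> real) set" where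
  "fin_energy_pos \<kappa> = fin_energy \<kappa> \<inter> radon_pos"

definition energy_norm :: "('a::topological_space \<times> 'a \<Rightarrow> ereal) \<Rightarrow> (('a \<Rightarrow> real) \<Rightarrow> real) \<Rightarrow> real" where
  "energy_norm \<kappa> \<mu> = sqrt (real_of_ereal (energy \<kappa> \<mu>))"

text \<open>The value outside \<^const>\<open>fin_energy\<close> is irrelevant; it is set to \<open>0\<close> because
  \<^locale>\<open>Metric_space\<close> requires nonnegativity and symmetry for all arguments.\<close>

definition strong_dist :: "('a::topological_space \<times> 'a \<Rightarrow> ereal) \<Rightarrow>
    (('a \<Rightarrow> real) \<Rightarrow> real) \<Rightarrow> (('a \<Rightarrow> real) \<Rightarrow> real) \<Rightarrow> real" where
  "strong_dist \<kappa> \<mu> \<nu> = (if \<mu> \<in> fin_energy \<kappa> \<and> \<nu> \<in> fin_energy \<kappa>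
     then energy_norm \<kappa> (\<lambda>\<phi>. \<mu> \<phi> - \<nu> \<phi>) else 0)"

definition strong_topology :: "('a::topological_space \<times> 'a \<Rightarrow> ereal) \<Rightarrow> (('a \<Rightarrow> real) \<Rightarrow> real) topology" where
  "strong_topology \<kappa> = Metric_space.mtopology (fin_energy_pos \<kappa>) (strong_dist \<kappa>)"

text \<open>The function space \<open>('a \<Rightarrow> real) \<Rightarrow> real\<close> carries the topology of pointwise convergence.
  Since Radon measures vanish identically outside \<^const>\<open>Cc\<close>, it induces on them
  pointwise convergence on \<^const>\<open>Cc\<close>, i.e. the vague topology.\<close>

definition vague_topology :: "(('a::topological_space \<Rightarrow> real) \<Rightarrow> real) topology" where
  "vague_topology = subtopology euclidean radon"

definition perfect :: "('a::topological_space \<times> 'a \<Rightarrow> ereal) \<Rightarrow> bool" where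
  "perfect \<kappa> \<longleftrightarrow> energy_principle \<kappa> \<and>
     Metric_space.mcomplete (fin_energy_pos \<kappa>) (strong_dist \<kappa>) \<and>
     (\<forall>U. openin (subtopology vague_topology (fin_energy_pos \<kappa>)) U \<longrightarrow> openin (strong_topology \<kappa>) U)"

definition first_max_principle :: "('a::topological_space \<times> 'a \<Rightarrow> ereal) \<Rightarrow> bool" where
  "first_max_principle \<kappa> \<longleftrightarrow> (\<forall>\<mu>\<in>fin_energy_pos \<kappa>.
     (\<forall>x\<in>msupport \<mu>. potential \<kappa> \<mu> x \<le> 1) \<longrightarrow> (\<forall>x. potential \<kappa> \<mu> x \<le> 1))"

definition second_max_principle :: "('a::topological_space \<times> 'a \<Rightarrow> ereal) \<Rightarrow> bool" where
  "second_max_principle \<kappa> \<longleftrightarrow> (\<forall>\<mu>\<in>fin_energy_pos \<kappa>. \<forall>\<nu>\<in>fin_energy_pos \<kappa>.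
     negligible_for \<mu> {x. \<not> potential \<kappa> \<mu> x \<le> potential \<kappa> \<nu> x} \<longrightarrow>
     (\<forall>x. potential \<kappa> \<mu> x \<le> potential \<kappa> \<nu> x))"

definition fin_energy_on :: "('a::topological_space \<times> 'a \<Rightarrow> ereal) \<Rightarrow> 'a set \<Rightarrow> (('a \<Rightarrow> real) \<Rightarrow> real) set" where
  "fin_energy_on \<kappa> A = {\<mu>\<in>fin_energy_pos \<kappa>. concentrated_on \<mu> A}"

definition unit_energy_on :: "('a::topological_space \<times> 'a \<Rightarrow> ereal) \<Rightarrow> 'a set \<Rightarrow> (('a \<Rightarrow> real) \<Rightarrow> real) set" where
  "unit_energy_on \<kappa> A = {\<mu>\<in>fin_energy_on \<kappa> A. total_mass \<mu> = 1}"

text \<open>In \<^typ>\<open>ereal\<close> one has \<open>Inf {} = \<infinity>\<close>, \<open>1 / \<infinity> = 0\<close> and \<open>1 / 0 = \<infinity>\<close>, as required here.\<close>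

definition min_energy :: "('a::topological_space \<times> 'a \<Rightarrow> ereal) \<Rightarrow> 'a set \<Rightarrow> ereal" where
  "min_energy \<kappa> A = (INF \<mu>\<in>unit_energy_on \<kappa> A. energy \<kappa> \<mu>)"

definition inner_capacity :: "('a::topological_space \<times> 'a \<Rightarrow> ereal) \<Rightarrow> 'a set \<Rightarrow> ereal" where
  "inner_capacity \<kappa> A = 1 / min_energy \<kappa> A"

definition unit_energy_field ::
    "('a::topological_space \<times> 'a \<Rightarrow> ereal) \<Rightarrow> ('a \<Rightarrow> ereal) \<Rightarrow> 'a set \<Rightarrow> (('a \<Rightarrow> real) \<Rightarrow> real) set" where
  "unit_energy_field \<kappa> f A = {\<mu>\<in>unit_energy_on \<kappa> A. radon_integrable \<mu> f}"

definition gauss_functional ::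
    "('a::topological_space \<times> 'a \<Rightarrow> ereal) \<Rightarrow> ('a \<Rightarrow> ereal) \<Rightarrow> (('a \<Rightarrow> real) \<Rightarrow> real) \<Rightarrow> ereal" where
  "gauss_functional \<kappa> f \<mu> = energy \<kappa> \<mu> + 2 * radon_integral \<mu> f"

definition min_gauss :: "('a::topological_space \<times> 'a \<Rightarrow> ereal) \<Rightarrow> ('a \<Rightarrow> ereal) \<Rightarrow> 'a set \<Rightarrow> ereal" where
  "min_gauss \<kappa> f A = (INF \<mu>\<in>unit_energy_field \<kappa> f A. gauss_functional \<kappa> f \<mu>)"

definition gauss_minimizer :: "('a::topological_space \<times> 'a \<Rightarrow> ereal) \<Rightarrow> ('a \<Rightarrow> ereal) \<Rightarrow> 'a set \<Rightarrow>
    (('a \<Rightarrow> real) \<Rightarrow> real) \<Rightarrow> bool" where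
  "gauss_minimizer \<kappa> f A \<mu> \<longleftrightarrow>
     \<mu> \<in> unit_energy_field \<kappa> f A \<and> gauss_functional \<kappa> f \<mu> = min_gauss \<kappa> f A"

end

theory Submission
  imports Defs
begin

text \<open>
  For \<open>\<mu>, \<zeta>\<close> of finite energy, \<open>I\<^sub>f(\<mu>) = I(\<mu>) - 2 I(\<mu>, \<zeta>) = \<parallel>\<mu> - \<zeta>\<parallel>\<^sup>2 - \<parallel>\<zeta>\<parallel>\<^sup>2\<close>, so if \<open>\<zeta>\<close> itself is
  admissible it is the unique minimizer, by the energy principle.

  Let now \<open>\<zeta>(X) < 1\<close> and suppose that \<open>\<lambda>\<close> is a minimizer.  Since \<open>A\<close> has infinite capacity there are
  unit measures \<open>\<nu>\<close> on \<open>A\<close> of arbitrarily small energy, hence mass can be moved away from \<open>\<lambda>\<close> at no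
  cost: comparing \<open>\<lambda>\<close> with \<open>\<lambda> - t g\<lambda> + t \<lambda>(g) \<nu>\<close>, where \<open>0 \<le> g \<le> 1\<close> is continuous with compact support,
  gives \<open>\<integral> g U\<^sup>\<lambda> d\<lambda> \<le> \<integral> g U\<^sup>\<zeta> d\<lambda>\<close>.  Thus \<open>U\<^sup>\<lambda> \<le> U\<^sup>\<zeta>\<close> holds \<open>\<lambda>\<close>-a.e., and everywhere by the domination
  principle.

  This contradicts the principle of positivity of mass, by which \<open>U\<^sup>\<lambda> \<le> U\<^sup>\<zeta>\<close> implies \<open>\<lambda>(X) \<le> \<zeta>(X)\<close>: for
  continuous \<open>0 \<le> \<phi> \<le> 1\<close> of compact support let \<open>\<gamma>\<close> minimize \<open>\<parallel>\<sigma>\<parallel>\<^sup>2 - 2 \<sigma>(\<phi>)\<close> over all positive \<open>\<sigma>\<close> of finite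
  energy; such a \<open>\<gamma>\<close> exists because the kernel is perfect.  Then \<open>\<tau>(\<phi>) \<le> I(\<gamma>, \<tau>)\<close> for all \<open>\<tau>\<close>, and
  \<open>U\<^sup>\<gamma> \<le> \<phi> \<le> 1\<close> on the support of \<open>\<gamma>\<close>, hence \<open>U\<^sup>\<gamma> \<le> 1\<close> everywhere by Frostman's principle, so
  \<open>\<lambda>(\<phi>) \<le> I(\<gamma>, \<lambda>) \<le> I(\<gamma>, \<zeta>) = \<integral> U\<^sup>\<gamma> d\<zeta> \<le> \<zeta>(X)\<close>.
\<close>

section \<open>Continuous functions of compact support\<close>

text \<open>Measures are functionals on \<open>Cc\<close>, possibly of infinite mass, on a space
  without countability assumptions, so every integral is reduced to \<open>lint\<close>, a supremum
  over \<open>Cc\<close> minorants. It behaves well on upper envelopes of \<open>Cc\<close>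
  functions, a class containing the kernel, its sections and all potentials of positive measures,
  also when the kernel takes negative values on a compact space. Directed families and Dini's
  theorem replace monotone convergence. The energy principle is applied to differences of measures,
  but the calculus stays in the cone of positive measures of finite energy:
  \<open>q \<mu> \<nu>\<close> stands for the squared norm of \<mu> - \<nu>, and removing t
  g\<lambda> from \<lambda> is multiplication by the density 1 - t g. The factor \<lambda>(g) in the
  competitor restores the unit mass. For fixed \<nu> the limit t -> 0 leaves a term bounded by a
  constant times the norm of \<nu>, by Cauchy--Schwarz, and only then is the energy of \<nu> made
  small. The resulting inequality holds almost everywhere for the measure whose potential stands on
  the left, as the domination principle requires.\<close>

lemma Cc_iff:
  fixes \<phi> :: "'a::t2_space \<Rightarrow> real"
  shows "\<phi> \<in> Cc \<longleftrightarrow> continuous_on UNIV \<phi> \<and> (\<exists>K. compact K \<and> (\<forall>x. x \<notin> K \<longrightarrow> \<phi> x = 0))"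
proof
  assume "\<phi> \<in> Cc"
  then have "continuous_on UNIV \<phi>" "compact (closure {x. \<phi> x \<noteq> 0})"
    by (auto simp: Cc_def)
  moreover have "\<forall>x. x \<notin> closure {x. \<phi> x \<noteq> 0} \<longrightarrow> \<phi> x = 0"
    using closure_subset[of "{x. \<phi> x \<noteq> 0}"] by auto
  ultimately show "continuous_on UNIV \<phi> \<and> (\<exists>K. compact K \<and> (\<forall>x. x \<notin> K \<longrightarrow> \<phi> x = 0))"
    by blast
next
  assume "continuous_on UNIV \<phi> \<and> (\<exists>K. compact K \<and> (\<forall>x. x \<notin> K \<longrightarrow> \<phi> x = 0))"
  then obtain K where K: "continuous_on UNIV \<phi>" "compact K" "\<forall>x. x \<notin> K \<longrightarrow> \<phi> x = 0"
    by blast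
  then have "closure {x. \<phi> x \<noteq> 0} \<subseteq> K"
    by (intro closure_minimal compact_imp_closed) auto
  then have "compact (closure {x. \<phi> x \<noteq> 0})"
    using K(2) by (metis closed_closure compact_Int_closed inf.absorb2)
  then show "\<phi> \<in> Cc"
    using K by (auto simp: Cc_def)
qed

lemma CcI:
  fixes \<phi> :: "'a::t2_space \<Rightarrow> real"
  assumes "continuous_on UNIV \<phi>" "compact K" "\<And>x. x \<notin> K \<Longrightarrow> \<phi> x = 0"
  shows "\<phi> \<in> Cc"
  using assms Cc_iff by blast

lemma Cc_vanishes:
  fixes \<phi> :: "'a::t2_space \<Rightarrow> real"
  assumes "\<phi> \<in> Cc"
  shows "\<exists>K. compact K \<and> (\<forall>x. x \<notin> K \<longrightarrow> \<phi> x = 0)"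
  using assms Cc_iff by blast

lemma Cc_continuous: "\<phi> \<in> Cc \<Longrightarrow> continuous_on UNIV \<phi>"
  by (simp add: Cc_def)

lemma Cc_zero [simp]: "(\<lambda>_::'a::t2_space. 0) \<in> Cc"
  by (rule CcI[of _ "{}"]) auto

text \<open>\<open>F 0 0 = 0\<close> keeps the combination zero off the union of two compact sets.
  The sums, differences, maxima and minima below are instances.\<close>

lemma Cc_combine:
  fixes \<phi> \<psi> :: "'a::t2_space \<Rightarrow> real"
  assumes "\<phi> \<in> Cc" "\<psi> \<in> Cc" and F: "continuous_on UNIV (\<lambda>(a, b). F a b)" and 0: "F 0 0 = (0::real)"
  shows "(\<lambda>x. F (\<phi> x) (\<psi> x)) \<in> Cc"
proof -
  obtain K where K: "compact K" "\<And>x. x \<notin> K \<Longrightarrow> \<phi> x = 0" using Cc_vanishes[OF assms(1)] by auto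
  obtain L where L: "compact L" "\<And>x. x \<notin> L \<Longrightarrow> \<psi> x = 0" using Cc_vanishes[OF assms(2)] by auto
  have "continuous_on UNIV (\<lambda>x. (\<lambda>(a, b). F a b) (\<phi> x, \<psi> x))"
    by (rule continuous_on_compose2[OF F]) (auto intro!: continuous_on_Pair Cc_continuous assms)
  then show ?thesis
    by (intro CcI[of _ "K \<union> L"]) (use K L 0 in auto)
qed

lemma Cc_add: "\<phi> \<in> Cc \<Longrightarrow> \<psi> \<in> Cc \<Longrightarrow> (\<lambda>x::'a::t2_space. \<phi> x + \<psi> x) \<in> Cc"
  by (rule Cc_combine[where F = "\<lambda>a b. a + b"]) (simp_all add: case_prod_unfold continuous_intros)

lemma Cc_diff: "\<phi> \<in> Cc \<Longrightarrow> \<psi> \<in> Cc \<Longrightarrow> (\<lambda>x::'a::t2_space. \<phi> x - \<psi> x) \<in> Cc"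
  by (rule Cc_combine[where F = "\<lambda>a b. a - b"]) (simp_all add: case_prod_unfold continuous_intros)

lemma Cc_max: "\<phi> \<in> Cc \<Longrightarrow> \<psi> \<in> Cc \<Longrightarrow> (\<lambda>x::'a::t2_space. max (\<phi> x) (\<psi> x)) \<in> Cc"
  by (rule Cc_combine[where F = "max"]) (simp_all add: case_prod_unfold continuous_intros)

lemma Cc_min: "\<phi> \<in> Cc \<Longrightarrow> \<psi> \<in> Cc \<Longrightarrow> (\<lambda>x::'a::t2_space. min (\<phi> x) (\<psi> x)) \<in> Cc"
  by (rule Cc_combine[where F = "min"]) (simp_all add: case_prod_unfold continuous_intros)

lemma Cc_mult_continuous:
  fixes \<phi> :: "'a::t2_space \<Rightarrow> real"
  assumes "\<phi> \<in> Cc" "continuous_on UNIV g"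
  shows "(\<lambda>x. g x * \<phi> x) \<in> Cc"
proof -
  obtain K where "compact K" "\<And>x. x \<notin> K \<Longrightarrow> \<phi> x = 0" using Cc_vanishes[OF assms(1)] by auto
  then show ?thesis
    using continuous_on_mult[OF assms(2) Cc_continuous[OF assms(1)]] by (intro CcI[of _ K]) auto
qed

lemma Cc_mult: "g \<in> Cc \<Longrightarrow> \<phi> \<in> Cc \<Longrightarrow> (\<lambda>x::'a::t2_space. g x * \<phi> x) \<in> Cc"
  by (simp add: Cc_mult_continuous Cc_continuous)

lemma Cc_cmult: "\<phi> \<in> Cc \<Longrightarrow> (\<lambda>x::'a::t2_space. c * \<phi> x) \<in> Cc"
  by (rule Cc_mult_continuous[where g = "\<lambda>_. c"]) simp_all

lemma Cc_uminus: "\<phi> \<in> Cc \<Longrightarrow> (\<lambda>x::'a::t2_space. - \<phi> x) \<in> Cc"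
  using Cc_cmult[of \<phi> "-1"] by simp

lemma Cc_max0: "\<phi> \<in> Cc \<Longrightarrow> (\<lambda>x::'a::t2_space. max 0 (\<phi> x)) \<in> Cc"
  by (rule Cc_max[OF Cc_zero])

lemma Cc_min0: "\<phi> \<in> Cc \<Longrightarrow> (\<lambda>x::'a::t2_space. min 0 (\<phi> x)) \<in> Cc"
  by (rule Cc_min[OF Cc_zero])

lemma Cc_const: "compact (UNIV :: 'a set) \<Longrightarrow> (\<lambda>_::'a::t2_space. c) \<in> Cc"
  by (rule CcI[of _ UNIV]) auto

lemmas Cc_intros = Cc_add Cc_diff Cc_max Cc_min Cc_mult Cc_cmult Cc_uminus Cc_max0 Cc_min0 Cc_zero

text \<open>K is covered by finitely many open sets lying in compact sets; intersecting their union
  with V gives an open W between K and V inside a compact M. A locally compact Hausdorff space is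
  completely regular, which separates K from the complement of W, and M contains the
  support.\<close>

lemma urysohn_Cc:
  fixes K V :: "'a::t2_space set"
  assumes lc: "locally_compact_space (euclidean :: 'a topology)"
    and K: "compact K" and V: "open V" "K \<subseteq> V"
  obtains \<eta> where "\<eta> \<in> Cc" "\<And>x. 0 \<le> \<eta> x" "\<And>x. \<eta> x \<le> 1"
    "\<And>x. x \<in> K \<Longrightarrow> \<eta> x = 1" "\<And>x. x \<notin> V \<Longrightarrow> \<eta> x = 0"
proof -
  have "\<forall>x. \<exists>U L. open U \<and> compact L \<and> x \<in> U \<and> U \<subseteq> (L :: 'a set)"
    using lc by (simp only: locally_compact_space_def open_openin[symmetric] compactin_euclidean_iff topspace_euclidean ball_UNIV simp_thms)
  from choice[OF this] obtain U where U: "\<forall>x. \<exists>L. open (U x) \<and> compact L \<and> x \<in> U x \<and> U x \<subseteq> (L :: 'a set)" ..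
  from choice[OF this] obtain L where "\<forall>x. open (U x) \<and> compact (L x) \<and> x \<in> U x \<and> U x \<subseteq> (L x :: 'a set)" ..
  then have UL: "open (U x)" "compact (L x)" "x \<in> U x" "U x \<subseteq> L x" for x by auto
  have "K \<subseteq> (\<Union>x\<in>UNIV. U x)" using UL(3) by auto
  from compactE_image[OF K UL(1) this] obtain F where F: "finite F" "K \<subseteq> (\<Union>x\<in>F. U x)"
    by metis
  define M where "M = (\<Union>x\<in>F. L x)"
  define W where "W = (\<Union>x\<in>F. U x) \<inter> V"
  have M: "compact M" using F UL by (auto simp: M_def)
  have W: "open W" "K \<subseteq> W" "W \<subseteq> M" "W \<subseteq> V" using F UL V by (auto simp: W_def M_def dest: subsetD[OF UL(4)])
  have "Hausdorff_space (euclidean :: 'a topology)"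
    by (simp add: Hausdorff_space_def disjnt_def) (meson hausdorff)
  then have "completely_regular_space (euclidean :: 'a topology)"
    by (intro locally_compact_regular_imp_completely_regular_space[OF lc]) simp
  moreover have "compactin euclidean K" "closedin euclidean (- W)" "disjnt K (- W)"
    using K W by (auto simp: disjnt_def)
  ultimately obtain f where f: "continuous_map (euclidean :: 'a topology) (subtopology euclidean {0..1::real}) f"
      "f ` (- W) \<subseteq> {0}" "f ` K \<subseteq> {1}"
    using Urysohn_completely_regular_compact_closed[of 0 1 "euclidean :: 'a topology" K "- W"] zero_le_one
    by metis
  have cont: "continuous_on UNIV f" and r: "\<And>x. f x \<in> {0..1}"
    using f(1) by (simp_all add: continuous_map_in_subtopology Pi_iff image_subset_iff)
  show thesis
  proof
    show "f \<in> Cc"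
      using f(2) W by (intro CcI[OF cont M]) auto
    show "0 \<le> f x" "f x \<le> 1" for x using r[of x] by auto
    show "f x = 1" if "x \<in> K" for x using f(3) that by auto
    show "f x = 0" if "x \<notin> V" for x
      using f(2) that contra_subsetD[OF W(4) that] by (simp add: image_subset_iff)
  qed
qed

section \<open>Positive linear functionals\<close>

text \<open>Positivity already yields boundedness on functions supported in a compact set
  (\<open>pl_locally_bounded\<close>), and values outside \<open>Cc\<close> are left free. This
  suits auxiliary functionals that are specified on \<open>Cc\<close> only.\<close>

definition positive_linear :: "(('a::topological_space \<Rightarrow> real) \<Rightarrow> real) \<Rightarrow> bool" where
  "positive_linear \<mu> \<longleftrightarrow>
     (\<forall>\<phi>\<in>Cc. \<forall>\<psi>\<in>Cc. \<mu> (\<lambda>x. \<phi> x + \<psi> x) = \<mu> \<phi> + \<mu> \<psi>) \<and>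
     (\<forall>c. \<forall>\<phi>\<in>Cc. \<mu> (\<lambda>x. c * \<phi> x) = c * \<mu> \<phi>) \<and>
     (\<forall>\<phi>\<in>Cc. (\<forall>x. 0 \<le> \<phi> x) \<longrightarrow> 0 \<le> \<mu> \<phi>)"

lemma positive_linearI:
  assumes "\<And>\<phi> \<psi>. \<phi> \<in> Cc \<Longrightarrow> \<psi> \<in> Cc \<Longrightarrow> \<mu> (\<lambda>x. \<phi> x + \<psi> x) = \<mu> \<phi> + \<mu> \<psi>"
    and "\<And>c \<phi>. \<phi> \<in> Cc \<Longrightarrow> \<mu> (\<lambda>x. c * \<phi> x) = c * \<mu> \<phi>"
    and "\<And>\<phi>. \<phi> \<in> Cc \<Longrightarrow> (\<And>x. 0 \<le> \<phi> x) \<Longrightarrow> 0 \<le> \<mu> \<phi>"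
  shows "positive_linear \<mu>"
  using assms by (auto simp: positive_linear_def)

lemma positive_linear_cong:
  assumes "\<And>\<phi>. \<phi> \<in> Cc \<Longrightarrow> \<mu> \<phi> = \<nu> \<phi>"
  shows "positive_linear \<mu> \<longleftrightarrow> positive_linear (\<nu> :: ('a::t2_space \<Rightarrow> real) \<Rightarrow> real)"
  unfolding positive_linear_def by (auto simp: assms Cc_add Cc_cmult)

context
  fixes \<mu> :: "('a::t2_space \<Rightarrow> real) \<Rightarrow> real"
  assumes \<mu>: "positive_linear \<mu>"
begin

lemma pl_add: "\<phi> \<in> Cc \<Longrightarrow> \<psi> \<in> Cc \<Longrightarrow> \<mu> (\<lambda>x. \<phi> x + \<psi> x) = \<mu> \<phi> + \<mu> \<psi>"
  using \<mu> by (auto simp: positive_linear_def)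

lemma pl_cmult: "\<phi> \<in> Cc \<Longrightarrow> \<mu> (\<lambda>x. c * \<phi> x) = c * \<mu> \<phi>"
  using \<mu> by (auto simp: positive_linear_def)

lemma pl_nonneg: "\<phi> \<in> Cc \<Longrightarrow> (\<And>x. 0 \<le> \<phi> x) \<Longrightarrow> 0 \<le> \<mu> \<phi>"
  using \<mu> by (auto simp: positive_linear_def)

lemma pl_zero: "\<mu> (\<lambda>_. 0) = 0"
  using pl_cmult[of "\<lambda>_. 0" 0] by simp

lemma pl_uminus: "\<phi> \<in> Cc \<Longrightarrow> \<mu> (\<lambda>x. - \<phi> x) = - \<mu> \<phi>"
  using pl_cmult[of \<phi> "-1"] by simp

lemma pl_diff: "\<phi> \<in> Cc \<Longrightarrow> \<psi> \<in> Cc \<Longrightarrow> \<mu> (\<lambda>x. \<phi> x - \<psi> x) = \<mu> \<phi> - \<mu> \<psi>"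
  using pl_add[of \<phi> "\<lambda>x. - \<psi> x"] by (simp add: Cc_uminus pl_uminus)

lemma pl_mono: "\<phi> \<in> Cc \<Longrightarrow> \<psi> \<in> Cc \<Longrightarrow> (\<And>x. \<phi> x \<le> \<psi> x) \<Longrightarrow> \<mu> \<phi> \<le> \<mu> \<psi>"
  using pl_nonneg[of "\<lambda>x. \<psi> x - \<phi> x"] by (simp add: Cc_diff pl_diff)

lemma pl_abs_le:
  assumes "\<phi> \<in> Cc" "\<psi> \<in> Cc" "\<And>x. \<bar>\<phi> x\<bar> \<le> \<psi> x"
  shows "\<bar>\<mu> \<phi>\<bar> \<le> \<mu> \<psi>"
proof -
  have "\<mu> \<phi> \<le> \<mu> \<psi>" "\<mu> (\<lambda>x. - \<phi> x) \<le> \<mu> \<psi>"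
    using assms by (auto intro!: pl_mono Cc_uminus simp: abs_le_iff)
  then show ?thesis using assms by (simp add: pl_uminus)
qed

text \<open>A function bounded by b and zero off K is dominated by b times a Urysohn function \<eta>
  equal to 1 on K, so \<mu>(\<eta>) serves as M.\<close>

lemma pl_locally_bounded:
  assumes lc: "locally_compact_space (euclidean :: 'a topology)" and K: "compact K"
  shows "\<exists>M\<ge>0. \<forall>\<phi>\<in>Cc. \<forall>b. (\<forall>x. x \<notin> K \<longrightarrow> \<phi> x = 0) \<longrightarrow> (\<forall>x. \<bar>\<phi> x\<bar> \<le> b) \<longrightarrow> \<bar>\<mu> \<phi>\<bar> \<le> M * b"
proof -
  obtain \<eta> where \<eta>: "\<eta> \<in> Cc" "\<And>x. 0 \<le> \<eta> x" "\<And>x. x \<in> K \<Longrightarrow> \<eta> x = 1"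
    by (rule urysohn_Cc[OF lc K open_UNIV]) auto
  have "\<bar>\<mu> \<phi>\<bar> \<le> \<mu> \<eta> * b"
    if "\<phi> \<in> Cc" "\<forall>x. x \<notin> K \<longrightarrow> \<phi> x = 0" "\<forall>x. \<bar>\<phi> x\<bar> \<le> b" for \<phi> b
  proof -
    have "0 \<le> b" using that(3) abs_ge_zero order_trans by blast
    then have "\<bar>\<phi> x\<bar> \<le> b * \<eta> x" for x
      using that \<eta>(2,3)[of x] by (cases "x \<in> K") auto
    then have "\<bar>\<mu> \<phi>\<bar> \<le> \<mu> (\<lambda>x. b * \<eta> x)"
      using that \<eta> by (intro pl_abs_le Cc_cmult) auto
    then show ?thesis using \<eta> by (simp add: pl_cmult mult.commute)
  qed
  then show ?thesis using pl_nonneg[OF \<eta>(1,2)] by blast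
qed

end

lemma positive_linear_add:
  fixes \<mu> \<nu> :: "('a::t2_space \<Rightarrow> real) \<Rightarrow> real"
  assumes "positive_linear \<mu>" "positive_linear \<nu>"
  shows "positive_linear (\<lambda>\<phi>. \<mu> \<phi> + \<nu> \<phi>)"
proof (rule positive_linearI)
  fix \<phi> :: "'a \<Rightarrow> real" assume \<phi>: "\<phi> \<in> Cc"
  show "\<mu> (\<lambda>x. \<phi> x + \<psi> x) + \<nu> (\<lambda>x. \<phi> x + \<psi> x) = \<mu> \<phi> + \<nu> \<phi> + (\<mu> \<psi> + \<nu> \<psi>)" if "\<psi> \<in> Cc" for \<psi>
    using pl_add[OF assms(1) \<phi> that] pl_add[OF assms(2) \<phi> that] by simp
  show "\<mu> (\<lambda>x. c * \<phi> x) + \<nu> (\<lambda>x. c * \<phi> x) = c * (\<mu> \<phi> + \<nu> \<phi>)" for c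
    using pl_cmult[OF assms(1) \<phi>] pl_cmult[OF assms(2) \<phi>] by (simp add: distrib_left)
  show "0 \<le> \<mu> \<phi> + \<nu> \<phi>" if "\<And>x. 0 \<le> \<phi> x"
    using pl_nonneg[OF assms(1) \<phi> that] pl_nonneg[OF assms(2) \<phi> that] by simp
qed

lemma positive_linear_cmult:
  fixes \<mu> :: "('a::t2_space \<Rightarrow> real) \<Rightarrow> real"
  assumes "positive_linear \<mu>" "0 \<le> c"
  shows "positive_linear (\<lambda>\<phi>. c * \<mu> \<phi>)"
proof (rule positive_linearI)
  fix \<phi> :: "'a \<Rightarrow> real" assume \<phi>: "\<phi> \<in> Cc"
  show "c * \<mu> (\<lambda>x. \<phi> x + \<psi> x) = c * \<mu> \<phi> + c * \<mu> \<psi>" if "\<psi> \<in> Cc" for \<psi>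
    using pl_add[OF assms(1) \<phi> that] by (simp add: distrib_left)
  show "c * \<mu> (\<lambda>x. d * \<phi> x) = d * (c * \<mu> \<phi>)" for d
    using pl_cmult[OF assms(1) \<phi>] by simp
  show "0 \<le> c * \<mu> \<phi>" if "\<And>x. 0 \<le> \<phi> x"
    using pl_nonneg[OF assms(1) \<phi> that] assms(2) by simp
qed

lemma radon_pos_iff:
  fixes \<mu> :: "('a::t2_space \<Rightarrow> real) \<Rightarrow> real"
  assumes lc: "locally_compact_space (euclidean :: 'a topology)"
  shows "\<mu> \<in> radon_pos \<longleftrightarrow> positive_linear \<mu> \<and> (\<forall>\<phi>. \<phi> \<notin> Cc \<longrightarrow> \<mu> \<phi> = 0)"
proof
  assume "\<mu> \<in> radon_pos"
  then show "positive_linear \<mu> \<and> (\<forall>\<phi>. \<phi> \<notin> Cc \<longrightarrow> \<mu> \<phi> = 0)"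
    by (auto simp: radon_pos_def radon_def positive_linear_def)
next
  assume *: "positive_linear \<mu> \<and> (\<forall>\<phi>. \<phi> \<notin> Cc \<longrightarrow> \<mu> \<phi> = 0)"
  then have "\<forall>K. compact K \<longrightarrow> (\<exists>M. \<forall>\<phi>\<in>Cc. \<forall>b. (\<forall>x. x \<notin> K \<longrightarrow> \<phi> x = 0) \<longrightarrow>
      (\<forall>x. \<bar>\<phi> x\<bar> \<le> b) \<longrightarrow> \<bar>\<mu> \<phi>\<bar> \<le> M * b)"
  proof (intro allI impI)
    fix K :: "'a set" assume "compact K"
    with pl_locally_bounded[OF conjunct1[OF *] lc this]
    show "\<exists>M. \<forall>\<phi>\<in>Cc. \<forall>b. (\<forall>x. x \<notin> K \<longrightarrow> \<phi> x = 0) \<longrightarrow>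
      (\<forall>x. \<bar>\<phi> x\<bar> \<le> b) \<longrightarrow> \<bar>\<mu> \<phi>\<bar> \<le> M * b"
      by (elim exE conjE) (rule exI)
  qed
  then show "\<mu> \<in> radon_pos"
    using * by (simp add: radon_pos_def radon_def positive_linear_def)
qed

section \<open>Upper envelopes of continuous functions\<close>

lemma directed_finite_upper_bound:
  assumes "D \<noteq> {}" and dir: "\<And>a b. a \<in> D \<Longrightarrow> b \<in> D \<Longrightarrow> \<exists>c\<in>D. \<forall>x. a x \<le> c x \<and> b x \<le> (c x :: real)"
    and "finite E" "E \<subseteq> D"
  shows "\<exists>c\<in>D. \<forall>a\<in>E. \<forall>x. a x \<le> c x"
  using assms(3,4)
proof (induction E)
  case empty
  then show ?case using assms(1) by auto
next
  case (insert a E)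
  then obtain c where c: "c \<in> D" "\<forall>a\<in>E. \<forall>x. a x \<le> c x" by auto
  obtain c' where "c' \<in> D" "\<forall>x. a x \<le> c' x \<and> c x \<le> c' x"
    using dir[of a c] insert.prems c(1) by auto
  moreover have "b x \<le> c' x" if "b \<in> E" for b x
    using that c(2) calculation(2) order_trans by blast
  ultimately show ?case by (intro bexI[of _ c']) auto
qed

text \<open>The open sets where \<psi> < d cover K; a finite subcover is merged into a single member
  of D by directedness.\<close>

lemma dini_directed:
  fixes D :: "('a::topological_space \<Rightarrow> real) set"
  assumes "D \<noteq> {}" and dir: "\<And>a b. a \<in> D \<Longrightarrow> b \<in> D \<Longrightarrow> \<exists>c\<in>D. \<forall>x. a x \<le> c x \<and> b x \<le> c x"
    and cont: "\<And>d. d \<in> D \<Longrightarrow> continuous_on UNIV d" "continuous_on UNIV \<psi>"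
    and K: "compact K" and sup: "\<And>x. x \<in> K \<Longrightarrow> \<exists>d\<in>D. \<psi> x < d x"
  shows "\<exists>d\<in>D. \<forall>x\<in>K. \<psi> x < d x"
proof -
  have "K \<subseteq> (\<Union>d\<in>D. {x. \<psi> x < d x})" using sup by auto
  moreover have "open {x. \<psi> x < d x}" if "d \<in> D" for d
    using that cont by (intro open_Collect_less) auto
  ultimately obtain E where E: "E \<subseteq> D" "finite E" "K \<subseteq> (\<Union>d\<in>E. {x. \<psi> x < d x})"
    using compactE_image[OF K, of D "\<lambda>d. {x. \<psi> x < d x}"] by blast
  obtain c where c: "c \<in> D" "\<forall>a\<in>E. \<forall>x. a x \<le> c x"
    using directed_finite_upper_bound[OF assms(1) dir E(2,1)] by blast
  have "\<psi> x < c x" if x: "x \<in> K" for x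
  proof -
    obtain a where "a \<in> E" "\<psi> x < a x" using x E(3) by blast
    then show ?thesis using c(2) by (meson less_le_trans)
  qed
  then show ?thesis using c by blast
qed

text \<open>Dini's theorem only controls \<open>D\<close> on a compact set; outside the supports of \<open>\<phi>\<close> and of a
  fixed \<open>d\<^sub>0 \<in> D\<close> one has \<open>\<phi> = 0 \<le> d\<close> for all \<open>d \<ge> d\<^sub>0\<close>.\<close>

lemma pl_le_directed_SUP:
  fixes D :: "('a::t2_space \<Rightarrow> real) set"
  assumes lc: "locally_compact_space (euclidean :: 'a topology)" and \<mu>: "positive_linear \<mu>"
    and "D \<noteq> {}" and dir: "\<And>a b. a \<in> D \<Longrightarrow> b \<in> D \<Longrightarrow> \<exists>c\<in>D. \<forall>x. a x \<le> c x \<and> b x \<le> c x"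
    and D: "D \<subseteq> Cc" and \<phi>: "\<phi> \<in> Cc"
    and sup: "\<And>x e. e > 0 \<Longrightarrow> \<exists>d\<in>D. \<phi> x - e < d x"
  shows "ereal (\<mu> \<phi>) \<le> (SUP d\<in>D. ereal (\<mu> d))"
proof (rule ereal_le_epsilon2)
  fix e :: real assume e: "0 < e"
  obtain d0 where d0: "d0 \<in> D" using \<open>D \<noteq> {}\<close> by auto
  obtain K1 where K1: "compact K1" "\<And>x. x \<notin> K1 \<Longrightarrow> \<phi> x = 0" using Cc_vanishes[OF \<phi>] by auto
  have "d0 \<in> Cc" using d0 D by auto
  then obtain K2 where K2: "compact K2" "\<And>x. x \<notin> K2 \<Longrightarrow> d0 x = 0"
    using Cc_vanishes by blast
  have K: "compact (K1 \<union> K2)" using K1 K2 by auto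
  obtain \<eta> where \<eta>: "\<eta> \<in> Cc" "\<And>x. 0 \<le> \<eta> x" "\<And>x. x \<in> K1 \<union> K2 \<Longrightarrow> \<eta> x = 1"
    by (rule urysohn_Cc[OF lc K open_UNIV]) auto
  have \<mu>\<eta>: "0 \<le> \<mu> \<eta>" using pl_nonneg[OF \<mu>] \<eta> by auto
  \<comment> \<open>The 1 in the denominator covers \<mu>(\<eta>) = 0; the correction r \<eta> then
    costs at most e.\<close>
  define r where "r = e / (\<mu> \<eta> + 1)"
  have r: "r > 0" "r * \<mu> \<eta> \<le> e" using e \<mu>\<eta> by (auto simp: r_def field_simps)
  have "\<exists>d\<in>D. \<forall>x\<in>K1 \<union> K2. \<phi> x - r < d x"
    using D by (intro dini_directed[OF assms(3) dir _ _ K sup[OF r(1)]] continuous_intros Cc_continuous \<phi>) auto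
  then obtain d1 where d1: "d1 \<in> D" "\<And>x. x \<in> K1 \<union> K2 \<Longrightarrow> \<phi> x - r < d1 x" by blast
  obtain d where d: "d \<in> D" "\<And>x. d0 x \<le> d x" "\<And>x. d1 x \<le> d x"
    using dir[OF d0 d1(1)] by auto
  have dC: "d \<in> Cc" using d D by auto
  have "\<phi> x \<le> d x + r * \<eta> x" for x
  proof (cases "x \<in> K1 \<union> K2")
    case True
    then show ?thesis using d1(2)[OF True] d(3)[of x] \<eta>(3) by auto
  next
    case False
    then show ?thesis using K1 K2 d(2)[of x] \<eta>(2)[of x] r by auto
  qed
  then have "\<mu> \<phi> \<le> \<mu> (\<lambda>x. d x + r * \<eta> x)"
    by (intro pl_mono[OF \<mu>] Cc_intros) (use \<phi> dC \<eta> in auto)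
  also have "\<dots> = \<mu> d + r * \<mu> \<eta>"
    using dC \<eta> by (simp add: pl_add[OF \<mu>] pl_cmult[OF \<mu>] Cc_cmult)
  finally have "ereal (\<mu> \<phi>) \<le> ereal (\<mu> d) + ereal e" using r by simp
  also have "\<dots> \<le> (SUP d\<in>D. ereal (\<mu> d)) + ereal e"
    using d by (intro add_right_mono SUP_upper) auto
  finally show "ereal (\<mu> \<phi>) \<le> (SUP d\<in>D. ereal (\<mu> d)) + ereal e" .
qed

definition Cc_below :: "('a::topological_space \<Rightarrow> ereal) \<Rightarrow> ('a \<Rightarrow> real) set" where
  "Cc_below f = {\<phi>\<in>Cc. \<forall>x. ereal (\<phi> x) \<le> f x}"

text \<open>The pointwise suprema of \<open>Cc\<close> functions. Asking for a minorant excludes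
  only the constant -\<infinity>; on a locally compact space these are the lower semicontinuous
  functions with a minorant in \<open>Cc\<close>, whatever their sign
  (\<open>Cc_envelope_iff\<close>).\<close>

definition Cc_envelope :: "('a::topological_space \<Rightarrow> ereal) \<Rightarrow> bool" where
  "Cc_envelope f \<longleftrightarrow> Cc_below f \<noteq> {} \<and> (\<forall>x c. ereal c < f x \<longrightarrow> (\<exists>\<phi>\<in>Cc_below f. c < \<phi> x))"

lemma Cc_belowI: "\<phi> \<in> Cc \<Longrightarrow> (\<And>x. ereal (\<phi> x) \<le> f x) \<Longrightarrow> \<phi> \<in> Cc_below f"
  and Cc_belowD: "\<phi> \<in> Cc_below f \<Longrightarrow> \<phi> \<in> Cc" "\<phi> \<in> Cc_below f \<Longrightarrow> ereal (\<phi> x) \<le> f x"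
  by (auto simp: Cc_below_def)

lemma Cc_below_max: "\<phi> \<in> Cc_below f \<Longrightarrow> \<psi> \<in> Cc_below f \<Longrightarrow> (\<lambda>x::'a::t2_space. max (\<phi> x) (\<psi> x)) \<in> Cc_below f"
  by (intro Cc_belowI Cc_max) (auto simp: Cc_below_def)

lemma Cc_envelope_not_MInf: "Cc_envelope f \<Longrightarrow> f x \<noteq> -\<infinity>"
  by (auto simp: Cc_envelope_def Cc_below_def) (metis MInfty_neq_ereal(1) ereal_infty_less_eq(2))

lemma Cc_envelopeE:
  assumes "Cc_envelope f" obtains \<phi> where "\<phi> \<in> Cc" "\<And>x. ereal (\<phi> x) \<le> f x"
  using assms by (auto simp: Cc_envelope_def Cc_below_def)

lemma Cc_envelopeD: "Cc_envelope f \<Longrightarrow> ereal c < f x \<Longrightarrow> \<exists>\<phi>\<in>Cc_below f. c < \<phi> x"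
  by (auto simp: Cc_envelope_def)

lemma Cc_envelope_Cc: "\<phi> \<in> Cc \<Longrightarrow> Cc_envelope (\<lambda>x. ereal (\<phi> x))"
  by (auto simp: Cc_envelope_def Cc_below_def intro: exI[of _ \<phi>])

lemma lower_semicontI:
  assumes "\<And>x c. ereal c < f x \<Longrightarrow> \<exists>V. open V \<and> x \<in> V \<and> (\<forall>y\<in>V. ereal c < f y)"
    and "\<And>x. f x \<noteq> -\<infinity>"
  shows "lower_semicont f"
  unfolding lower_semicont_def
proof
  fix a :: ereal
  have "\<exists>T. open T \<and> x \<in> T \<and> T \<subseteq> {x. a < f x}" if a: "a < f x" for x
    proof (cases "a = -\<infinity>")
      case True
      then show ?thesis using assms(2) by (intro exI[of _ UNIV]) auto
    next
      case False
      then obtain c where c: "a = ereal c" using a by (cases a) auto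
      then show ?thesis using assms(1)[of c x] a by auto
    qed
  then show "open {x. a < f x}" by (subst open_subopen) auto
qed

lemma Cc_envelope_imp_lower_semicont:
  assumes "Cc_envelope f" shows "lower_semicont f"
proof (rule lower_semicontI)
  fix x c assume "ereal c < f x"
  then obtain \<phi> where \<phi>: "\<phi> \<in> Cc" "\<And>x. ereal (\<phi> x) \<le> f x" "c < \<phi> x"
    using Cc_envelopeD[OF assms] by (meson Cc_belowD)
  then have "open {y. c < \<phi> y}"
    by (intro open_Collect_less continuous_on_const Cc_continuous)
  then show "\<exists>V. open V \<and> x \<in> V \<and> (\<forall>y\<in>V. ereal c < f y)"
    using \<phi> by (intro exI[of _ "{y. c < \<phi> y}"]) (auto intro: less_le_trans[OF _ \<phi>(2)])
qed (use Cc_envelope_not_MInf assms in auto)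

text \<open>Near a point x a given minorant can be raised by a Urysohn bump to any level below f x,
  since f stays above that level on a neighbourhood.\<close>

lemma Cc_envelope_iff:
  fixes f :: "'a::t2_space \<Rightarrow> ereal"
  assumes lc: "locally_compact_space (euclidean :: 'a topology)"
  shows "Cc_envelope f \<longleftrightarrow> lower_semicont f \<and> (\<exists>\<phi>\<in>Cc. \<forall>x. ereal (\<phi> x) \<le> f x)"
proof
  assume "Cc_envelope f"
  then show "lower_semicont f \<and> (\<exists>\<phi>\<in>Cc. \<forall>x. ereal (\<phi> x) \<le> f x)"
    using Cc_envelope_imp_lower_semicont Cc_envelopeE by metis
next
  assume "lower_semicont f \<and> (\<exists>\<phi>\<in>Cc. \<forall>x. ereal (\<phi> x) \<le> f x)"
  then obtain \<phi>0 where f: "lower_semicont f" and \<phi>0: "\<phi>0 \<in> Cc" "\<And>x. ereal (\<phi>0 x) \<le> f x" by auto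
  have "\<exists>\<phi>\<in>Cc_below f. c < \<phi> x" if c: "ereal c < f x" for x c
  proof (cases "c < \<phi>0 x")
    case True
    then show ?thesis using \<phi>0 by (auto simp: Cc_below_def)
  next
    case False
    obtain c' where c': "c < c'" "ereal c' < f x"
      using ereal_dense2[OF c] by (auto simp: less_ereal.simps)
    obtain r where r: "c' < r" "ereal r < f x"
      using ereal_dense2[OF c'(2)] by auto
    define s where "s = c' - \<phi>0 x"
    have s: "s > 0" using False c' by (simp add: s_def)
    \<comment> \<open>On V even \<phi>0 + s stays below r < f, so adding a bump of height s that
      vanishes off V keeps the function below f; at x it reaches c' > c.\<close>
    define V where "V = {y. \<phi>0 y + s < r} \<inter> {y. ereal r < f y}"
    have "open V"
      unfolding V_def
    proof (rule open_Int)
      show "open {y. \<phi>0 y + s < r}"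
        by (intro open_Collect_less continuous_intros Cc_continuous \<phi>0(1))
      show "open {y. ereal r < f y}" using f by (simp add: lower_semicont_def)
    qed
    moreover have "{x} \<subseteq> V" using r by (auto simp: V_def s_def)
    ultimately obtain \<eta> where \<eta>: "\<eta> \<in> Cc" "\<And>x. 0 \<le> \<eta> x" "\<And>x. \<eta> x \<le> 1" "\<eta> x = 1"
      "\<And>x. x \<notin> V \<Longrightarrow> \<eta> x = 0"
      using urysohn_Cc[OF lc, of "{x}" V] by auto
    have "ereal (\<phi>0 y + s * \<eta> y) \<le> f y" for y
    proof (cases "y \<in> V")
      case True
      have "\<phi>0 y + s * \<eta> y \<le> r" using True mult_left_mono[OF \<eta>(3) less_imp_le[OF s], of y] unfolding V_def mem_Collect_eq Int_iff by linarith
      then have "ereal (\<phi>0 y + s * \<eta> y) \<le> ereal r" by simp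
      also have "\<dots> \<le> f y" using True by (simp add: V_def less_imp_le)
      finally show ?thesis .
    qed (use \<eta> \<phi>0 in auto)
    then have "(\<lambda>y. \<phi>0 y + s * \<eta> y) \<in> Cc_below f"
      using \<phi>0 \<eta> by (intro Cc_belowI Cc_intros) auto
    then show ?thesis using \<eta>(4) c' by (intro bexI) (auto simp: s_def)
  qed
  then show "Cc_envelope f"
    using \<phi>0 by (auto simp: Cc_envelope_def Cc_below_def)
qed

text \<open>Addition in \<open>ereal\<close> is tested on reals strictly below each summand. A
  summand -\<infinity> has none below it, while -\<infinity> + \<infinity> = \<infinity>, hence the
  two exclusions.\<close>

lemma ereal_add_le_I:
  fixes a b c :: ereal
  assumes "\<And>r s. ereal r < a \<Longrightarrow> ereal s < b \<Longrightarrow> ereal (r + s) \<le> c" "a \<noteq> -\<infinity>" "b \<noteq> -\<infinity>"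
  shows "a + b \<le> c"
proof (rule ccontr)
  assume "\<not> a + b \<le> c"
  then obtain z where z: "c < ereal z" "ereal z < a + b"
    using ereal_dense2[of c "a + b"] by (auto simp: not_le)
  have "\<exists>r s. ereal r < a \<and> ereal s < b \<and> z \<le> r + s"
  proof (cases a)
    case (real a')
    show ?thesis
    proof (cases b)
      case (real b')
      then have "z < a' + b'" using z \<open>a = ereal a'\<close> by simp
      then show ?thesis
        using real \<open>a = ereal a'\<close>
        by (intro exI[of _ "a' - (a' + b' - z) / 2"] exI[of _ "b' - (a' + b' - z) / 2"]) (auto simp: field_simps)
    next
      case PInf
      then show ?thesis using real by (intro exI[of _ "a' - 1"] exI[of _ "z - a' + 1"]) auto
    qed (use assms in auto)
  next
    case PInf
    show ?thesis
    proof (cases b)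
      case (real b')
      then show ?thesis using PInf by (intro exI[of _ "z - b' + 1"] exI[of _ "b' - 1"]) auto
    next
      case PInf
      then show ?thesis using \<open>a = \<infinity>\<close> by (intro exI[of _ z] exI[of _ 0]) auto
    qed (use assms in auto)
  qed (use assms in auto)
  then obtain r s where "ereal r < a" "ereal s < b" "z \<le> r + s" by auto
  then have "ereal z \<le> c" using assms(1)[of r s] by (meson ereal_less_eq(3) order_trans)
  then show False using z by auto
qed

lemma Cc_envelope_add:
  fixes f g :: "'a::t2_space \<Rightarrow> ereal"
  assumes f: "Cc_envelope f" and g: "Cc_envelope g"
  shows "Cc_envelope (\<lambda>x. f x + g x)"
proof -
  have add: "(\<lambda>x. \<phi> x + \<psi> x) \<in> Cc_below (\<lambda>x. f x + g x)" if "\<phi> \<in> Cc_below f" "\<psi> \<in> Cc_below g" for \<phi> \<psi>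
    using that by (auto simp: Cc_below_def Cc_add simp flip: plus_ereal.simps(1) intro: add_mono)
  have "\<exists>\<phi>\<in>Cc_below (\<lambda>x. f x + g x). c < \<phi> x" if c: "ereal c < f x + g x" for x c
  proof (rule ccontr)
    assume *: "\<not> ?thesis"
    have "f x + g x \<le> ereal c"
    proof (rule ereal_add_le_I)
      fix r s assume "ereal r < f x" "ereal s < g x"
      then obtain \<phi> \<psi> where "\<phi> \<in> Cc_below f" "r < \<phi> x" "\<psi> \<in> Cc_below g" "s < \<psi> x"
        using Cc_envelopeD f g by meson
      then show "ereal (r + s) \<le> ereal c"
        using * add[of \<phi> \<psi>] by fastforce
    qed (use f g Cc_envelope_not_MInf in auto)
    then show False using c by auto
  qed
  moreover have "Cc_below (\<lambda>x. f x + g x) \<noteq> {}"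
    using add f g by (fastforce simp: Cc_envelope_def)
  ultimately show ?thesis by (auto simp: Cc_envelope_def)
qed

lemma Cc_envelope_max0:
  fixes f :: "'a::t2_space \<Rightarrow> ereal"
  assumes f: "Cc_envelope f"
  shows "Cc_envelope (\<lambda>x. max 0 (f x))"
proof -
  have mem: "(\<lambda>x. max 0 (\<phi> x)) \<in> Cc_below (\<lambda>x. max 0 (f x))" if "\<phi> \<in> Cc_below f" for \<phi>
    using that by (intro Cc_belowI) (auto simp: Cc_below_def Cc_max0 ereal_max zero_ereal_def simp del: ereal_max_0 intro: max.coboundedI2)
  have 0: "(\<lambda>x. 0) \<in> Cc_below (\<lambda>x. max 0 (f x))"
    by (auto simp: Cc_below_def zero_ereal_def)
  have "\<exists>\<phi>\<in>Cc_below (\<lambda>x. max 0 (f x)). c < \<phi> x" if c: "ereal c < max 0 (f x)" for x c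
  proof (cases "c < 0")
    case False
    then have "ereal c < f x" using c by (auto simp: max_def zero_ereal_def split: if_splits)
    then show ?thesis using Cc_envelopeD[OF f] mem by (metis max_less_iff_conj less_max_iff_disj)
  next
    case True
    then show ?thesis using 0 by (intro bexI[OF _ 0]) auto
  qed
  then show ?thesis using 0 by (auto simp: Cc_envelope_def)
qed

lemma Cc_envelope_min0:
  fixes f :: "'a::t2_space \<Rightarrow> ereal"
  assumes f: "Cc_envelope f"
  shows "Cc_envelope (\<lambda>x. min 0 (f x))"
proof -
  have mem: "(\<lambda>x. min 0 (\<phi> x)) \<in> Cc_below (\<lambda>x. min 0 (f x))" if "\<phi> \<in> Cc_below f" for \<phi>
    using that by (intro Cc_belowI) (auto simp: Cc_below_def Cc_min0 ereal_min zero_ereal_def intro: min.coboundedI2)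
  have "\<exists>\<phi>\<in>Cc_below (\<lambda>x. min 0 (f x)). c < \<phi> x" if c: "ereal c < min 0 (f x)" for x c
  proof -
    have "ereal c < f x" "c < 0" using c by (auto simp: zero_ereal_def)
    then show ?thesis using Cc_envelopeD[OF f] mem by (metis min_less_iff_conj)
  qed
  moreover have "Cc_below (\<lambda>x. min 0 (f x)) \<noteq> {}"
    using mem f by (auto simp: Cc_envelope_def)
  ultimately show ?thesis by (auto simp: Cc_envelope_def)
qed

lemma Cc_envelope_diff_Cc:
  "Cc_envelope f \<Longrightarrow> \<phi> \<in> Cc \<Longrightarrow> Cc_envelope (\<lambda>x::'a::t2_space. f x - ereal (\<phi> x))"
  using Cc_envelope_add[of f "\<lambda>x. ereal (- \<phi> x)"] Cc_envelope_Cc[OF Cc_uminus, of \<phi>]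
  by (simp add: minus_ereal_def)

section \<open>Integration of upper envelopes\<close>

text \<open>Unlike \<^const>\<open>lsc_integral\<close>, the supremum is not restricted to nonnegative minorants.  It is
  therefore additive on all envelopes, and no splitting into positive and negative parts is needed.\<close>

definition lint :: "(('a::topological_space \<Rightarrow> real) \<Rightarrow> real) \<Rightarrow> ('a \<Rightarrow> ereal) \<Rightarrow> ereal" where
  "lint \<mu> f = (SUP \<phi>\<in>Cc_below f. ereal (\<mu> \<phi>))"

lemma lint_upper: "\<phi> \<in> Cc_below f \<Longrightarrow> ereal (\<mu> \<phi>) \<le> lint \<mu> f"
  unfolding lint_def by (rule SUP_upper)

lemma lint_least: "(\<And>\<phi>. \<phi> \<in> Cc_below f \<Longrightarrow> ereal (\<mu> \<phi>) \<le> c) \<Longrightarrow> lint \<mu> f \<le> c"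
  unfolding lint_def by (rule SUP_least)

lemma lint_lessD: "c < lint \<mu> f \<Longrightarrow> \<exists>\<phi>\<in>Cc_below f. c < ereal (\<mu> \<phi>)"
  unfolding lint_def by (simp add: less_SUP_iff)

lemma lint_mono:
  assumes "\<And>x. f x \<le> g x" shows "lint \<mu> f \<le> lint \<mu> g"
proof (rule lint_least)
  fix \<phi> assume "\<phi> \<in> Cc_below f"
  then have "\<phi> \<in> Cc_below g" using assms order_trans unfolding Cc_below_def by blast
  then show "ereal (\<mu> \<phi>) \<le> lint \<mu> g" by (rule lint_upper)
qed

lemma lint_cong_measure:
  assumes "\<And>\<phi>. \<phi> \<in> Cc \<Longrightarrow> \<mu> \<phi> = \<nu> \<phi>" shows "lint \<mu> f = lint \<nu> f"
  unfolding lint_def by (rule SUP_cong) (auto simp: Cc_below_def assms)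

lemma lint_not_MInf:
  assumes "Cc_envelope f" shows "lint \<mu> f \<noteq> -\<infinity>"
proof -
  obtain \<phi> where "\<phi> \<in> Cc_below f" using assms by (auto simp: Cc_envelope_def)
  then show ?thesis using lint_upper[of \<phi> f \<mu>] by auto
qed

lemma lint_Cc:
  fixes \<phi> :: "'a::t2_space \<Rightarrow> real"
  assumes \<mu>: "positive_linear \<mu>" and "\<phi> \<in> Cc"
  shows "lint \<mu> (\<lambda>x. ereal (\<phi> x)) = ereal (\<mu> \<phi>)"
proof (rule antisym)
  show "lint \<mu> (\<lambda>x. ereal (\<phi> x)) \<le> ereal (\<mu> \<phi>)"
    using pl_mono[OF \<mu>] assms(2) by (intro lint_least) (auto simp: Cc_below_def)
  show "ereal (\<mu> \<phi>) \<le> lint \<mu> (\<lambda>x. ereal (\<phi> x))"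
    using assms(2) by (intro lint_upper Cc_belowI) auto
qed

lemma lint_nonneg:
  fixes f :: "'a::t2_space \<Rightarrow> ereal"
  assumes "positive_linear \<mu>" "\<And>x. 0 \<le> f x"
  shows "0 \<le> lint \<mu> f"
proof -
  have "(\<lambda>_. 0) \<in> Cc_below f" using assms(2) by (intro Cc_belowI) (auto simp: zero_ereal_def)
  from lint_upper[OF this, of \<mu>] show ?thesis by (simp add: pl_zero[OF assms(1)] zero_ereal_def)
qed

text \<open>The functionals are compared on nonnegative test functions only, so a minorant of f is
  first replaced by its positive part, which is still a minorant because f \<ge> 0.\<close>

lemma lint_mono_measure:
  fixes f :: "'a::t2_space \<Rightarrow> ereal"
  assumes \<mu>: "positive_linear \<mu>" and le: "\<And>\<phi>. \<phi> \<in> Cc \<Longrightarrow> (\<And>x. 0 \<le> \<phi> x) \<Longrightarrow> \<mu> \<phi> \<le> \<nu> \<phi>"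
    and f: "\<And>x. 0 \<le> f x"
  shows "lint \<mu> f \<le> lint \<nu> f"
proof (rule lint_least)
  fix \<phi> assume \<phi>: "\<phi> \<in> Cc_below f"
  define \<psi> where "\<psi> = (\<lambda>x. max 0 (\<phi> x))"
  have \<psi>: "\<psi> \<in> Cc" "\<And>x. 0 \<le> \<psi> x" "\<And>x. \<phi> x \<le> \<psi> x"
    using Cc_max0[OF Cc_belowD(1)[OF \<phi>]] by (auto simp: \<psi>_def)
  have "\<psi> \<in> Cc_below f"
    using \<phi> f \<psi>(1) by (auto simp: Cc_below_def \<psi>_def max_def zero_ereal_def)
  have "\<mu> \<phi> \<le> \<nu> \<psi>"
    using pl_mono[OF \<mu> Cc_belowD(1)[OF \<phi>] \<psi>(1,3)] le[OF \<psi>(1,2)] by simp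
  then have "ereal (\<mu> \<phi>) \<le> ereal (\<nu> \<psi>)" by simp
  also have "\<dots> \<le> lint \<nu> f" by (rule lint_upper) fact
  finally show "ereal (\<mu> \<phi>) \<le> lint \<nu> f" .
qed

lemma lint_cmult_measure:
  assumes "0 \<le> c" "Cc_envelope f"
  shows "lint (\<lambda>\<phi>. c * \<mu> \<phi>) f = ereal c * lint \<mu> f"
proof -
  \<comment> \<open>A nonempty family makes the supremum 0 for c = 0, matching 0 * \<infinity> = 0
    in \<open>ereal\<close>.\<close>
  have ne: "Cc_below f \<noteq> {}" using assms by (auto simp: Cc_envelope_def)
  show ?thesis
  proof (cases "c = 0")
    case True
    then show ?thesis using ne by (simp add: lint_def zero_ereal_def[symmetric])
  next
    case False
    then have c: "0 < c" using assms by simp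
    show ?thesis
    proof (rule antisym)
      show "lint (\<lambda>\<phi>. c * \<mu> \<phi>) f \<le> ereal c * lint \<mu> f"
        using c by (intro lint_least) (auto simp flip: times_ereal.simps(1) intro!: ereal_mult_left_mono lint_upper)
      have "lint \<mu> f \<le> lint (\<lambda>\<phi>. c * \<mu> \<phi>) f / ereal c"
      proof (rule lint_least)
        fix \<phi> assume "\<phi> \<in> Cc_below f"
        then have "ereal (c * \<mu> \<phi>) \<le> lint (\<lambda>\<phi>. c * \<mu> \<phi>) f" by (rule lint_upper)
        then have "ereal (c * \<mu> \<phi>) / ereal c \<le> lint (\<lambda>\<phi>. c * \<mu> \<phi>) f / ereal c"
          using c by (intro ereal_divide_right_mono) auto
        then show "ereal (\<mu> \<phi>) \<le> lint (\<lambda>\<phi>. c * \<mu> \<phi>) f / ereal c"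
          using c by simp
      qed
      then show "ereal c * lint \<mu> f \<le> lint (\<lambda>\<phi>. c * \<mu> \<phi>) f"
        using c by (simp add: ereal_le_divide_pos)
    qed
  qed
qed

context
  fixes \<mu> :: "('a::t2_space \<Rightarrow> real) \<Rightarrow> real"
  assumes lc: "locally_compact_space (euclidean :: 'a topology)" and \<mu>: "positive_linear \<mu>"
begin

text \<open>Smoothness of a positive functional along directed families: each \<open>Cc\<close>
  minorant of f is reached pointwise by D up to any e, and Dini's theorem makes this uniform. No
  countability of D is involved.\<close>

lemma lint_le_directed_SUP:
  assumes "D \<noteq> {}" and dir: "\<And>a b. a \<in> D \<Longrightarrow> b \<in> D \<Longrightarrow> \<exists>c\<in>D. \<forall>x. a x \<le> c x \<and> b x \<le> c x"
    and D: "D \<subseteq> Cc"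
    and sup: "\<And>x c. ereal c < f x \<Longrightarrow> \<exists>d\<in>D. c < d x"
  shows "lint \<mu> f \<le> (SUP d\<in>D. ereal (\<mu> d))"
proof (rule lint_least)
  fix \<phi> assume \<phi>: "\<phi> \<in> Cc_below f"
  show "ereal (\<mu> \<phi>) \<le> (SUP d\<in>D. ereal (\<mu> d))"
  proof (rule pl_le_directed_SUP[OF lc \<mu> assms(1) dir D Cc_belowD(1)[OF \<phi>]])
    fix x and e :: real assume "e > 0"
    then have "ereal (\<phi> x - e) < ereal (\<phi> x)" by simp
    also have "\<dots> \<le> f x" using \<phi> by (rule Cc_belowD)
    finally show "\<exists>d\<in>D. \<phi> x - e < d x" by (rule sup)
  qed
qed

lemma lint_add:
  assumes f: "Cc_envelope f" and g: "Cc_envelope g"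
  shows "lint \<mu> (\<lambda>x. f x + g x) = lint \<mu> f + lint \<mu> g"
proof (rule antisym)
  show "lint \<mu> f + lint \<mu> g \<le> lint \<mu> (\<lambda>x. f x + g x)"
  proof (rule ereal_add_le_I)
    fix r s assume "ereal r < lint \<mu> f" "ereal s < lint \<mu> g"
    then obtain \<phi> \<psi> where \<phi>: "\<phi> \<in> Cc_below f" "r < \<mu> \<phi>" and \<psi>: "\<psi> \<in> Cc_below g" "s < \<mu> \<psi>"
      by (auto dest!: lint_lessD)
    have "(\<lambda>x. \<phi> x + \<psi> x) \<in> Cc_below (\<lambda>x. f x + g x)"
      using \<phi>(1) \<psi>(1) by (auto simp: Cc_below_def Cc_add simp flip: plus_ereal.simps(1) intro: add_mono)
    from lint_upper[OF this, of \<mu>] have *: "ereal (\<mu> \<phi> + \<mu> \<psi>) \<le> lint \<mu> (\<lambda>x. f x + g x)"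
      by (simp add: pl_add[OF \<mu> Cc_belowD(1)[OF \<phi>(1)] Cc_belowD(1)[OF \<psi>(1)]])
    have "ereal (r + s) \<le> ereal (\<mu> \<phi> + \<mu> \<psi>)" using \<phi> \<psi> by simp
    then show "ereal (r + s) \<le> lint \<mu> (\<lambda>x. f x + g x)" using * by (rule order_trans)
  qed (simp_all add: lint_not_MInf f g)
next
  \<comment> \<open>Sums of minorants form a directed family, by taking the maxima in each summand
    separately, and their pointwise supremum is f + g.\<close>
  define D where "D = {\<lambda>x. \<phi> x + \<psi> x |\<phi> \<psi>. \<phi> \<in> Cc_below f \<and> \<psi> \<in> Cc_below g}"
  have "lint \<mu> (\<lambda>x. f x + g x) \<le> (SUP d\<in>D. ereal (\<mu> d))"
  proof (rule lint_le_directed_SUP)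
    show "D \<noteq> {}" using f g by (auto simp: D_def Cc_envelope_def)
    show "D \<subseteq> Cc" by (auto simp: D_def intro!: Cc_add dest: Cc_belowD(1))
    fix a b assume "a \<in> D" "b \<in> D"
    then obtain \<phi> \<psi> \<phi>' \<psi>' where 1: "a = (\<lambda>x. \<phi> x + \<psi> x)" "b = (\<lambda>x. \<phi>' x + \<psi>' x)"
      "\<phi> \<in> Cc_below f" "\<phi>' \<in> Cc_below f" "\<psi> \<in> Cc_below g" "\<psi>' \<in> Cc_below g"
      by (auto simp: D_def)
    then have "(\<lambda>x. max (\<phi> x) (\<phi>' x) + max (\<psi> x) (\<psi>' x)) \<in> D"
      unfolding D_def mem_Collect_eq using Cc_below_max[OF 1(3,4)] Cc_below_max[OF 1(5,6)]
      by (intro exI[of _ "\<lambda>x. max (\<phi> x) (\<phi>' x)"] exI[of _ "\<lambda>x. max (\<psi> x) (\<psi>' x)"]) simp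
    then show "\<exists>c\<in>D. \<forall>x. a x \<le> c x \<and> b x \<le> c x"
      by (rule bexI[rotated]) (auto simp: 1 intro: add_mono)
  next
    fix x c assume c: "ereal c < f x + g x"
    show "\<exists>d\<in>D. c < d x"
    proof (rule ccontr)
      assume *: "\<not> ?thesis"
      have "f x + g x \<le> ereal c"
      proof (rule ereal_add_le_I)
        fix r s assume "ereal r < f x" "ereal s < g x"
        then obtain \<phi> \<psi> where 1: "\<phi> \<in> Cc_below f" "r < \<phi> x" "\<psi> \<in> Cc_below g" "s < \<psi> x"
          using Cc_envelopeD f g by meson
        then have "(\<lambda>x. \<phi> x + \<psi> x) \<in> D" by (auto simp: D_def)
        with * have "\<phi> x + \<psi> x \<le> c" by (meson not_less)
        then show "ereal (r + s) \<le> ereal c" using 1 by simp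
      qed (use f g Cc_envelope_not_MInf in auto)
      then show False using c by auto
    qed
  qed
  also have "\<dots> \<le> lint \<mu> f + lint \<mu> g"
  proof (rule SUP_least)
    fix d assume "d \<in> D"
    then obtain \<phi> \<psi> where 1: "d = (\<lambda>x. \<phi> x + \<psi> x)" "\<phi> \<in> Cc_below f" "\<psi> \<in> Cc_below g"
      by (auto simp: D_def)
    then have "ereal (\<mu> d) = ereal (\<mu> \<phi>) + ereal (\<mu> \<psi>)"
      using pl_add[OF \<mu>] by (auto dest: Cc_belowD(1))
    also have "\<dots> \<le> lint \<mu> f + lint \<mu> g"
      by (intro add_mono lint_upper 1)
    finally show "ereal (\<mu> d) \<le> lint \<mu> f + lint \<mu> g" .
  qed
  finally show "lint \<mu> (\<lambda>x. f x + g x) \<le> lint \<mu> f + lint \<mu> g" .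
qed

lemma lint_diff_Cc:
  assumes f: "Cc_envelope f" and \<phi>: "\<phi> \<in> Cc"
  shows "lint \<mu> (\<lambda>x. f x - ereal (\<phi> x)) = lint \<mu> f - ereal (\<mu> \<phi>)"
  using lint_add[OF f Cc_envelope_Cc[OF Cc_uminus[OF \<phi>]]]
  by (simp add: lint_Cc[OF \<mu> Cc_uminus[OF \<phi>]] pl_uminus[OF \<mu> \<phi>] minus_ereal_def)

text \<open>Near-optimal minorants for \<mu> and for \<nu> differ, but their maximum is a minorant
  that is near-optimal for both.\<close>

lemma lint_add_measure:
  assumes \<nu>: "positive_linear \<nu>" and f: "Cc_envelope f"
  shows "lint (\<lambda>\<phi>. \<mu> \<phi> + \<nu> \<phi>) f = lint \<mu> f + lint \<nu> f"
proof (rule antisym)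
  show "lint (\<lambda>\<phi>. \<mu> \<phi> + \<nu> \<phi>) f \<le> lint \<mu> f + lint \<nu> f"
    by (rule lint_least) (auto simp flip: plus_ereal.simps(1) intro!: add_mono lint_upper)
  show "lint \<mu> f + lint \<nu> f \<le> lint (\<lambda>\<phi>. \<mu> \<phi> + \<nu> \<phi>) f"
  proof (rule ereal_add_le_I)
    fix r s assume "ereal r < lint \<mu> f" "ereal s < lint \<nu> f"
    then obtain \<phi> \<psi> where \<phi>: "\<phi> \<in> Cc_below f" "r < \<mu> \<phi>" and \<psi>: "\<psi> \<in> Cc_below f" "s < \<nu> \<psi>"
      by (auto dest!: lint_lessD)
    define \<theta> where "\<theta> = (\<lambda>x. max (\<phi> x) (\<psi> x))"
    have \<theta>: "\<theta> \<in> Cc_below f" unfolding \<theta>_def by (rule Cc_below_max) fact+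
    have "\<mu> \<phi> \<le> \<mu> \<theta>" "\<nu> \<psi> \<le> \<nu> \<theta>"
      using \<phi> \<psi> \<theta> by (auto intro!: pl_mono[OF \<mu>] pl_mono[OF \<nu>] dest: Cc_belowD(1) simp: \<theta>_def)
    then have "ereal (r + s) \<le> ereal (\<mu> \<theta> + \<nu> \<theta>)" using \<phi> \<psi> by simp
    also have "\<dots> \<le> lint (\<lambda>\<phi>. \<mu> \<phi> + \<nu> \<phi>) f"
      using lint_upper[OF \<theta>, of "\<lambda>\<phi>. \<mu> \<phi> + \<nu> \<phi>"] by simp
    finally show "ereal (r + s) \<le> lint (\<lambda>\<phi>. \<mu> \<phi> + \<nu> \<phi>) f" .
  qed (simp_all add: lint_not_MInf f)
qed

text \<open>Monotone convergence: the minorants of all the f n together form a directed family,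
  because those of f m are minorants of f n for m \<le> n.\<close>

lemma lint_sup_sequence:
  fixes f :: "nat \<Rightarrow> 'a \<Rightarrow> ereal"
  assumes f: "\<And>n. Cc_envelope (f n)" and mono: "\<And>m n x. m \<le> n \<Longrightarrow> f m x \<le> f n x"
  shows "Cc_envelope (\<lambda>x. SUP n. f n x)" and "lint \<mu> (\<lambda>x. SUP n. f n x) \<le> (SUP n. lint \<mu> (f n))"
proof -
  define D where "D = (\<Union>n. Cc_below (f n))"
  have sup: "\<exists>d\<in>D. c < d x" if c: "ereal c < (SUP n. f n x)" for x c
  proof -
    obtain n where "ereal c < f n x" using c unfolding less_SUP_iff by auto
    then show ?thesis using Cc_envelopeD[OF f] by (fastforce simp: D_def)
  qed
  have sub: "D \<subseteq> Cc_below (\<lambda>x. SUP n. f n x)"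
    by (auto simp: D_def Cc_below_def intro: SUP_upper2)
  have ne: "D \<noteq> {}" using f[of 0] by (auto simp: D_def Cc_envelope_def)
  show "Cc_envelope (\<lambda>x. SUP n. f n x)"
    unfolding Cc_envelope_def
  proof (intro conjI allI impI)
    show "Cc_below (\<lambda>x. SUP n. f n x) \<noteq> {}" using ne sub by auto
    fix x c assume "ereal c < (SUP n. f n x)"
    from sup[OF this] obtain d where "d \<in> D" "c < d x" ..
    then show "\<exists>\<phi>\<in>Cc_below (\<lambda>x. SUP n. f n x). c < \<phi> x" using sub by (intro bexI[of _ d]) auto
  qed
  have "lint \<mu> (\<lambda>x. SUP n. f n x) \<le> (SUP d\<in>D. ereal (\<mu> d))"
  proof (rule lint_le_directed_SUP[OF ne _ _ sup])
    show "D \<subseteq> Cc" using sub by (auto dest: Cc_belowD(1))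
    fix a b assume "a \<in> D" "b \<in> D"
    then obtain m n where mn: "a \<in> Cc_below (f m)" "b \<in> Cc_below (f n)" by (auto simp: D_def)
    have below_mono: "d \<in> Cc_below (f (max m n))" if d: "d \<in> Cc_below (f k)" and k: "k \<le> max m n" for d k
    proof (rule Cc_belowI)
      show "d \<in> Cc" using d by (rule Cc_belowD)
      show "ereal (d x) \<le> f (max m n) x" for x
        using Cc_belowD(2)[OF d, of x] mono[OF k, of x] by (rule order_trans)
    qed
    have "a \<in> Cc_below (f (max m n))" "b \<in> Cc_below (f (max m n))"
      by (rule below_mono[OF mn(1)] below_mono[OF mn(2)], simp)+
    from Cc_below_max[OF this] show "\<exists>c\<in>D. \<forall>x. a x \<le> c x \<and> b x \<le> c x"
      by (intro bexI[of _ "\<lambda>x. max (a x) (b x)"]) (auto simp: D_def)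
  qed
  also have "\<dots> \<le> (SUP n. lint \<mu> (f n))"
  proof (rule SUP_least)
    fix d assume "d \<in> D"
    then obtain n where "d \<in> Cc_below (f n)" by (auto simp: D_def)
    then show "ereal (\<mu> d) \<le> (SUP n. lint \<mu> (f n))" by (intro SUP_upper2[of n] lint_upper) auto
  qed
  finally show "lint \<mu> (\<lambda>x. SUP n. f n x) \<le> (SUP n. lint \<mu> (f n))" .
qed

end

section \<open>Bourbaki integrals as envelope integrals\<close>

lemma lsc_integral_eq_lint:
  fixes h :: "'a::t2_space \<Rightarrow> ereal"
  assumes \<mu>: "positive_linear \<mu>" and h: "\<And>x. 0 \<le> h x"
  shows "lsc_integral \<mu> h = lint \<mu> h"
proof (rule antisym)
  show "lsc_integral \<mu> h \<le> lint \<mu> h"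
    unfolding lsc_integral_def lint_def by (rule SUP_subset_mono) (auto simp: Cc_below_def)
  show "lint \<mu> h \<le> lsc_integral \<mu> h"
  proof (rule lint_least)
    fix \<phi> assume \<phi>: "\<phi> \<in> Cc_below h"
    then have C: "\<phi> \<in> Cc" by (rule Cc_belowD)
    have "ereal (max 0 (\<phi> x)) \<le> h x" for x
      using Cc_belowD(2)[OF \<phi>, of x] h[of x] by (auto simp: max_def zero_ereal_def)
    then have "ereal (\<mu> (\<lambda>x. max 0 (\<phi> x))) \<le> lsc_integral \<mu> h"
      unfolding lsc_integral_def using Cc_max0[OF C] by (intro SUP_upper) auto
    moreover have "ereal (\<mu> \<phi>) \<le> ereal (\<mu> (\<lambda>x. max 0 (\<phi> x)))"
      using pl_mono[OF \<mu> C Cc_max0[OF C]] by auto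
    ultimately show "ereal (\<mu> \<phi>) \<le> lsc_integral \<mu> h" by (rule order_trans[rotated])
  qed
qed

lemma lsc_integral_cong_measure:
  assumes "\<And>\<phi>. \<phi> \<in> Cc \<Longrightarrow> \<mu> \<phi> = \<nu> \<phi>" shows "lsc_integral \<mu> h = lsc_integral \<nu> h"
  unfolding lsc_integral_def by (rule SUP_cong) (auto simp: assms)

lemma upper_integral_cong_measure:
  assumes "\<And>\<phi>. \<phi> \<in> Cc \<Longrightarrow> \<mu> \<phi> = \<nu> \<phi>" shows "upper_integral \<mu> f = upper_integral \<nu> f"
  unfolding upper_integral_def by (rule INF_cong[OF refl lsc_integral_cong_measure[OF assms]])

lemma upper_integral_mono:
  assumes "\<And>x. f x \<le> g x" shows "upper_integral \<mu> f \<le> upper_integral \<mu> g"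
  unfolding upper_integral_def by (rule INF_superset_mono) (auto intro: order_trans[OF assms])

text \<open>A lower semicontinuous h is itself the least admissible majorant in the infimum.\<close>

lemma upper_integral_eq_lint:
  fixes h :: "'a::t2_space \<Rightarrow> ereal"
  assumes \<mu>: "positive_linear \<mu>" and h: "\<And>x. 0 \<le> h x" "lower_semicont h"
  shows "upper_integral \<mu> h = lint \<mu> h"
proof (rule antisym)
  show "upper_integral \<mu> h \<le> lint \<mu> h"
    unfolding upper_integral_def using h
    by (intro INF_lower2[of h]) (auto simp: lsc_integral_eq_lint[OF \<mu>])
  show "lint \<mu> h \<le> upper_integral \<mu> h"
    unfolding upper_integral_def
  proof (rule INF_greatest)
    fix g assume g: "g \<in> {g. lower_semicont g \<and> (\<forall>x. h x \<le> g x)}"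
    then have "0 \<le> g x" for x using h(1)[of x] order_trans by blast
    then have "lsc_integral \<mu> g = lint \<mu> g" by (rule lsc_integral_eq_lint[OF \<mu>])
    then show "lint \<mu> h \<le> lsc_integral \<mu> g" using g by (auto intro: lint_mono)
  qed
qed

lemma upper_integral_zero_measure:
  assumes "\<And>\<phi>. \<phi> \<in> Cc \<Longrightarrow> \<mu> \<phi> = 0" and f: "\<And>x::'a::t2_space. 0 \<le> f x"
  shows "upper_integral \<mu> f = 0"
proof -
  have 0: "lsc_integral \<mu> h = 0" if "\<And>x. 0 \<le> h x" for h
  proof -
    have "(\<lambda>_. 0) \<in> {\<phi> \<in> Cc. \<forall>x. 0 \<le> \<phi> x \<and> ereal (\<phi> x) \<le> h x}"
      using that by (auto simp: zero_ereal_def)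
    then have "{\<phi> \<in> Cc. \<forall>x. 0 \<le> \<phi> x \<and> ereal (\<phi> x) \<le> h x} \<noteq> {}" by blast
    moreover have "lsc_integral \<mu> h = (SUP \<phi>\<in>{\<phi> \<in> Cc. \<forall>x. 0 \<le> \<phi> x \<and> ereal (\<phi> x) \<le> h x}. 0)"
      unfolding lsc_integral_def by (rule SUP_cong) (auto simp: assms(1))
    ultimately show ?thesis by simp
  qed
  have eq: "lsc_integral \<mu> h = 0" if "h \<in> {h. lower_semicont h \<and> (\<forall>x. f x \<le> h x)}" for h
    using that f order_trans by (intro 0) blast
  \<comment> \<open>The constant \<infinity> is an admissible majorant, so the infimum of zeros is
    not taken over the empty set, where it would be \<infinity>.\<close>
  have "(\<lambda>_. \<infinity>) \<in> {h. lower_semicont h \<and> (\<forall>x. f x \<le> h x)}"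
    by (auto simp: lower_semicont_def)
  then have "{h. lower_semicont h \<and> (\<forall>x. f x \<le> h x)} \<noteq> {}" by blast
  moreover have "upper_integral \<mu> f = (INF h\<in>{h. lower_semicont h \<and> (\<forall>x. f x \<le> h x)}. 0)"
    unfolding upper_integral_def by (rule INF_cong[OF refl eq])
  ultimately show ?thesis by simp
qed

text \<open>The negative part is -g with g = min 0 f an envelope. It is upper semicontinuous, so its
  upper integral is a genuine infimum. Negated \<open>Cc\<close> minorants of g are continuous
  majorants of -g, which gives one inequality; for any lower semicontinuous h \<ge> -g the sum h + g
  is nonnegative, and additivity gives the other.\<close>

lemma upper_integral_neg:
  fixes f :: "'a::t2_space \<Rightarrow> ereal"
  assumes lc: "locally_compact_space (euclidean :: 'a topology)" and \<mu>: "positive_linear \<mu>"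
    and f: "Cc_envelope f"
  shows "upper_integral \<mu> (\<lambda>x. max 0 (- f x)) = - lint \<mu> (\<lambda>x. min 0 (f x))"
proof -
  define g where "g = (\<lambda>x. min 0 (f x))"
  have g: "Cc_envelope g" unfolding g_def by (rule Cc_envelope_min0[OF f])
  have neg: "max 0 (- f x) = - g x" for x
    by (cases "f x") (auto simp: g_def min_def max_def zero_ereal_def)
  have g0: "g x \<le> 0" for x by (simp add: g_def)
  have "lint \<mu> g \<le> - upper_integral \<mu> (\<lambda>x. - g x)"
  proof (rule lint_least)
    fix \<phi> assume \<phi>: "\<phi> \<in> Cc_below g"
    then have C: "(\<lambda>x. - \<phi> x) \<in> Cc" by (intro Cc_uminus) (rule Cc_belowD)
    have "ereal (\<phi> x) \<le> 0" for x using Cc_belowD(2)[OF \<phi>, of x] g0[of x] by (rule order_trans)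
    then have pos: "0 \<le> ereal (- \<phi> x)" for x by (simp add: zero_ereal_def)
    have "upper_integral \<mu> (\<lambda>x. - g x) \<le> upper_integral \<mu> (\<lambda>x. ereal (- \<phi> x))"
      using Cc_belowD(2)[OF \<phi>] by (intro upper_integral_mono) (simp flip: uminus_ereal.simps(1))
    also have "\<dots> = ereal (\<mu> (\<lambda>x. - \<phi> x))"
      using upper_integral_eq_lint[OF \<mu> pos Cc_envelope_imp_lower_semicont[OF Cc_envelope_Cc[OF C]]]
      by (simp only: lint_Cc[OF \<mu> C])
    also have "\<dots> = - ereal (\<mu> \<phi>)" using pl_uminus[OF \<mu> Cc_belowD(1)[OF \<phi>]] by simp
    finally show "ereal (\<mu> \<phi>) \<le> - upper_integral \<mu> (\<lambda>x. - g x)"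
      using ereal_minus_le_minus by fastforce
  qed
  then have le: "upper_integral \<mu> (\<lambda>x. - g x) \<le> - lint \<mu> g"
    using ereal_minus_le_minus by fastforce
  have "- lint \<mu> g \<le> upper_integral \<mu> (\<lambda>x. - g x)"
    unfolding upper_integral_def
  proof (rule INF_greatest)
    fix h assume "h \<in> {h. lower_semicont h \<and> (\<forall>x. - g x \<le> h x)}"
    then have h: "lower_semicont h" "\<And>x. - g x \<le> h x" by auto
    have h0: "0 \<le> h x" for x
    proof -
      have "0 \<le> - g x" using g0[of x] by simp
      then show ?thesis using h(2) by (rule order_trans)
    qed
    have hE: "Cc_envelope h"
      unfolding Cc_envelope_iff[OF lc] using h(1) h0 by (auto intro!: bexI[of _ "\<lambda>_. 0"] simp flip: zero_ereal_def)
    have "0 \<le> lint \<mu> (\<lambda>x. h x + g x)"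
    proof (rule lint_nonneg[OF \<mu>])
      fix x
      have "- g x + g x = 0" using g0[of x] Cc_envelope_not_MInf[OF g, of x] by (cases "g x") auto
      then show "0 \<le> h x + g x" using add_right_mono[OF h(2), of x "g x"] by simp
    qed
    also have "\<dots> = lint \<mu> h + lint \<mu> g" by (rule lint_add[OF lc \<mu> hE g])
    finally have "0 \<le> lint \<mu> h + lint \<mu> g" .
    then have "- lint \<mu> g \<le> lint \<mu> h"
      using lint_not_MInf[OF g, of \<mu>] by (cases "lint \<mu> g"; cases "lint \<mu> h") auto
    then show "- lint \<mu> g \<le> lsc_integral \<mu> h" by (simp add: lsc_integral_eq_lint[OF \<mu> h0])
  qed
  with le have "upper_integral \<mu> (\<lambda>x. - g x) = - lint \<mu> g" by (rule antisym)
  then show ?thesis by (simp only: neg) (simp only: g_def)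
qed

text \<open>The minorant in \<open>Cc\<close> bounds the integral of the negative part, so the
  integral of an envelope against a positive functional never takes the form \<infinity> -
  \<infinity>.\<close>

lemma lint_pos_neg_parts:
  fixes f :: "'a::t2_space \<Rightarrow> ereal"
  assumes lc: "locally_compact_space (euclidean :: 'a topology)" and \<mu>: "positive_linear \<mu>"
    and f: "Cc_envelope f"
  shows "lint \<mu> f = lint \<mu> (\<lambda>x. max 0 (f x)) + lint \<mu> (\<lambda>x. min 0 (f x))"
    and "0 \<le> lint \<mu> (\<lambda>x. max 0 (f x))"
    and "\<bar>lint \<mu> (\<lambda>x. min 0 (f x))\<bar> \<noteq> \<infinity>"
proof -
  have "f x = max 0 (f x) + min 0 (f x)" for x by (cases "0 \<le> f x") (auto simp: max_def min_def)
  then have "lint \<mu> f = lint \<mu> (\<lambda>x. max 0 (f x) + min 0 (f x))" by (simp only: HOL.ext)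
  also have "\<dots> = lint \<mu> (\<lambda>x. max 0 (f x)) + lint \<mu> (\<lambda>x. min 0 (f x))"
    by (intro lint_add[OF lc \<mu>] Cc_envelope_max0 Cc_envelope_min0 f)
  finally show "lint \<mu> f = lint \<mu> (\<lambda>x. max 0 (f x)) + lint \<mu> (\<lambda>x. min 0 (f x))" .
  show "0 \<le> lint \<mu> (\<lambda>x. max 0 (f x))" by (rule lint_nonneg[OF \<mu>]) simp
  have "lint \<mu> (\<lambda>x. min 0 (f x)) \<le> lint \<mu> (\<lambda>x. ereal 0)"
    by (rule lint_mono) (simp flip: zero_ereal_def)
  also have "\<dots> = 0" by (subst lint_Cc[OF \<mu>]) (auto simp: pl_zero[OF \<mu>])
  finally show "\<bar>lint \<mu> (\<lambda>x. min 0 (f x))\<bar> \<noteq> \<infinity>"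
    using lint_not_MInf[OF Cc_envelope_min0[OF f], of \<mu>] by auto
qed

section \<open>Jordan decomposition and signed integrals\<close>

context
  fixes P Q \<rho> :: "('a::t2_space \<Rightarrow> real) \<Rightarrow> real"
  assumes P: "positive_linear P" and Q: "positive_linear Q"
    and \<rho>: "\<And>\<phi>. \<phi> \<in> Cc \<Longrightarrow> \<rho> \<phi> = P \<phi> - Q \<phi>"
begin

lemma difference_add: "\<phi> \<in> Cc \<Longrightarrow> \<psi> \<in> Cc \<Longrightarrow> \<rho> (\<lambda>x. \<phi> x + \<psi> x) = \<rho> \<phi> + \<rho> \<psi>"
  by (simp add: \<rho> Cc_add pl_add[OF P] pl_add[OF Q])

lemma difference_cmult: "\<phi> \<in> Cc \<Longrightarrow> \<rho> (\<lambda>x. c * \<phi> x) = c * \<rho> \<phi>"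
  by (simp add: \<rho> Cc_cmult pl_cmult[OF P] pl_cmult[OF Q] right_diff_distrib)

lemma difference_zero: "\<rho> (\<lambda>x. 0) = 0"
  by (simp add: \<rho> pl_zero[OF P] pl_zero[OF Q])

text \<open>The dominating functional P makes the supremum in \<open>pos_variation\<close> one of a
  bounded set of reals.\<close>

lemma pos_variation_bound:
  assumes "\<psi> \<in> Cc" "\<And>x. 0 \<le> \<psi> x" "\<And>x. \<psi> x \<le> \<phi> x" "\<phi> \<in> Cc"
  shows "\<rho> \<psi> \<le> P \<phi>"
  using pl_mono[OF P assms(1,4,3)] pl_nonneg[OF Q assms(1,2)] by (simp add: \<rho> assms)

lemma pos_variation_upper:
  assumes "\<psi> \<in> Cc" "\<And>x. 0 \<le> \<psi> x" "\<And>x. \<psi> x \<le> \<phi> x" "\<phi> \<in> Cc"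
  shows "\<rho> \<psi> \<le> pos_variation \<rho> \<phi>"
  unfolding pos_variation_def
proof (rule cSUP_upper)
  show "bdd_above (\<rho> ` {\<psi> \<in> Cc. \<forall>x. 0 \<le> \<psi> x \<and> \<psi> x \<le> \<phi> x})"
    by (rule bdd_aboveI2[of _ _ "P \<phi>"]) (auto intro: pos_variation_bound assms(4))
qed (use assms in auto)

lemma pos_variation_least:
  assumes "\<And>x. 0 \<le> \<phi> x" "\<And>\<psi>. \<psi> \<in> Cc \<Longrightarrow> (\<And>x. 0 \<le> \<psi> x) \<Longrightarrow> (\<And>x. \<psi> x \<le> \<phi> x) \<Longrightarrow> \<rho> \<psi> \<le> c"
  shows "pos_variation \<rho> \<phi> \<le> c"
  unfolding pos_variation_def
proof (rule cSUP_least)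
  have "(\<lambda>_. 0) \<in> {\<psi> \<in> Cc. \<forall>x. 0 \<le> \<psi> x \<and> \<psi> x \<le> \<phi> x}" using assms(1) by auto
  then show "{\<psi> \<in> Cc. \<forall>x. 0 \<le> \<psi> x \<and> \<psi> x \<le> \<phi> x} \<noteq> {}" by blast
qed (use assms(2) in auto)

lemma pos_variation_nonneg:
  assumes "\<phi> \<in> Cc" "\<And>x. 0 \<le> \<phi> x"
  shows "0 \<le> pos_variation \<rho> \<phi>"
  using pos_variation_upper[of "\<lambda>_. 0" \<phi>] assms by (simp add: difference_zero)

text \<open>Riesz decomposition: any \<theta> between 0 and \<phi> + \<psi> is the sum of min
  \<theta> \<phi> and a remainder between 0 and \<psi>.\<close>

lemma pos_variation_add:
  assumes \<phi>: "\<phi> \<in> Cc" "\<And>x. 0 \<le> \<phi> x" and \<psi>: "\<psi> \<in> Cc" "\<And>x. 0 \<le> \<psi> x"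
  shows "pos_variation \<rho> (\<lambda>x. \<phi> x + \<psi> x) = pos_variation \<rho> \<phi> + pos_variation \<rho> \<psi>"
proof (rule antisym)
  show "pos_variation \<rho> (\<lambda>x. \<phi> x + \<psi> x) \<le> pos_variation \<rho> \<phi> + pos_variation \<rho> \<psi>"
  proof (rule pos_variation_least)
    fix \<theta> assume \<theta>: "\<theta> \<in> Cc" "\<And>x. 0 \<le> \<theta> x" "\<And>x. \<theta> x \<le> \<phi> x + \<psi> x"
    define a where "a = (\<lambda>x. min (\<theta> x) (\<phi> x))"
    define b where "b = (\<lambda>x. \<theta> x - a x)"
    have C: "a \<in> Cc" "b \<in> Cc" unfolding b_def a_def by (intro Cc_diff Cc_min \<theta> \<phi>)+
    have "\<rho> a \<le> pos_variation \<rho> \<phi>"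
      by (rule pos_variation_upper[OF C(1) _ _ \<phi>(1)]) (auto simp: a_def \<theta>(2) \<phi>(2))
    moreover have "\<rho> b \<le> pos_variation \<rho> \<psi>"
      by (rule pos_variation_upper[OF C(2) _ _ \<psi>(1)])
        (use \<theta>(3) \<psi>(2) in \<open>auto simp: b_def a_def min_def algebra_simps\<close>)
    moreover have "\<theta> = (\<lambda>x. a x + b x)" by (simp add: b_def)
    ultimately show "\<rho> \<theta> \<le> pos_variation \<rho> \<phi> + pos_variation \<rho> \<psi>"
      using difference_add[OF C] by simp
  qed (simp add: \<phi> \<psi>)
  have "pos_variation \<rho> \<psi> \<le> pos_variation \<rho> (\<lambda>x. \<phi> x + \<psi> x) - pos_variation \<rho> \<phi>"
  proof (rule pos_variation_least[OF \<psi>(2)])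
    fix b assume b: "b \<in> Cc" "\<And>x. 0 \<le> b x" "\<And>x. b x \<le> \<psi> x"
    have "pos_variation \<rho> \<phi> \<le> pos_variation \<rho> (\<lambda>x. \<phi> x + \<psi> x) - \<rho> b"
    proof (rule pos_variation_least[OF \<phi>(2)])
      fix a assume a: "a \<in> Cc" "\<And>x. 0 \<le> a x" "\<And>x. a x \<le> \<phi> x"
      have "\<rho> (\<lambda>x. a x + b x) \<le> pos_variation \<rho> (\<lambda>x. \<phi> x + \<psi> x)"
        by (rule pos_variation_upper) (auto intro!: Cc_add add_mono add_nonneg_nonneg a b \<phi> \<psi>)
      then show "\<rho> a \<le> pos_variation \<rho> (\<lambda>x. \<phi> x + \<psi> x) - \<rho> b"
        by (simp add: difference_add a b)
    qed
    then show "\<rho> b \<le> pos_variation \<rho> (\<lambda>x. \<phi> x + \<psi> x) - pos_variation \<rho> \<phi>" by simp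
  qed
  then show "pos_variation \<rho> \<phi> + pos_variation \<rho> \<psi> \<le> pos_variation \<rho> (\<lambda>x. \<phi> x + \<psi> x)" by simp
qed

lemma pos_variation_cmult:
  assumes \<phi>: "\<phi> \<in> Cc" "\<And>x. 0 \<le> \<phi> x" and c: "0 \<le> c"
  shows "pos_variation \<rho> (\<lambda>x. c * \<phi> x) = c * pos_variation \<rho> \<phi>"
proof (cases "c = 0")
  case True
  have "pos_variation \<rho> (\<lambda>x. 0) = 0"
  proof (rule antisym)
    show "pos_variation \<rho> (\<lambda>x. 0) \<le> 0"
    proof (rule pos_variation_least)
      fix \<psi> :: "'a \<Rightarrow> real" assume "\<And>x. 0 \<le> \<psi> x" "\<And>x. \<psi> x \<le> 0"
      then have "\<psi> = (\<lambda>x. 0)" by (intro ext antisym)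
      then show "\<rho> \<psi> \<le> 0" by (simp add: difference_zero)
    qed simp
  qed (rule pos_variation_nonneg, auto)
  then show ?thesis using True by simp
next
  case False
  then have c: "0 < c" using c by simp
  \<comment> \<open>One inequality for all positive factors suffices: with 1/c and c \<phi> in place
    of a and \<psi> it gives the reverse one.\<close>
  have le: "a * pos_variation \<rho> \<psi> \<le> pos_variation \<rho> (\<lambda>x. a * \<psi> x)"
    if a: "0 < a" and \<psi>: "\<psi> \<in> Cc" "\<And>x. 0 \<le> \<psi> x" for a \<psi>
  proof -
    have "pos_variation \<rho> \<psi> \<le> pos_variation \<rho> (\<lambda>x. a * \<psi> x) / a"
    proof (rule pos_variation_least[OF \<psi>(2)])
      fix b assume b: "b \<in> Cc" "\<And>x. 0 \<le> b x" "\<And>x. b x \<le> \<psi> x"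
      have "\<rho> (\<lambda>x. a * b x) \<le> pos_variation \<rho> (\<lambda>x. a * \<psi> x)"
        by (rule pos_variation_upper) (use a b \<psi> in \<open>auto intro!: Cc_cmult\<close>)
      then show "\<rho> b \<le> pos_variation \<rho> (\<lambda>x. a * \<psi> x) / a"
        using a by (simp add: difference_cmult b(1) field_simps)
    qed
    then show ?thesis using a by (simp add: field_simps)
  qed
  have "(1 / c) * pos_variation \<rho> (\<lambda>x. c * \<phi> x) \<le> pos_variation \<rho> (\<lambda>x. (1 / c) * (c * \<phi> x))"
    by (rule le) (use c \<phi> in \<open>auto intro!: Cc_cmult\<close>)
  then have "pos_variation \<rho> (\<lambda>x. c * \<phi> x) \<le> c * pos_variation \<rho> \<phi>"
    using c by (simp add: field_simps)
  with le[OF c \<phi>] show ?thesis by (intro antisym)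
qed

text \<open>The value does not depend on how \<phi> is written as a difference of nonnegative
  functions, so linearity can be checked on a convenient representation instead of on max 0 \<phi>
  and max 0 (-\<phi>).\<close>

lemma pos_part_eq_diff:
  assumes "\<phi> = (\<lambda>x. a x - b x)" and a: "a \<in> Cc" "\<And>x. 0 \<le> a x" and b: "b \<in> Cc" "\<And>x. 0 \<le> b x"
  shows "pos_part \<rho> \<phi> = pos_variation \<rho> a - pos_variation \<rho> b"
proof -
  have C: "\<phi> \<in> Cc" unfolding assms(1) by (rule Cc_diff[OF a(1) b(1)])
  have C': "(\<lambda>x. max 0 (\<phi> x)) \<in> Cc" "(\<lambda>x. max 0 (- \<phi> x)) \<in> Cc"
    using Cc_max0[OF C] Cc_max0[OF Cc_uminus[OF C]] by auto
  have "(\<lambda>x. max 0 (\<phi> x) + b x) = (\<lambda>x. max 0 (- \<phi> x) + a x)"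
    by (auto simp: assms(1) max_def)
  then have "pos_variation \<rho> (\<lambda>x. max 0 (\<phi> x)) + pos_variation \<rho> b
      = pos_variation \<rho> (\<lambda>x. max 0 (- \<phi> x)) + pos_variation \<rho> a"
    using pos_variation_add[OF C'(1) _ b] pos_variation_add[OF C'(2) _ a] by simp
  then show ?thesis using C by (simp add: pos_part_def)
qed

lemma pos_part_nonneg_eq:
  assumes "\<phi> \<in> Cc" "\<And>x. 0 \<le> \<phi> x"
  shows "pos_part \<rho> \<phi> = pos_variation \<rho> \<phi>"
  using pos_part_eq_diff[of \<phi> \<phi> "\<lambda>_. 0"] pos_variation_cmult[of "\<lambda>_. 0" 0] assms by simp

lemma positive_linear_pos_part: "positive_linear (pos_part \<rho>)"
proof (rule positive_linearI)
  fix \<phi> :: "'a \<Rightarrow> real" assume \<phi>: "\<phi> \<in> Cc"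
  have C: "(\<lambda>x. max 0 (\<phi> x)) \<in> Cc" "(\<lambda>x. max 0 (- \<phi> x)) \<in> Cc"
    using Cc_max0[OF \<phi>] Cc_max0[OF Cc_uminus[OF \<phi>]] by auto
  have part: "pos_part \<rho> \<phi> = pos_variation \<rho> (\<lambda>x. max 0 (\<phi> x)) - pos_variation \<rho> (\<lambda>x. max 0 (- \<phi> x))"
    using \<phi> by (simp add: pos_part_def)
  show "pos_part \<rho> (\<lambda>x. \<phi> x + \<psi> x) = pos_part \<rho> \<phi> + pos_part \<rho> \<psi>" if \<psi>: "\<psi> \<in> Cc" for \<psi>
  proof -
    have D: "(\<lambda>x. max 0 (\<psi> x)) \<in> Cc" "(\<lambda>x. max 0 (- \<psi> x)) \<in> Cc"
      using Cc_max0[OF \<psi>] Cc_max0[OF Cc_uminus[OF \<psi>]] by auto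
    have "pos_part \<rho> (\<lambda>x. \<phi> x + \<psi> x) = pos_variation \<rho> (\<lambda>x. max 0 (\<phi> x) + max 0 (\<psi> x))
        - pos_variation \<rho> (\<lambda>x. max 0 (- \<phi> x) + max 0 (- \<psi> x))"
      by (rule pos_part_eq_diff[OF _ Cc_add[OF C(1) D(1)] _ Cc_add[OF C(2) D(2)]]) (auto simp: max_def)
    also have "\<dots> = pos_part \<rho> \<phi> + pos_part \<rho> \<psi>"
      using \<psi> by (simp add: pos_variation_add C D part) (simp add: pos_part_def)
    finally show ?thesis .
  qed
  show "pos_part \<rho> (\<lambda>x. c * \<phi> x) = c * pos_part \<rho> \<phi>" for c
  proof (cases "0 \<le> c")
    case True
    have "pos_part \<rho> (\<lambda>x. c * \<phi> x) = pos_variation \<rho> (\<lambda>x. c * max 0 (\<phi> x))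
        - pos_variation \<rho> (\<lambda>x. c * max 0 (- \<phi> x))"
      by (rule pos_part_eq_diff[OF _ Cc_cmult[OF C(1)] _ Cc_cmult[OF C(2)]]) (use True in \<open>auto simp: max_def\<close>)
    also have "\<dots> = c * pos_part \<rho> \<phi>"
      using True by (simp add: pos_variation_cmult C part right_diff_distrib)
    finally show ?thesis .
  next
    case False
    have "pos_part \<rho> (\<lambda>x. c * \<phi> x) = pos_variation \<rho> (\<lambda>x. (- c) * max 0 (- \<phi> x))
        - pos_variation \<rho> (\<lambda>x. (- c) * max 0 (\<phi> x))"
    proof (rule pos_part_eq_diff[OF _ Cc_cmult[OF C(2)] _ Cc_cmult[OF C(1)]])
      show "(\<lambda>x. c * \<phi> x) = (\<lambda>x. - c * max 0 (- \<phi> x) - - c * max 0 (\<phi> x))" by (auto simp: max_def)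
      show "0 \<le> - c * max 0 (- \<phi> x)" "0 \<le> - c * max 0 (\<phi> x)" for x
        by (rule mult_nonneg_nonneg; use False in simp)+
    qed
    also have "\<dots> = (- c) * pos_variation \<rho> (\<lambda>x. max 0 (- \<phi> x)) - (- c) * pos_variation \<rho> (\<lambda>x. max 0 (\<phi> x))"
      using False by (subst (1 2) pos_variation_cmult) (auto simp: C)
    also have "\<dots> = c * pos_part \<rho> \<phi>"
      unfolding part by (simp add: algebra_simps)
    finally show ?thesis .
  qed
  show "0 \<le> pos_part \<rho> \<phi>" if "\<And>x. 0 \<le> \<phi> x"
    using pos_part_nonneg_eq[OF \<phi> that] pos_variation_nonneg[OF \<phi> that] by simp
qed

lemma pos_part_le:
  assumes "\<phi> \<in> Cc" "\<And>x. 0 \<le> \<phi> x"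
  shows "pos_part \<rho> \<phi> \<le> P \<phi>"
  unfolding pos_part_nonneg_eq[OF assms]
  by (rule pos_variation_least) (auto intro: pos_variation_bound assms)

text \<open>The involution \<psi> -> \<phi> - \<psi> of the order interval from 0 to \<phi> turns
  the supremum of -\<rho> into that of \<rho>, shifted by \<rho>(\<phi>).\<close>

lemma neg_variation_eq:
  assumes \<phi>: "\<phi> \<in> Cc" "\<And>x. 0 \<le> \<phi> x"
  shows "pos_variation (\<lambda>\<phi>. - \<rho> \<phi>) \<phi> = pos_variation \<rho> \<phi> - \<rho> \<phi>"
proof -
  define D where "D = {\<psi> \<in> Cc. \<forall>x. 0 \<le> \<psi> x \<and> \<psi> x \<le> \<phi> x}"
  have inv: "(\<lambda>x. \<phi> x - \<psi> x) \<in> D" if "\<psi> \<in> D" for \<psi>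
    using that \<phi> by (auto simp: D_def Cc_diff)
  have D0: "(\<lambda>_. 0) \<in> D" using \<phi> by (auto simp: D_def)
  have diff: "\<rho> (\<lambda>x. \<phi> x - \<psi> x) = \<rho> \<phi> - \<rho> \<psi>" if "\<psi> \<in> D" for \<psi>
    using that \<phi>(1) by (simp add: D_def \<rho> Cc_diff pl_diff[OF P] pl_diff[OF Q])
  have *: "- \<rho> \<psi> \<le> pos_variation \<rho> \<phi> - \<rho> \<phi>" if "\<psi> \<in> D" for \<psi>
    using pos_variation_upper[of "\<lambda>x. \<phi> x - \<psi> x" \<phi>] inv[OF that] diff[OF that] \<phi>(1) by (auto simp: D_def)
  show ?thesis
  proof (rule antisym)
    show "pos_variation (\<lambda>\<phi>. - \<rho> \<phi>) \<phi> \<le> pos_variation \<rho> \<phi> - \<rho> \<phi>"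
      unfolding pos_variation_def[of "\<lambda>\<phi>. - \<rho> \<phi>"] D_def[symmetric]
      using D0 * by (intro cSUP_least) auto
    have "pos_variation \<rho> \<phi> \<le> pos_variation (\<lambda>\<phi>. - \<rho> \<phi>) \<phi> + \<rho> \<phi>"
    proof (rule pos_variation_least[OF \<phi>(2)])
      fix \<psi> assume "\<psi> \<in> Cc" "\<And>x. 0 \<le> \<psi> x" "\<And>x. \<psi> x \<le> \<phi> x"
      then have \<psi>: "\<psi> \<in> D" by (auto simp: D_def)
      have "- \<rho> (\<lambda>x. \<phi> x - \<psi> x) \<le> pos_variation (\<lambda>\<phi>. - \<rho> \<phi>) \<phi>"
        unfolding pos_variation_def[of "\<lambda>\<phi>. - \<rho> \<phi>"] D_def[symmetric]
      proof (rule cSUP_upper[OF inv[OF \<psi>]])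
        show "bdd_above ((\<lambda>\<psi>. - \<rho> \<psi>) ` D)" by (rule bdd_aboveI2) (rule *)
      qed
      then show "\<rho> \<psi> \<le> pos_variation (\<lambda>\<phi>. - \<rho> \<phi>) \<phi> + \<rho> \<phi>" using diff[OF \<psi>] by simp
    qed
    then show "pos_variation \<rho> \<phi> - \<rho> \<phi> \<le> pos_variation (\<lambda>\<phi>. - \<rho> \<phi>) \<phi>" by simp
  qed
qed

lemma neg_part_eq:
  assumes \<phi>: "\<phi> \<in> Cc"
  shows "neg_part \<rho> \<phi> = pos_part \<rho> \<phi> - \<rho> \<phi>"
proof -
  have C: "(\<lambda>x. max 0 (\<phi> x)) \<in> Cc" "(\<lambda>x. max 0 (- \<phi> x)) \<in> Cc"
    using Cc_max0[OF \<phi>] Cc_max0[OF Cc_uminus[OF \<phi>]] by auto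
  have "(\<lambda>x. \<phi> x + max 0 (- \<phi> x)) = (\<lambda>x. max 0 (\<phi> x))" by (auto simp: max_def)
  then have "\<rho> (\<lambda>x. max 0 (\<phi> x)) = \<rho> \<phi> + \<rho> (\<lambda>x. max 0 (- \<phi> x))"
    using difference_add[OF \<phi> C(2)] by simp
  then show ?thesis
    using \<phi> neg_variation_eq[OF C(1)] neg_variation_eq[OF C(2)]
    by (simp add: neg_part_def pos_part_def)
qed

text \<open>\<open>m\<close> is the infimum of \<open>P\<close> and \<open>Q\<close>; the decomposition \<open>\<rho> = P - Q\<close> need not be minimal.\<close>

lemma jordan_decomposition:
  obtains m where "positive_linear (pos_part \<rho>)" "positive_linear (neg_part \<rho>)" "positive_linear m"
    "\<And>\<phi>. \<phi> \<in> Cc \<Longrightarrow> P \<phi> = pos_part \<rho> \<phi> + m \<phi>" "\<And>\<phi>. \<phi> \<in> Cc \<Longrightarrow> Q \<phi> = neg_part \<rho> \<phi> + m \<phi>"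
proof
  define m where "m = (\<lambda>\<phi>. P \<phi> - pos_part \<rho> \<phi>)"
  note pp = positive_linear_pos_part
  show "positive_linear (pos_part \<rho>)" by (rule pp)
  show "positive_linear m"
    unfolding m_def by (rule positive_linearI)
      (simp_all add: pl_add[OF P] pl_add[OF pp] pl_cmult[OF P] pl_cmult[OF pp] pos_part_le right_diff_distrib)
  show "P \<phi> = pos_part \<rho> \<phi> + m \<phi>" for \<phi> by (simp add: m_def)
  show "Q \<phi> = neg_part \<rho> \<phi> + m \<phi>" if "\<phi> \<in> Cc" for \<phi> by (simp add: m_def neg_part_eq that \<rho>)
  have "positive_linear (\<lambda>\<phi>. pos_part \<rho> \<phi> - \<rho> \<phi>)"
  proof (rule positive_linearI)
    fix \<phi> assume "\<phi> \<in> Cc" "\<And>x::'a. 0 \<le> \<phi> x"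
    then show "0 \<le> pos_part \<rho> \<phi> - \<rho> \<phi>"
      using pos_variation_upper[of \<phi> \<phi>] by (simp add: pos_part_nonneg_eq)
  qed (simp_all add: pl_add[OF pp] pl_cmult[OF pp] difference_add difference_cmult right_diff_distrib)
  then show "positive_linear (neg_part \<rho>)"
    by (subst positive_linear_cong[of _ "\<lambda>\<phi>. pos_part \<rho> \<phi> - \<rho> \<phi>"]) (simp_all add: neg_part_eq)
qed

end

section \<open>Envelopes integrated against a positive functional\<close>

context
  fixes \<mu> :: "('a::t2_space \<Rightarrow> real) \<Rightarrow> real"
  assumes \<mu>: "positive_linear \<mu>"
begin

lemma positive_linear_zero: "positive_linear (\<lambda>_::'a \<Rightarrow> real. 0)"
  by (rule positive_linearI) auto

lemma pos_part_positive:
  assumes "\<phi> \<in> Cc" shows "pos_part \<mu> \<phi> = \<mu> \<phi>"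
proof -
  \<comment> \<open>The Jordan context is used with P = \<mu> and Q = 0.\<close>
  note Z = \<mu> positive_linear_zero
  have var: "pos_variation \<mu> \<psi> = \<mu> \<psi>" if "\<psi> \<in> Cc" "\<And>x. 0 \<le> \<psi> x" for \<psi>
  proof (rule antisym)
    show "pos_variation \<mu> \<psi> \<le> \<mu> \<psi>"
      by (rule pos_variation_least[OF Z]) (auto intro!: that pl_mono[OF \<mu>])
    show "\<mu> \<psi> \<le> pos_variation \<mu> \<psi>"
      by (rule pos_variation_upper[OF Z]) (auto intro!: that)
  qed
  have C: "(\<lambda>x. max 0 (\<phi> x)) \<in> Cc" "(\<lambda>x. max 0 (- \<phi> x)) \<in> Cc"
    using Cc_max0[OF assms] Cc_max0[OF Cc_uminus[OF assms]] by auto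
  have "(\<lambda>x. max 0 (\<phi> x) - max 0 (- \<phi> x)) = \<phi>" by (auto simp: max_def)
  then show ?thesis using assms pl_diff[OF \<mu> C] by (simp add: pos_part_def var C)
qed

lemma neg_part_positive:
  assumes "\<phi> \<in> Cc" shows "neg_part \<mu> \<phi> = 0"
  using neg_part_eq[OF \<mu> positive_linear_zero _ assms] pos_part_positive[OF assms] by simp

context
  fixes f :: "'a \<Rightarrow> ereal"
  assumes lc: "locally_compact_space (euclidean :: 'a topology)" and f: "Cc_envelope f"
begin

lemma integral_pos_positive: "integral_pos \<mu> f = lint \<mu> (\<lambda>x. max 0 (f x))"
proof -
  have "upper_integral (pos_part \<mu>) (\<lambda>x. max 0 (f x)) = upper_integral \<mu> (\<lambda>x. max 0 (f x))"
    by (rule upper_integral_cong_measure) (rule pos_part_positive)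
  also have "\<dots> = lint \<mu> (\<lambda>x. max 0 (f x))"
    by (rule upper_integral_eq_lint[OF \<mu>])
      (auto intro!: Cc_envelope_imp_lower_semicont Cc_envelope_max0 f)
  moreover have "upper_integral (neg_part \<mu>) (\<lambda>x. max 0 (- f x)) = 0"
    by (rule upper_integral_zero_measure) (auto simp: neg_part_positive)
  ultimately show ?thesis by (simp add: integral_pos_def)
qed

lemma integral_neg_positive: "integral_neg \<mu> f = - lint \<mu> (\<lambda>x. min 0 (f x))"
proof -
  have "upper_integral (pos_part \<mu>) (\<lambda>x. max 0 (- f x)) = upper_integral \<mu> (\<lambda>x. max 0 (- f x))"
    by (rule upper_integral_cong_measure) (rule pos_part_positive)
  also have "\<dots> = - lint \<mu> (\<lambda>x. min 0 (f x))"
    by (rule upper_integral_neg[OF lc \<mu> f])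
  moreover have "upper_integral (neg_part \<mu>) (\<lambda>x. max 0 (f x)) = 0"
    by (rule upper_integral_zero_measure) (auto simp: neg_part_positive)
  ultimately show ?thesis by (simp add: integral_neg_def)
qed

lemma radon_integral_positive: "radon_integral \<mu> f = lint \<mu> f"
  using lint_pos_neg_parts(1)[OF lc \<mu> f]
  by (simp add: radon_integral_def integral_pos_positive integral_neg_positive minus_ereal_def)

lemma integral_defined_positive: "integral_defined \<mu> f"
  using lint_pos_neg_parts(3)[OF lc \<mu> f] by (auto simp: integral_defined_def integral_neg_positive)

text \<open>In general -f is not an envelope. Negation exchanges the two parts of the integral, and
  since the negative part of f has a finite one, their difference changes sign without meeting
  \<infinity> - \<infinity>. This is how the external field is integrated.\<close>

lemma radon_integral_uminus_positive: "radon_integral \<mu> (\<lambda>x. - f x) = - lint \<mu> f"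
proof -
  have "integral_pos \<mu> (\<lambda>x. - f x) = integral_neg \<mu> f" "integral_neg \<mu> (\<lambda>x. - f x) = integral_pos \<mu> f"
    by (simp_all add: integral_pos_def integral_neg_def)
  then show ?thesis
    using lint_pos_neg_parts[OF lc \<mu> f]
    by (cases "lint \<mu> (\<lambda>x. min 0 (f x))"; cases "lint \<mu> (\<lambda>x. max 0 (f x))")
      (auto simp: radon_integral_def integral_pos_positive integral_neg_positive)
qed

text \<open>A near-optimal minorant \<phi> approximates f in mean: f - \<phi> is a nonnegative
  envelope, so its upper integral is \<open>lint \<mu> f\<close> minus \<mu>(\<phi>).\<close>

lemma radon_integrable_uminus_positive:
  assumes fin: "lint \<mu> f < \<infinity>"
  shows "radon_integrable \<mu> (\<lambda>x. - f x)"
  unfolding radon_integrable_def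
proof (intro allI impI)
  fix e :: real assume e: "e > 0"
  obtain r where r: "lint \<mu> f = ereal r" using fin lint_not_MInf[OF f, of \<mu>] by (cases "lint \<mu> f") auto
  have "ereal (r - e) < lint \<mu> f" using e r by simp
  then obtain \<phi> where \<phi>: "\<phi> \<in> Cc_below f" "r - e < \<mu> \<phi>" by (auto dest!: lint_lessD)
  have C: "\<phi> \<in> Cc" using \<phi> by (auto dest: Cc_belowD)
  define g where "g = (\<lambda>x. f x - ereal (\<phi> x))"
  have g0: "0 \<le> g x" for x
    using Cc_belowD(2)[OF \<phi>(1), of x] by (cases "f x") (auto simp: g_def)
  have "\<bar>- f x - ereal (- \<phi> x)\<bar> = g x" for x
    using g0[of x] Cc_envelope_not_MInf[OF f, of x] by (cases "f x") (auto simp: g_def)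
  then have "upper_integral \<mu> (\<lambda>x. \<bar>- f x - ereal (- \<phi> x)\<bar>) = upper_integral \<mu> g"
    by simp
  also have "\<dots> = lint \<mu> g"
    by (intro upper_integral_eq_lint[OF \<mu> g0] Cc_envelope_imp_lower_semicont)
      (simp add: g_def Cc_envelope_diff_Cc[OF f C])
  also have "\<dots> = ereal r - ereal (\<mu> \<phi>)"
    unfolding g_def lint_diff_Cc[OF lc \<mu> f C] r ..
  also have "\<dots> < ereal e" using \<phi>(2) by simp
  finally show "\<exists>\<phi>\<in>Cc. upper_integral \<mu> (\<lambda>x. \<bar>- f x - ereal (\<phi> x)\<bar>) < ereal e"
    by (rule bexI[OF _ Cc_uminus[OF C]])
qed

end

end

section \<open>Envelopes integrated against a difference of positive functionals\<close>

context
  fixes P Q \<rho> :: "('a::t2_space \<Rightarrow> real) \<Rightarrow> real" and f :: "'a \<Rightarrow> ereal"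
  assumes lc: "locally_compact_space (euclidean :: 'a topology)"
    and P: "positive_linear P" and Q: "positive_linear Q"
    and \<rho>: "\<And>\<phi>. \<phi> \<in> Cc \<Longrightarrow> \<rho> \<phi> = P \<phi> - Q \<phi>"
    and f: "Cc_envelope f" and finP: "lint P f < \<infinity>"
begin

text \<open>P and Q exceed the two Jordan parts of \<rho> by a common m. Finiteness of the integral
  against P makes the one against m finite, so m cancels. The integral against Q may be infinite,
  and the value is then -\<infinity>.\<close>

lemma integral_defined_difference: "integral_defined \<rho> f"
  and radon_integral_difference: "radon_integral \<rho> f = lint P f - lint Q f"
proof -
  obtain m where p: "positive_linear (pos_part \<rho>)" and n: "positive_linear (neg_part \<rho>)"
    and m: "positive_linear m" and Pm: "\<And>\<phi>. \<phi> \<in> Cc \<Longrightarrow> P \<phi> = pos_part \<rho> \<phi> + m \<phi>"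
    and Qm: "\<And>\<phi>. \<phi> \<in> Cc \<Longrightarrow> Q \<phi> = neg_part \<rho> \<phi> + m \<phi>"
    using jordan_decomposition[OF P Q \<rho>] by blast
  let ?p = "\<lambda>x. max 0 (f x)" and ?n = "\<lambda>x. min 0 (f x)"
  have up: "upper_integral \<mu> ?p = lint \<mu> ?p" if "positive_linear \<mu>" for \<mu>
    by (rule upper_integral_eq_lint[OF that])
      (auto intro!: Cc_envelope_imp_lower_semicont Cc_envelope_max0 f)
  have "lint P f = lint (\<lambda>\<phi>. pos_part \<rho> \<phi> + m \<phi>) f" by (rule lint_cong_measure) (rule Pm)
  then have lP: "lint P f = lint (pos_part \<rho>) f + lint m f" using lint_add_measure[OF lc p m f] by simp
  have "lint Q f = lint (\<lambda>\<phi>. neg_part \<rho> \<phi> + m \<phi>) f" by (rule lint_cong_measure) (rule Qm)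
  then have lQ: "lint Q f = lint (neg_part \<rho>) f + lint m f" using lint_add_measure[OF lc n m f] by simp
  have pos: "integral_pos \<rho> f = lint (pos_part \<rho>) ?p - lint (neg_part \<rho>) ?n"
    unfolding integral_pos_def up[OF p] upper_integral_neg[OF lc n f] minus_ereal_def ..
  have neg: "integral_neg \<rho> f = - lint (pos_part \<rho>) ?n + lint (neg_part \<rho>) ?p"
    unfolding integral_neg_def up[OF n] upper_integral_neg[OF lc p f] ..
  note pf = lint_pos_neg_parts[OF lc p f] and nf = lint_pos_neg_parts[OF lc n f]
    and mf = lint_pos_neg_parts[OF lc m f]
  have pn: "\<bar>lint (pos_part \<rho>) ?n\<bar> \<noteq> \<infinity>" "\<bar>lint (neg_part \<rho>) ?n\<bar> \<noteq> \<infinity>" by (rule pf(3) nf(3))+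
  have fin: "\<bar>lint m f\<bar> \<noteq> \<infinity>" "\<bar>lint (pos_part \<rho>) f\<bar> \<noteq> \<infinity>"
    using finP lP lint_not_MInf[OF f, of m] lint_not_MInf[OF f, of "pos_part \<rho>"]
    by (cases "lint m f"; cases "lint (pos_part \<rho>) f"; auto)+
  then have pp: "\<bar>lint (pos_part \<rho>) ?p\<bar> \<noteq> \<infinity>"
    using pf by (cases "lint (pos_part \<rho>) ?p"; cases "lint (pos_part \<rho>) ?n") auto
  show "integral_defined \<rho> f"
    unfolding integral_defined_def pos using pp pn
    by (cases "lint (pos_part \<rho>) ?p"; cases "lint (neg_part \<rho>) ?n") auto
  have "radon_integral \<rho> f = lint (pos_part \<rho>) f - lint (neg_part \<rho>) f"
    unfolding radon_integral_def pos neg pf(1) nf(1) using pp pn nf(2)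
    by (cases "lint (pos_part \<rho>) ?p"; cases "lint (neg_part \<rho>) ?n"; cases "lint (pos_part \<rho>) ?n";
        cases "lint (neg_part \<rho>) ?p") auto
  also have "\<dots> = lint P f - lint Q f"
    unfolding lP lQ using fin
    by (cases "lint m f"; cases "lint (pos_part \<rho>) f"; cases "lint (neg_part \<rho>) f") auto
  finally show "radon_integral \<rho> f = lint P f - lint Q f" .
qed

end

section \<open>Product measures\<close>

lemma Cc_product_support:
  fixes \<Phi> :: "'a::t2_space \<times> 'b::t2_space \<Rightarrow> real"
  assumes "\<Phi> \<in> Cc"
  obtains K L where "compact K" "compact L" "\<And>x y. x \<notin> K \<Longrightarrow> \<Phi> (x, y) = 0" "\<And>x y. y \<notin> L \<Longrightarrow> \<Phi> (x, y) = 0"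
proof -
  obtain M where M: "compact M" "\<And>p. p \<notin> M \<Longrightarrow> \<Phi> p = 0" using Cc_vanishes[OF assms] by auto
  show thesis
  proof
    show "compact (fst ` M)" "compact (snd ` M)"
      using M(1) by (auto intro!: compact_continuous_image continuous_intros)
    show "\<Phi> (x, y) = 0" if "x \<notin> fst ` M" for x y
      using that by (intro M(2)) force
    show "\<Phi> (x, y) = 0" if "y \<notin> snd ` M" for x y
      using that by (intro M(2)) force
  qed
qed

lemma Cc_section:
  fixes \<Phi> :: "'a::t2_space \<times> 'b::t2_space \<Rightarrow> real"
  assumes "\<Phi> \<in> Cc"
  shows "(\<lambda>y. \<Phi> (x, y)) \<in> Cc"
proof -
  obtain K L where KL: "compact K" "compact L" "\<And>x y. x \<notin> K \<Longrightarrow> \<Phi> (x, y) = 0" "\<And>x y. y \<notin> L \<Longrightarrow> \<Phi> (x, y) = 0"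
    using Cc_product_support[OF assms] by metis
  have "continuous_on UNIV (\<lambda>y. \<Phi> (x, y))"
    by (rule continuous_on_compose2[OF Cc_continuous[OF assms]]) (auto intro!: continuous_intros)
  then show ?thesis using KL by (intro CcI[of _ L]) auto
qed

lemma Cc_swap:
  fixes \<Phi> :: "'a::t2_space \<times> 'b::t2_space \<Rightarrow> real"
  assumes "\<Phi> \<in> Cc"
  shows "(\<lambda>p. \<Phi> (snd p, fst p)) \<in> Cc"
proof -
  obtain K L where KL: "compact K" "compact L" "\<And>x y. x \<notin> K \<Longrightarrow> \<Phi> (x, y) = 0" "\<And>x y. y \<notin> L \<Longrightarrow> \<Phi> (x, y) = 0"
    using Cc_product_support[OF assms] by metis
  have "continuous_on UNIV (\<lambda>p. \<Phi> (snd p, fst p))"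
    by (rule continuous_on_compose2[OF Cc_continuous[OF assms]]) (auto intro!: continuous_intros)
  moreover have "\<Phi> (snd p, fst p) = 0" if "p \<notin> L \<times> K" for p
    using that by (cases "fst p \<in> L"; cases "snd p \<in> K") (auto simp: mem_Times_iff KL)
  ultimately show ?thesis using KL by (intro CcI[of _ "L \<times> K"] compact_Times)
qed

lemma Cc_tensor:
  fixes a :: "'a::t2_space \<Rightarrow> real" and b :: "'b::t2_space \<Rightarrow> real"
  assumes "a \<in> Cc" "b \<in> Cc"
  shows "(\<lambda>p. a (fst p) * b (snd p)) \<in> Cc"
proof -
  obtain K where K: "compact K" "\<And>x. x \<notin> K \<Longrightarrow> a x = 0" using Cc_vanishes[OF assms(1)] by auto
  obtain L where L: "compact L" "\<And>x. x \<notin> L \<Longrightarrow> b x = 0" using Cc_vanishes[OF assms(2)] by auto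
  have "continuous_on UNIV (\<lambda>p::'a \<times> 'b. a (fst p))" "continuous_on UNIV (\<lambda>p::'a \<times> 'b. b (snd p))"
    by (auto intro!: continuous_on_compose2[OF Cc_continuous[OF assms(1)]]
        continuous_on_compose2[OF Cc_continuous[OF assms(2)]] continuous_intros)
  then have "continuous_on UNIV (\<lambda>p. a (fst p) * b (snd p))" by (rule continuous_on_mult)
  then show ?thesis
    using K L by (intro CcI[of _ "K \<times> L"] compact_Times) (auto simp: mem_Times_iff)
qed

text \<open>By the tube lemma the sections over a neighbourhood of x0 differ uniformly little on the
  compact L, off which they vanish; local boundedness of \<nu> turns this into continuity.\<close>

lemma Cc_fiber_integral:
  fixes \<Phi> :: "'a::t2_space \<times> 'b::t2_space \<Rightarrow> real"
  assumes lc: "locally_compact_space (euclidean :: 'b topology)" and \<nu>: "positive_linear \<nu>"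
    and \<Phi>: "\<Phi> \<in> Cc"
  shows "(\<lambda>x. \<nu> (\<lambda>y. \<Phi> (x, y))) \<in> Cc"
proof -
  obtain K L where KL: "compact K" "compact L" "\<And>x y. x \<notin> K \<Longrightarrow> \<Phi> (x, y) = 0" "\<And>x y. y \<notin> L \<Longrightarrow> \<Phi> (x, y) = 0"
    using Cc_product_support[OF \<Phi>] by metis
  obtain M where M: "M \<ge> 0" "\<And>\<phi> b. \<phi> \<in> Cc \<Longrightarrow> (\<forall>x. x \<notin> L \<longrightarrow> \<phi> x = 0) \<Longrightarrow> (\<forall>x. \<bar>\<phi> x\<bar> \<le> b) \<Longrightarrow> \<bar>\<nu> \<phi>\<bar> \<le> M * b"
    using pl_locally_bounded[OF \<nu> lc KL(2)] by auto
  have cont: "((\<lambda>x. \<nu> (\<lambda>y. \<Phi> (x, y))) \<longlongrightarrow> \<nu> (\<lambda>y. \<Phi> (x0, y))) (at x0)" for x0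
  proof (rule tendstoI)
    fix e :: real assume e: "0 < e"
    define d where "d = e / (M + 1)"
    have d: "d > 0" "M * d < e" using e M(1) by (auto simp: d_def field_simps)
    define W where "W = {p. \<bar>\<Phi> p - \<Phi> (x0, snd p)\<bar> < d}"
    have "continuous_on UNIV (\<lambda>p. \<Phi> (x0, snd p :: 'b))"
      by (rule continuous_on_compose2[OF Cc_continuous[OF \<Phi>]]) (auto intro!: continuous_intros)
    then have "open W" unfolding W_def
      by (intro open_Collect_less continuous_on_rabs continuous_on_diff Cc_continuous[OF \<Phi>] continuous_on_const)
    moreover have "{x0} \<times> L \<subseteq> W" using d by (auto simp: W_def)
    ultimately obtain X0 where X0: "x0 \<in> X0" "open X0" "X0 \<times> L \<subseteq> W"
      using Elementary_Topology.tube_lemma[OF KL(2)] by metis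
    have "dist (\<nu> (\<lambda>y. \<Phi> (x, y))) (\<nu> (\<lambda>y. \<Phi> (x0, y))) < e" if x: "x \<in> X0" for x
    proof -
      have C: "(\<lambda>y. \<Phi> (x, y) - \<Phi> (x0, y)) \<in> Cc" by (intro Cc_diff Cc_section \<Phi>)
      have "\<bar>\<Phi> (x, y) - \<Phi> (x0, y)\<bar> \<le> d" for y
      proof (cases "y \<in> L")
        case True
        then have "(x, y) \<in> W" using X0(3) x by auto
        then show ?thesis by (simp add: W_def)
      qed (use d KL(4) in simp)
      then have "\<bar>\<nu> (\<lambda>y. \<Phi> (x, y) - \<Phi> (x0, y))\<bar> \<le> M * d"
        using KL(4) by (intro M(2)[OF C]) auto
      then show ?thesis
        using d by (simp add: dist_real_def pl_diff[OF \<nu> Cc_section[OF \<Phi>] Cc_section[OF \<Phi>]])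
    qed
    then show "\<forall>\<^sub>F x in at x0. dist (\<nu> (\<lambda>y. \<Phi> (x, y))) (\<nu> (\<lambda>y. \<Phi> (x0, y))) < e"
      unfolding eventually_at_topological using X0 by blast
  qed
  have "continuous_on UNIV (\<lambda>x. \<nu> (\<lambda>y. \<Phi> (x, y)))"
    by (rule continuous_at_imp_continuous_on) (simp add: continuous_at cont)
  then show ?thesis
    using KL(3) by (intro CcI[OF _ KL(1)]) (simp_all add: pl_zero[OF \<nu>])
qed

section \<open>Tensors and Fubini's theorem for test functions\<close>

lemma locally_compact_space_product:
  assumes "locally_compact_space (euclidean :: 'a::topological_space topology)"
    and "locally_compact_space (euclidean :: 'b::topological_space topology)"
  shows "locally_compact_space (euclidean :: ('a \<times> 'b) topology)"
proof -
  have "locally_compact_space (prod_topology (euclidean :: 'a topology) (euclidean :: 'b topology))"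
    using assms locally_compact_space_prod_topology by blast
  then show ?thesis by simp
qed

text \<open>Finite sums of products a(x) b(y). The factors need not have compact support, so that
  the constants belong to this algebra, as Stone--Weierstrass demands; compact support is imposed
  afterwards by a cutoff.\<close>

inductive_set tensors :: "('a::topological_space \<times> 'b::topological_space \<Rightarrow> real) set" where
  tensor: "continuous_on UNIV a \<Longrightarrow> continuous_on UNIV b \<Longrightarrow> (\<lambda>p. a (fst p) * b (snd p)) \<in> tensors"
| add: "g \<in> tensors \<Longrightarrow> h \<in> tensors \<Longrightarrow> (\<lambda>p. g p + h p) \<in> tensors"

lemma tensors_continuous: "g \<in> tensors \<Longrightarrow> continuous_on UNIV g"
proof (induction rule: tensors.induct)
  case (tensor a b)
  then show ?case
    by (intro continuous_on_mult continuous_on_compose2[OF tensor(1)] continuous_on_compose2[OF tensor(2)])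
      (auto intro!: continuous_intros)
qed (rule continuous_on_add)

lemma tensors_mult:
  assumes "g \<in> tensors" "h \<in> tensors" shows "(\<lambda>p. g p * h p) \<in> tensors"
  using assms(1)
proof (induction rule: tensors.induct)
  case (tensor a b)
  from assms(2) show ?case
  proof (induction rule: tensors.induct)
    case (tensor a' b')
    have "(\<lambda>p. (\<lambda>x. a x * a' x) (fst p) * (\<lambda>y. b y * b' y) (snd p)) \<in> tensors"
      by (intro tensors.tensor continuous_on_mult tensor \<open>continuous_on UNIV a\<close> \<open>continuous_on UNIV b\<close>)
    then show ?case by (simp add: mult_ac)
  next
    case (add g h)
    from tensors.add[OF add.IH] show ?case by (simp add: distrib_left)
  qed
next
  case (add g1 g2)
  from tensors.add[OF add.IH] show ?case by (simp add: distrib_right)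
qed

context
  fixes \<mu> :: "('a::t2_space \<Rightarrow> real) \<Rightarrow> real" and \<nu> :: "('b::t2_space \<Rightarrow> real) \<Rightarrow> real"
  assumes lca: "locally_compact_space (euclidean :: 'a topology)"
    and lcb: "locally_compact_space (euclidean :: 'b topology)"
    and \<mu>: "positive_linear \<mu>" and \<nu>: "positive_linear \<nu>"
begin

lemma positive_linear_radon_prod: "positive_linear (radon_prod \<mu> \<nu>)"
proof (rule positive_linearI)
  fix \<Phi> :: "'a \<times> 'b \<Rightarrow> real" assume \<Phi>: "\<Phi> \<in> Cc"
  note F = Cc_fiber_integral[OF lcb \<nu>] and S = Cc_section
  show "radon_prod \<mu> \<nu> (\<lambda>x. \<Phi> x + \<Psi> x) = radon_prod \<mu> \<nu> \<Phi> + radon_prod \<mu> \<nu> \<Psi>" if \<Psi>: "\<Psi> \<in> Cc" for \<Psi>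
    using \<Phi> \<Psi> by (simp add: radon_prod_def Cc_add pl_add[OF \<nu> S S] pl_add[OF \<mu> F F])
  show "radon_prod \<mu> \<nu> (\<lambda>x. c * \<Phi> x) = c * radon_prod \<mu> \<nu> \<Phi>" for c
    using \<Phi> by (simp add: radon_prod_def Cc_cmult pl_cmult[OF \<nu> S] pl_cmult[OF \<mu> F])
  show "0 \<le> radon_prod \<mu> \<nu> \<Phi>" if "\<And>x. 0 \<le> \<Phi> x"
    using \<Phi> that by (simp add: radon_prod_def) (intro pl_nonneg[OF \<mu> F] pl_nonneg[OF \<nu> S])
qed

end

text \<open>Both iterated integrals agree on tensors, hence everywhere by Stone--Weierstrass.\<close>

lemma radon_prod_fubini:
  fixes \<mu> :: "('a::t2_space \<Rightarrow> real) \<Rightarrow> real" and \<nu> :: "('b::t2_space \<Rightarrow> real) \<Rightarrow> real"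
  assumes lca: "locally_compact_space (euclidean :: 'a topology)"
    and lcb: "locally_compact_space (euclidean :: 'b topology)"
    and \<mu>: "positive_linear \<mu>" and \<nu>: "positive_linear \<nu>" and \<Phi>: "\<Phi> \<in> Cc"
  shows "radon_prod \<mu> \<nu> \<Phi> = radon_prod \<nu> \<mu> (\<lambda>p. \<Phi> (snd p, fst p))"
proof -
  define P where "P = radon_prod \<mu> \<nu>"
  define Q where "Q = (\<lambda>\<Phi>. radon_prod \<nu> \<mu> (\<lambda>p. \<Phi> (snd p, fst p)))"
  have P: "positive_linear P" unfolding P_def by (rule positive_linear_radon_prod[OF lca lcb \<mu> \<nu>])
  note Q' = positive_linear_radon_prod[OF lcb lca \<nu> \<mu>]
  have Q: "positive_linear Q" unfolding Q_def
    by (rule positive_linearI)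
      (simp_all add: pl_add[OF Q' Cc_swap Cc_swap] pl_cmult[OF Q' Cc_swap] pl_nonneg[OF Q' Cc_swap])
  obtain K L where KL: "compact K" "compact L" "\<And>x y. x \<notin> K \<Longrightarrow> \<Phi> (x, y) = 0" "\<And>x y. y \<notin> L \<Longrightarrow> \<Phi> (x, y) = 0"
    using Cc_product_support[OF \<Phi>] by metis
  obtain u where u: "u \<in> Cc" "\<And>x. 0 \<le> u x" "\<And>x. u x \<le> 1" "\<And>x. x \<in> K \<Longrightarrow> u x = 1"
    by (rule urysohn_Cc[OF lca KL(1) open_UNIV]) auto
  obtain v where v: "v \<in> Cc" "\<And>x. 0 \<le> v x" "\<And>x. v x \<le> 1" "\<And>x. x \<in> L \<Longrightarrow> v x = 1"
    by (rule urysohn_Cc[OF lcb KL(2) open_UNIV]) auto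
  obtain K' where K': "compact K'" "\<And>x. x \<notin> K' \<Longrightarrow> u x = 0" using Cc_vanishes[OF u(1)] by auto
  obtain L' where L': "compact L'" "\<And>x. x \<notin> L' \<Longrightarrow> v x = 0" using Cc_vanishes[OF v(1)] by auto
  \<comment> \<open>The cutoff is itself a product, so a product a(x) b(y) times w splits into
    factors in \<open>Cc\<close>. It equals 1 on K \<times> L and leaves \<Phi> unchanged.\<close>
  define w where "w = (\<lambda>p. u (fst p) * v (snd p))"
  have w: "w \<in> Cc" "\<And>p. 0 \<le> w p" "\<And>p. w p \<le> 1" "\<And>p. p \<notin> K' \<times> L' \<Longrightarrow> w p = 0"
    using u(2,3) v(2,3) K'(2) L'(2) Cc_tensor[OF u(1) v(1)]
    by (auto simp: w_def mem_Times_iff intro: mult_le_one)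
  have \<Phi>w: "w p * \<Phi> p = \<Phi> p" for p
    by (cases p; cases "fst p \<in> K"; cases "snd p \<in> L") (auto simp: w_def u(4) v(4) KL(3,4))
  have agree: "P (\<lambda>p. g p * w p) = Q (\<lambda>p. g p * w p)" if "g \<in> tensors" for g
    using that
  proof (induction rule: tensors.induct)
    case (tensor a b)
    have C: "(\<lambda>x. a x * u x) \<in> Cc" "(\<lambda>y. b y * v y) \<in> Cc"
      by (intro Cc_mult_continuous u v tensor)+
    have D: "(\<lambda>p. a (fst p) * b (snd p) * w p) \<in> Cc"
      using Cc_tensor[OF C] by (simp add: w_def mult_ac)
    have "P (\<lambda>p. a (fst p) * b (snd p) * w p) = \<mu> (\<lambda>x. \<nu> (\<lambda>y. (a x * u x) * (b y * v y)))"
      using D by (simp add: P_def radon_prod_def) (simp add: w_def mult_ac)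
    also have "\<dots> = \<mu> (\<lambda>x. \<nu> (\<lambda>y. b y * v y) * (a x * u x))"
      by (simp only: pl_cmult[OF \<nu> C(2)] mult.commute)
    also have "\<dots> = \<nu> (\<lambda>y. \<mu> (\<lambda>x. a x * u x) * (b y * v y))"
      by (subst pl_cmult[OF \<mu> C(1)], subst pl_cmult[OF \<nu> C(2)]) (rule mult.commute)
    also have "\<dots> = \<nu> (\<lambda>y. \<mu> (\<lambda>x. (b y * v y) * (a x * u x)))"
      by (simp only: pl_cmult[OF \<mu> C(1)]) (simp only: mult.commute)
    also have "\<dots> = Q (\<lambda>p. a (fst p) * b (snd p) * w p)"
      using Cc_swap[OF D] by (simp add: Q_def radon_prod_def) (simp add: w_def mult_ac)
    finally show ?case .
  next
    case (add g h)
    have C: "(\<lambda>p. g p * w p) \<in> Cc" "(\<lambda>p. h p * w p) \<in> Cc"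
      by (intro Cc_mult_continuous w tensors_continuous add)+
    show ?case using add.IH by (simp add: distrib_right pl_add[OF P C] pl_add[OF Q C])
  qed
  have SW: "\<exists>g. g \<in> tensors \<and> (\<forall>p\<in>K' \<times> L'. \<bar>\<Phi> p - g p\<bar> < e)" if "e > 0" for e
  proof (rule Stone_Weierstrass_HOL[of "K' \<times> L'" "\<lambda>g. g \<in> tensors" \<Phi> e])
    show "compact (K' \<times> L')" using K' L' by (intro compact_Times)
    show "(\<lambda>x. c) \<in> tensors" for c
      using tensors.tensor[of "\<lambda>_. c" "\<lambda>_. 1"] by simp
    show "continuous_on (K' \<times> L') f" if "f \<in> tensors" for f
      using tensors_continuous[OF that] by (rule continuous_on_subset) simp
    show "(\<lambda>x. f x + g x) \<in> tensors" if "f \<in> tensors \<and> g \<in> tensors" for f g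
      using that by (intro tensors.add) auto
    show "(\<lambda>x. f x * g x) \<in> tensors" if "f \<in> tensors \<and> g \<in> tensors" for f g
      using that by (intro tensors_mult) auto
    show "continuous_on (K' \<times> L') \<Phi>"
      using Cc_continuous[OF \<Phi>] by (rule continuous_on_subset) simp
    fix p q assume pq: "p \<in> K' \<times> L' \<and> q \<in> K' \<times> L' \<and> p \<noteq> q"
    show "\<exists>f. f \<in> tensors \<and> f p \<noteq> f q"
    proof (cases "fst p = fst q")
      case False
      obtain a where a: "a \<in> Cc" "a (fst p) = 1" "a (fst q) = 0"
        by (rule urysohn_Cc[OF lca, of "{fst p}" "- {fst q}"]) (use False in auto)
      have "(\<lambda>p. a (fst p) * (\<lambda>_. 1) (snd p :: 'b)) \<in> tensors"
        by (intro tensors.tensor Cc_continuous a continuous_on_const)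
      then show ?thesis using a by (intro exI[of _ "\<lambda>p. a (fst p) * (\<lambda>_. 1) (snd p)"]) simp
    next
      case True
      then have ne: "snd p \<noteq> snd q" using pq by (auto simp: prod_eq_iff)
      obtain b where b: "b \<in> Cc" "b (snd p) = 1" "b (snd q) = 0"
        by (rule urysohn_Cc[OF lcb, of "{snd p}" "- {snd q}"]) (use ne in auto)
      have "(\<lambda>p. (\<lambda>_. 1) (fst p :: 'a) * b (snd p)) \<in> tensors"
        by (intro tensors.tensor Cc_continuous b continuous_on_const)
      then show ?thesis using b by (intro exI[of _ "\<lambda>p. (\<lambda>_. 1) (fst p) * b (snd p)"]) simp
    qed
  qed fact
  have lcp: "locally_compact_space (euclidean :: ('a \<times> 'b) topology)"
    by (rule locally_compact_space_product[OF lca lcb])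
  have cp: "compact (K' \<times> L')" using K' L' by (intro compact_Times)
  obtain M where M: "M \<ge> 0" "\<And>\<phi> b. \<phi> \<in> Cc \<Longrightarrow> (\<forall>x. x \<notin> K' \<times> L' \<longrightarrow> \<phi> x = 0) \<Longrightarrow> (\<forall>x. \<bar>\<phi> x\<bar> \<le> b) \<Longrightarrow> \<bar>P \<phi>\<bar> \<le> M * b"
    using pl_locally_bounded[OF P lcp cp] by auto
  obtain N where N: "N \<ge> 0" "\<And>\<phi> b. \<phi> \<in> Cc \<Longrightarrow> (\<forall>x. x \<notin> K' \<times> L' \<longrightarrow> \<phi> x = 0) \<Longrightarrow> (\<forall>x. \<bar>\<phi> x\<bar> \<le> b) \<Longrightarrow> \<bar>Q \<phi>\<bar> \<le> N * b"
    using pl_locally_bounded[OF Q lcp cp] by auto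
  have bound: "\<bar>P \<Phi> - Q \<Phi>\<bar> \<le> (M + N) * e" if e: "e > 0" for e
  proof -
    obtain g where g: "g \<in> tensors" "\<forall>p\<in>K' \<times> L'. \<bar>\<Phi> p - g p\<bar> < e" using SW[OF e] by auto
    have C: "(\<lambda>p. g p * w p) \<in> Cc" by (intro Cc_mult_continuous w tensors_continuous g)
    have D: "(\<lambda>p. \<Phi> p - g p * w p) \<in> Cc" by (intro Cc_diff \<Phi> C)
    have zero: "\<forall>p. p \<notin> K' \<times> L' \<longrightarrow> \<Phi> p - g p * w p = 0"
      using w(4) \<Phi>w by (metis diff_zero mult_zero_left mult_zero_right)
    have "\<bar>\<Phi> p - g p * w p\<bar> \<le> e" for p
    proof (cases "p \<in> K' \<times> L'")
      case True
      have "\<Phi> p - g p * w p = w p * (\<Phi> p - g p)" using \<Phi>w[of p] by (simp add: algebra_simps)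
      then have "\<bar>\<Phi> p - g p * w p\<bar> = w p * \<bar>\<Phi> p - g p\<bar>" using w(2)[of p] by (simp add: abs_mult)
      also have "\<dots> \<le> 1 * e"
        using True g(2) w(2,3)[of p] by (intro mult_mono) (auto intro: less_imp_le)
      finally show ?thesis by simp
    next
      case False
      then have "\<Phi> p - g p * w p = 0" using zero by blast
      then show ?thesis using e by simp
    qed
    then have "\<bar>P (\<lambda>p. \<Phi> p - g p * w p)\<bar> \<le> M * e" "\<bar>Q (\<lambda>p. \<Phi> p - g p * w p)\<bar> \<le> N * e"
      using M(2)[OF D zero] N(2)[OF D zero] by auto
    then show ?thesis
      using agree[OF g(1)] by (simp add: pl_diff[OF P \<Phi> C] pl_diff[OF Q \<Phi> C] distrib_right)
  qed
  have "\<bar>P \<Phi> - Q \<Phi>\<bar> \<le> 0"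
  proof (rule field_le_epsilon)
    fix e :: real assume e: "e > 0"
    have "\<bar>P \<Phi> - Q \<Phi>\<bar> \<le> (M + N) * (e / (M + N + 1))"
      by (rule bound) (use e M N in simp)
    also have "\<dots> \<le> e" using e M N by (simp add: field_simps)
    finally show "\<bar>P \<Phi> - Q \<Phi>\<bar> \<le> 0 + e" by simp
  qed
  then show ?thesis by (simp add: P_def Q_def)
qed

lemma Cc_envelope_section:
  fixes F :: "'a::t2_space \<times> 'b::t2_space \<Rightarrow> ereal"
  assumes F: "Cc_envelope F"
  shows "Cc_envelope (\<lambda>y. F (x, y))"
proof -
  have below: "(\<lambda>y. \<Phi> (x, y)) \<in> Cc_below (\<lambda>y. F (x, y))" if "\<Phi> \<in> Cc_below F" for \<Phi>
    using that by (auto simp: Cc_below_def intro: Cc_section)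
  have "\<exists>\<phi>\<in>Cc_below (\<lambda>y. F (x, y)). c < \<phi> y" if c: "ereal c < F (x, y)" for y c
  proof -
    obtain \<Phi> where \<Phi>: "\<Phi> \<in> Cc_below F" "c < \<Phi> (x, y)" using Cc_envelopeD[OF F c] by auto
    then show ?thesis by (intro bexI[OF _ below[OF \<Phi>(1)]])
  qed
  moreover have "Cc_below (\<lambda>y. F (x, y)) \<noteq> {}" using F below by (auto simp: Cc_envelope_def)
  ultimately show ?thesis by (auto simp: Cc_envelope_def)
qed

section \<open>Iterated integrals of envelopes\<close>

context
  fixes \<nu> :: "('b::t2_space \<Rightarrow> real) \<Rightarrow> real" and F :: "'a::t2_space \<times> 'b \<Rightarrow> ereal"
  assumes lcb: "locally_compact_space (euclidean :: 'b topology)"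
    and \<nu>: "positive_linear \<nu>" and F: "Cc_envelope F"
begin

text \<open>A minorant of a section of F need not come from a minorant of F, but the sections of
  minorants of F form a directed family whose supremum is the section, so they compute its integral
  as well.\<close>

lemma lint_section_less:
  assumes "ereal c < lint \<nu> (\<lambda>y. F (x, y))"
  shows "\<exists>\<Phi>\<in>Cc_below F. c < \<nu> (\<lambda>y. \<Phi> (x, y))"
proof -
  define D where "D = (\<lambda>\<Phi> y. \<Phi> (x, y)) ` Cc_below F"
  have "lint \<nu> (\<lambda>y. F (x, y)) \<le> (SUP d\<in>D. ereal (\<nu> d))"
  proof (rule lint_le_directed_SUP[OF lcb \<nu>])
    show "D \<noteq> {}" using F by (auto simp: D_def Cc_envelope_def)
    show "D \<subseteq> Cc" by (auto simp: D_def intro!: Cc_section dest: Cc_belowD(1))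
    show "\<exists>d\<in>D. c < d y" if c: "ereal c < F (x, y)" for y c
      using Cc_envelopeD[OF F c] by (auto simp: D_def)
    fix a b assume "a \<in> D" "b \<in> D"
    then obtain \<Phi> \<Psi> where 1: "a = (\<lambda>y. \<Phi> (x, y))" "b = (\<lambda>y. \<Psi> (x, y))" "\<Phi> \<in> Cc_below F" "\<Psi> \<in> Cc_below F"
      by (auto simp: D_def)
    from Cc_below_max[OF 1(3,4)] have "(\<lambda>y. max (\<Phi> (x, y)) (\<Psi> (x, y))) \<in> D"
      unfolding D_def by (rule rev_image_eqI) simp
    then show "\<exists>c\<in>D. \<forall>y. a y \<le> c y \<and> b y \<le> c y"
      by (rule bexI[rotated]) (simp add: 1)
  qed
  with assms have "ereal c < (SUP d\<in>D. ereal (\<nu> d))" by (rule less_le_trans)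
  then show ?thesis by (auto simp: less_SUP_iff D_def)
qed

lemma fiber_integral_below:
  assumes "\<Phi> \<in> Cc_below F"
  shows "(\<lambda>x. \<nu> (\<lambda>y. \<Phi> (x, y))) \<in> Cc_below (\<lambda>x. lint \<nu> (\<lambda>y. F (x, y)))"
proof (rule Cc_belowI)
  show "(\<lambda>x. \<nu> (\<lambda>y. \<Phi> (x, y))) \<in> Cc"
    using assms by (intro Cc_fiber_integral[OF lcb \<nu>]) (rule Cc_belowD)
  show "ereal (\<nu> (\<lambda>y. \<Phi> (x, y))) \<le> lint \<nu> (\<lambda>y. F (x, y))" for x
    using assms by (intro lint_upper) (auto simp: Cc_below_def intro: Cc_section)
qed

text \<open>Applied to the kernel, this makes the potentials of positive measures envelopes, hence
  lower semicontinuous, and \<open>lint\<close> applies to them in turn.\<close>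

lemma Cc_envelope_fiber_integral: "Cc_envelope (\<lambda>x. lint \<nu> (\<lambda>y. F (x, y)))"
proof -
  have "\<exists>\<phi>\<in>Cc_below (\<lambda>x. lint \<nu> (\<lambda>y. F (x, y))). c < \<phi> x" if c: "ereal c < lint \<nu> (\<lambda>y. F (x, y))" for x c
  proof -
    obtain \<Phi> where \<Phi>: "\<Phi> \<in> Cc_below F" "c < \<nu> (\<lambda>y. \<Phi> (x, y))" using lint_section_less[OF c] by auto
    then show ?thesis by (intro bexI[OF _ fiber_integral_below[OF \<Phi>(1)]])
  qed
  moreover have "Cc_below (\<lambda>x. lint \<nu> (\<lambda>y. F (x, y))) \<noteq> {}"
    using F fiber_integral_below by (auto simp: Cc_envelope_def)
  ultimately show ?thesis by (auto simp: Cc_envelope_def)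
qed

text \<open>For test functions the product is an iterated integral by definition; the fibre
  integrals of minorants of F form a directed family with supremum the inner integral, which carries
  this over to envelopes.\<close>

lemma lint_radon_prod:
  assumes lca: "locally_compact_space (euclidean :: 'a topology)" and \<mu>: "positive_linear \<mu>"
  shows "lint (radon_prod \<mu> \<nu>) F = lint \<mu> (\<lambda>x. lint \<nu> (\<lambda>y. F (x, y)))"
proof (rule antisym)
  have eq: "radon_prod \<mu> \<nu> \<Phi> = \<mu> (\<lambda>x. \<nu> (\<lambda>y. \<Phi> (x, y)))" if "\<Phi> \<in> Cc_below F" for \<Phi>
    using Cc_belowD(1)[OF that] by (simp add: radon_prod_def)
  show "lint (radon_prod \<mu> \<nu>) F \<le> lint \<mu> (\<lambda>x. lint \<nu> (\<lambda>y. F (x, y)))"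
    by (rule lint_least) (simp add: eq lint_upper fiber_integral_below)
  define D where "D = (\<lambda>\<Phi> x. \<nu> (\<lambda>y. \<Phi> (x, y))) ` Cc_below F"
  have "lint \<mu> (\<lambda>x. lint \<nu> (\<lambda>y. F (x, y))) \<le> (SUP d\<in>D. ereal (\<mu> d))"
  proof (rule lint_le_directed_SUP[OF lca \<mu>])
    show "D \<noteq> {}" using F by (auto simp: D_def Cc_envelope_def)
    show "D \<subseteq> Cc" by (auto simp: D_def intro!: Cc_fiber_integral[OF lcb \<nu>] dest: Cc_belowD(1))
    show "\<exists>d\<in>D. c < d x" if c: "ereal c < lint \<nu> (\<lambda>y. F (x, y))" for x c
      using lint_section_less[OF c] by (auto simp: D_def)
    fix a b assume "a \<in> D" "b \<in> D"
    then obtain \<Phi> \<Psi> where 1: "a = (\<lambda>x. \<nu> (\<lambda>y. \<Phi> (x, y)))" "b = (\<lambda>x. \<nu> (\<lambda>y. \<Psi> (x, y)))"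
      "\<Phi> \<in> Cc_below F" "\<Psi> \<in> Cc_below F"
      by (auto simp: D_def)
    note C = Cc_belowD(1)[OF 1(3)] Cc_belowD(1)[OF 1(4)] Cc_belowD(1)[OF Cc_below_max[OF 1(3,4)]]
    from Cc_below_max[OF 1(3,4)] have "(\<lambda>x. \<nu> (\<lambda>y. max (\<Phi> (x, y)) (\<Psi> (x, y)))) \<in> D"
      unfolding D_def by (rule rev_image_eqI) simp
    moreover have "a x \<le> \<nu> (\<lambda>y. max (\<Phi> (x, y)) (\<Psi> (x, y)))" "b x \<le> \<nu> (\<lambda>y. max (\<Phi> (x, y)) (\<Psi> (x, y)))" for x
      unfolding 1 using Cc_section[OF C(1)] Cc_section[OF C(2)] Cc_section[OF C(3)]
      by (intro pl_mono[OF \<nu>]; simp)+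
    ultimately show "\<exists>c\<in>D. \<forall>x. a x \<le> c x \<and> b x \<le> c x" by (intro bexI) auto
  qed
  also have "\<dots> \<le> lint (radon_prod \<mu> \<nu>) F"
    by (rule SUP_least) (auto simp: D_def eq[symmetric] lint_upper)
  finally show "lint \<mu> (\<lambda>x. lint \<nu> (\<lambda>y. F (x, y))) \<le> lint (radon_prod \<mu> \<nu>) F" .
qed

end

section \<open>Kernels and measures of finite energy\<close>

text \<open>Either \<kappa> \<ge> 0 and 0 is a minorant, or the product space is compact: then the
  open sets where \<kappa> > -n have a finite subcover, and a constant, which now lies in
  \<open>Cc\<close>, bounds \<kappa> from below.\<close>

lemma kernel_Cc_envelope:
  fixes \<kappa> :: "'a::t2_space \<times> 'a \<Rightarrow> ereal"
  assumes lc: "locally_compact_space (euclidean :: 'a topology)" and ker: "kernel \<kappa>"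
  shows "Cc_envelope \<kappa>"
proof -
  have lsc: "lower_semicont \<kappa>" and mi: "\<And>p. \<kappa> p \<noteq> -\<infinity>"
    and c: "compact (UNIV :: ('a \<times> 'a) set) \<or> (\<forall>p. 0 \<le> \<kappa> p)"
    using ker by (auto simp: kernel_def Phi_def)
  have "\<exists>\<phi>\<in>Cc. \<forall>p. ereal (\<phi> p) \<le> \<kappa> p"
  proof (cases "\<forall>p. 0 \<le> \<kappa> p")
    case True
    then show ?thesis by (intro bexI[of _ "\<lambda>_. 0"]) (auto simp flip: zero_ereal_def)
  next
    case False
    then have comp: "compact (UNIV :: ('a \<times> 'a) set)" using c by blast
    have op: "open {p. ereal (- real n) < \<kappa> p}" for n
      using lsc by (simp add: lower_semicont_def)
    have "p \<in> (\<Union>n. {p. ereal (- real n) < \<kappa> p})" for p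
    proof (cases "\<kappa> p")
      case (real r)
      obtain n where "- r < real n" using reals_Archimedean2 by blast
      then show ?thesis using real by (intro UN_I[of n]) auto
    qed (use mi[of p] in auto)
    then have "UNIV \<subseteq> (\<Union>n\<in>UNIV. {p. ereal (- real n) < \<kappa> p})" by blast
    from compactE_image[OF comp op this]
    obtain F where F: "finite F" "UNIV \<subseteq> (\<Union>n\<in>F. {p. ereal (- real n) < \<kappa> p})" by metis
    have "ereal (- real (Max (insert 0 F))) \<le> \<kappa> p" for p
    proof -
      obtain n where n: "n \<in> F" "ereal (- real n) < \<kappa> p" using F(2) by blast
      have "n \<le> Max (insert 0 F)" using n F by auto
      then have "ereal (- real (Max (insert 0 F))) \<le> ereal (- real n)" by simp
      then show ?thesis using n(2) by (meson less_imp_le order_trans)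
    qed
    then show ?thesis by (intro bexI[OF _ Cc_const[OF comp]] allI)
  qed
  then show ?thesis
    unfolding Cc_envelope_iff[OF locally_compact_space_product[OF lc lc]] using lsc by simp
qed

text \<open>Sums and multiples of measures are given names so that bilinearity of the energy consists of
  first-order rewrite rules.\<close>

definition madd :: "(('a \<Rightarrow> real) \<Rightarrow> real) \<Rightarrow> (('a \<Rightarrow> real) \<Rightarrow> real) \<Rightarrow> ('a \<Rightarrow> real) \<Rightarrow> real" where
  "madd \<mu> \<nu> = (\<lambda>\<phi>. \<mu> \<phi> + \<nu> \<phi>)"

definition mscale :: "real \<Rightarrow> (('a \<Rightarrow> real) \<Rightarrow> real) \<Rightarrow> ('a \<Rightarrow> real) \<Rightarrow> real" where
  "mscale c \<mu> = (\<lambda>\<phi>. c * \<mu> \<phi>)"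

locale lc_kernel =
  fixes \<kappa> :: "'a::t2_space \<times> 'a \<Rightarrow> ereal"
  assumes lc: "locally_compact_space (euclidean :: 'a topology)"
    and ker: "kernel \<kappa>"
begin

lemmas lcp = locally_compact_space_product[OF lc lc]

lemmas kernel_envelope = kernel_Cc_envelope[OF lc ker]

lemma kernel_sym: "\<kappa> (x, y) = \<kappa> (y, x)"
  using ker by (simp add: kernel_def)

lemma radon_posD: "\<mu> \<in> radon_pos \<Longrightarrow> positive_linear (\<mu> :: ('a \<Rightarrow> real) \<Rightarrow> real)"
  by (simp add: radon_pos_iff[OF lc])

lemma total_mass_eq_lint: "positive_linear \<mu> \<Longrightarrow> total_mass \<mu> = lint \<mu> (\<lambda>_::'a. 1)"
  unfolding outer_meas_def
  by (subst upper_integral_eq_lint) (auto simp: lower_semicont_def indicator_def)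

lemma radon_pos_madd: "\<mu> \<in> radon_pos \<Longrightarrow> \<nu> \<in> radon_pos \<Longrightarrow> madd \<mu> (\<nu> :: ('a \<Rightarrow> real) \<Rightarrow> real) \<in> radon_pos"
  unfolding radon_pos_iff[OF lc] madd_def by (simp add: positive_linear_add)

lemma radon_pos_mscale: "\<mu> \<in> radon_pos \<Longrightarrow> 0 \<le> c \<Longrightarrow> mscale c (\<mu> :: ('a \<Rightarrow> real) \<Rightarrow> real) \<in> radon_pos"
  unfolding radon_pos_iff[OF lc] mscale_def by (simp add: positive_linear_cmult)

lemma potential_eq_lint:
  assumes "\<mu> \<in> radon_pos"
  shows "potential \<kappa> \<mu> x = lint \<mu> (\<lambda>y. \<kappa> (x, y))"
  unfolding potential_def
  by (rule radon_integral_positive[OF radon_posD[OF assms] lc Cc_envelope_section[OF kernel_envelope]])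

lemma potential_envelope:
  assumes "\<mu> \<in> radon_pos"
  shows "Cc_envelope (potential \<kappa> \<mu>)"
proof -
  have "potential \<kappa> \<mu> = (\<lambda>x. lint \<mu> (\<lambda>y. \<kappa> (x, y)))" by (rule ext) (rule potential_eq_lint[OF assms])
  then show ?thesis using Cc_envelope_fiber_integral[OF lc radon_posD[OF assms] kernel_envelope] by simp
qed

lemma mutual_energy_eq_lint_prod:
  assumes "\<mu> \<in> radon_pos" "\<nu> \<in> radon_pos"
  shows "mutual_energy \<kappa> \<mu> \<nu> = lint (radon_prod \<mu> \<nu>) \<kappa>"
  unfolding mutual_energy_def
  by (intro radon_integral_positive positive_linear_radon_prod lc lcp radon_posD assms kernel_envelope)

lemma mutual_energy_eq_lint:
  assumes "\<mu> \<in> radon_pos" "\<nu> \<in> radon_pos"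
  shows "mutual_energy \<kappa> \<mu> \<nu> = lint \<mu> (potential \<kappa> \<nu>)"
  using lint_radon_prod[OF lc radon_posD[OF assms(2)] kernel_envelope lc radon_posD[OF assms(1)]]
  by (simp add: mutual_energy_eq_lint_prod assms potential_eq_lint[OF assms(2), abs_def])

text \<open>Since the kernel is symmetric, swapping coordinates maps its minorants to minorants, and
  Fubini's theorem matches their integrals.\<close>

lemma mutual_energy_commute:
  assumes "\<mu> \<in> radon_pos" "\<nu> \<in> radon_pos"
  shows "mutual_energy \<kappa> \<mu> \<nu> = mutual_energy \<kappa> \<nu> \<mu>"
proof -
  have le: "lint (radon_prod \<mu> \<nu>) \<kappa> \<le> lint (radon_prod \<nu> \<mu>) \<kappa>"
    if "\<mu> \<in> radon_pos" "\<nu> \<in> radon_pos" for \<mu> \<nu>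
  proof (rule lint_least)
    fix \<Phi> assume \<Phi>: "\<Phi> \<in> Cc_below \<kappa>"
    have "(\<lambda>p. \<Phi> (snd p, fst p)) \<in> Cc_below \<kappa>"
    proof (rule Cc_belowI)
      show "ereal (\<Phi> (snd p, fst p)) \<le> \<kappa> p" for p
        using Cc_belowD(2)[OF \<Phi>, of "(snd p, fst p)"] kernel_sym[of "snd p" "fst p"] by simp
    qed (rule Cc_swap[OF Cc_belowD(1)[OF \<Phi>]])
    from lint_upper[OF this, of "radon_prod \<nu> \<mu>"]
    show "ereal (radon_prod \<mu> \<nu> \<Phi>) \<le> lint (radon_prod \<nu> \<mu>) \<kappa>"
      using radon_prod_fubini[OF lc lc radon_posD[OF that(1)] radon_posD[OF that(2)] Cc_belowD(1)[OF \<Phi>]]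
      by simp
  qed
  show ?thesis
    using le[OF assms] le[OF assms(2,1)] by (simp add: mutual_energy_eq_lint_prod assms)
qed

text \<open>For a positive measure the energy is always defined, because the negative part of the
  kernel has a finite integral against the product; finiteness remains as the condition.\<close>

lemma fin_energy_pos_iff: "\<mu> \<in> fin_energy_pos \<kappa> \<longleftrightarrow> \<mu> \<in> radon_pos \<and> mutual_energy \<kappa> \<mu> \<mu> < \<infinity>"
proof -
  have *: "energy_defined \<kappa> \<mu>" "\<mu> \<in> radon" if \<mu>: "\<mu> \<in> radon_pos"
  proof -
    note pl = positive_linear_radon_prod[OF lc lc radon_posD[OF \<mu>] radon_posD[OF \<mu>]]
    show "energy_defined \<kappa> \<mu>"
      unfolding energy_defined_def by (rule integral_defined_positive[OF pl lcp kernel_envelope])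
    show "\<mu> \<in> radon" using \<mu> unfolding radon_pos_def mem_Collect_eq by (rule conjunct1)
  qed
  show ?thesis
    unfolding fin_energy_pos_def fin_energy_def energy_def Int_iff mem_Collect_eq
    by (cases "\<mu> \<in> radon_pos") (simp_all add: *)
qed

lemma radon_diff:
  fixes \<mu> \<nu> :: "('a \<Rightarrow> real) \<Rightarrow> real"
  assumes "\<mu> \<in> radon" "\<nu> \<in> radon"
  shows "(\<lambda>\<phi>. \<mu> \<phi> - \<nu> \<phi>) \<in> radon"
  unfolding radon_def mem_Collect_eq
proof (intro conjI ballI allI impI)
  note m = assms(1)[unfolded radon_def mem_Collect_eq] and n = assms(2)[unfolded radon_def mem_Collect_eq]
  fix \<phi> :: "'a \<Rightarrow> real"
  show "\<mu> \<phi> - \<nu> \<phi> = 0" if "\<phi> \<notin> Cc"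
    using m[THEN conjunct2, THEN conjunct2, THEN conjunct2, rule_format, OF that]
      n[THEN conjunct2, THEN conjunct2, THEN conjunct2, rule_format, OF that] by simp
  assume \<phi>: "\<phi> \<in> Cc"
  show "\<mu> (\<lambda>x. c * \<phi> x) - \<nu> (\<lambda>x. c * \<phi> x) = c * (\<mu> \<phi> - \<nu> \<phi>)" for c
    using m[THEN conjunct2, THEN conjunct1, rule_format, OF \<phi>, of c]
      n[THEN conjunct2, THEN conjunct1, rule_format, OF \<phi>, of c] by (simp add: right_diff_distrib)
  show "\<mu> (\<lambda>x. \<phi> x + \<psi> x) - \<nu> (\<lambda>x. \<phi> x + \<psi> x) = \<mu> \<phi> - \<nu> \<phi> + (\<mu> \<psi> - \<nu> \<psi>)" if "\<psi> \<in> Cc" for \<psi>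
    using m[THEN conjunct1, rule_format, OF \<phi> that] n[THEN conjunct1, rule_format, OF \<phi> that] by simp
next
  note m = assms(1)[unfolded radon_def mem_Collect_eq] and n = assms(2)[unfolded radon_def mem_Collect_eq]
  fix K :: "'a set" assume K: "compact K"
  obtain M where M: "\<forall>\<phi>\<in>Cc. \<forall>b. (\<forall>x. x \<notin> K \<longrightarrow> \<phi> x = 0) \<longrightarrow> (\<forall>x. \<bar>\<phi> x\<bar> \<le> b) \<longrightarrow> \<bar>\<mu> \<phi>\<bar> \<le> M * b"
    using m[THEN conjunct2, THEN conjunct2, THEN conjunct1, THEN spec, THEN mp, OF K] ..
  obtain N where N: "\<forall>\<phi>\<in>Cc. \<forall>b. (\<forall>x. x \<notin> K \<longrightarrow> \<phi> x = 0) \<longrightarrow> (\<forall>x. \<bar>\<phi> x\<bar> \<le> b) \<longrightarrow> \<bar>\<nu> \<phi>\<bar> \<le> N * b"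
    using n[THEN conjunct2, THEN conjunct2, THEN conjunct1, THEN spec, THEN mp, OF K] ..
  show "\<exists>M. \<forall>\<phi>\<in>Cc. \<forall>b. (\<forall>x. x \<notin> K \<longrightarrow> \<phi> x = 0) \<longrightarrow> (\<forall>x. \<bar>\<phi> x\<bar> \<le> b) \<longrightarrow> \<bar>\<mu> \<phi> - \<nu> \<phi>\<bar> \<le> M * b"
  proof (intro exI[of _ "M + N"] ballI allI impI)
    fix \<phi> :: "'a \<Rightarrow> real" and b assume \<phi>: "\<phi> \<in> Cc" "\<forall>x. x \<notin> K \<longrightarrow> \<phi> x = 0" "\<forall>x. \<bar>\<phi> x\<bar> \<le> b"
    show "\<bar>\<mu> \<phi> - \<nu> \<phi>\<bar> \<le> (M + N) * b"
      using bspec[OF M \<phi>(1), THEN spec, THEN mp, THEN mp, OF \<phi>(2,3)]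
        bspec[OF N \<phi>(1), THEN spec, THEN mp, THEN mp, OF \<phi>(2,3)]
      by (simp add: distrib_right)
  qed
qed

text \<open>It gives the symmetry of \<open>strong_dist\<close> for arbitrary signed arguments.
  Negation passes through \<delta> for every function, also outside \<open>Cc\<close>, where
  \<delta> vanishes.\<close>

lemma radon_prod_minus_minus:
  assumes "\<delta> \<in> radon"
  shows "radon_prod (\<lambda>\<phi>::'a \<Rightarrow> real. - \<delta> \<phi>) (\<lambda>\<phi>. - \<delta> \<phi>) = radon_prod \<delta> \<delta>"
proof -
  have neg: "\<delta> (\<lambda>x. - h x) = - \<delta> h" for h :: "'a \<Rightarrow> real"
  proof (cases "h \<in> Cc")
    case True
    then have "\<delta> (\<lambda>x. (- 1) * h x) = (- 1) * \<delta> h"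
      by (rule assms[unfolded radon_def mem_Collect_eq, THEN conjunct2, THEN conjunct1, rule_format])
    then show ?thesis by simp
  next
    case False
    then have "(\<lambda>x. - h x) \<notin> Cc" using Cc_uminus[of "\<lambda>x. - h x"] by auto
    then show ?thesis
      using assms[unfolded radon_def mem_Collect_eq, THEN conjunct2, THEN conjunct2, THEN conjunct2, rule_format]
        False by simp
  qed
  have "- \<delta> (\<lambda>x. - \<delta> (\<lambda>y. \<Phi> (x, y))) = \<delta> (\<lambda>x. \<delta> (\<lambda>y. \<Phi> (x, y)))" for \<Phi> :: "'a \<times> 'a \<Rightarrow> real"
    unfolding neg by simp
  then show ?thesis by (intro ext) (simp add: radon_prod_def)
qed

text \<open>On \<open>Cc\<close> the product of \<mu> - \<nu> with itself is P - Q, with the pure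
  terms in P and the mixed ones in Q. Finiteness of the integral against P suffices for the energy
  to be defined, before the mutual energy is known to be finite.\<close>

lemma energy_difference:
  assumes \<mu>: "\<mu> \<in> fin_energy_pos \<kappa>" and \<nu>: "\<nu> \<in> fin_energy_pos \<kappa>"
  shows "energy_defined \<kappa> (\<lambda>\<phi>. \<mu> \<phi> - \<nu> \<phi>)"
    and "energy \<kappa> (\<lambda>\<phi>. \<mu> \<phi> - \<nu> \<phi>) = (mutual_energy \<kappa> \<mu> \<mu> + mutual_energy \<kappa> \<nu> \<nu>)
      - (mutual_energy \<kappa> \<mu> \<nu> + mutual_energy \<kappa> \<mu> \<nu>)"
proof -
  have r: "\<mu> \<in> radon_pos" "\<nu> \<in> radon_pos" using \<mu> \<nu> by (auto simp: fin_energy_pos_iff)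
  note l = r[THEN radon_posD] and F = Cc_fiber_integral[OF lc]
  define P where "P = (\<lambda>\<Phi>. radon_prod \<mu> \<mu> \<Phi> + radon_prod \<nu> \<nu> \<Phi>)"
  define Q where "Q = (\<lambda>\<Phi>. radon_prod \<mu> \<nu> \<Phi> + radon_prod \<nu> \<mu> \<Phi>)"
  note pl = positive_linear_radon_prod[OF lc lc]
  have P: "positive_linear P" and Q: "positive_linear Q"
    unfolding P_def Q_def by (intro positive_linear_add pl l)+
  have lP: "lint P \<kappa> = mutual_energy \<kappa> \<mu> \<mu> + mutual_energy \<kappa> \<nu> \<nu>"
    unfolding P_def mutual_energy_eq_lint_prod[OF r(1) r(1)] mutual_energy_eq_lint_prod[OF r(2) r(2)]
    by (intro lint_add_measure lcp pl l kernel_envelope)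
  have lQ: "lint Q \<kappa> = mutual_energy \<kappa> \<mu> \<nu> + mutual_energy \<kappa> \<mu> \<nu>"
    using lint_add_measure[OF lcp pl[OF l(1) l(2)] pl[OF l(2) l(1)] kernel_envelope]
      mutual_energy_commute[OF r(1) r(2)]
    by (simp add: Q_def mutual_energy_eq_lint_prod r)
  have \<rho>: "radon_prod (\<lambda>\<phi>. \<mu> \<phi> - \<nu> \<phi>) (\<lambda>\<phi>. \<mu> \<phi> - \<nu> \<phi>) \<Phi> = P \<Phi> - Q \<Phi>" if \<Phi>: "\<Phi> \<in> Cc" for \<Phi>
    using \<Phi> by (simp add: radon_prod_def P_def Q_def pl_diff[OF l(1) F[OF l(1) \<Phi>] F[OF l(2) \<Phi>]]
        pl_diff[OF l(2) F[OF l(1) \<Phi>] F[OF l(2) \<Phi>]])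
  have fin: "lint P \<kappa> < \<infinity>"
    using \<mu> \<nu> by (auto simp: lP fin_energy_pos_iff)
  show "energy_defined \<kappa> (\<lambda>\<phi>. \<mu> \<phi> - \<nu> \<phi>)"
    unfolding energy_defined_def by (rule integral_defined_difference[OF lcp P Q \<rho> kernel_envelope fin])
  show "energy \<kappa> (\<lambda>\<phi>. \<mu> \<phi> - \<nu> \<phi>) = (mutual_energy \<kappa> \<mu> \<mu> + mutual_energy \<kappa> \<nu> \<nu>)
      - (mutual_energy \<kappa> \<mu> \<nu> + mutual_energy \<kappa> \<mu> \<nu>)"
    unfolding energy_def mutual_energy_def[of \<kappa> "\<lambda>\<phi>. \<mu> \<phi> - \<nu> \<phi>"] lP[symmetric] lQ[symmetric]
    by (rule radon_integral_difference[OF lcp P Q \<rho> kernel_envelope fin])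
qed

lemma mutual_energy_not_MInf:
  "\<mu> \<in> radon_pos \<Longrightarrow> \<nu> \<in> radon_pos \<Longrightarrow> mutual_energy \<kappa> \<mu> \<nu> \<noteq> -\<infinity>"
  by (simp add: mutual_energy_eq_lint lint_not_MInf potential_envelope)

text \<open>The measure with density g with respect to \<mu>; the value 0 outside \<open>Cc\<close>
  is the normalisation in \<open>radon\<close>.\<close>

definition weight :: "('a \<Rightarrow> real) \<Rightarrow> (('a \<Rightarrow> real) \<Rightarrow> real) \<Rightarrow> ('a \<Rightarrow> real) \<Rightarrow> real" where
  "weight g \<mu> \<phi> = (if \<phi> \<in> Cc then \<mu> (\<lambda>x. g x * \<phi> x) else 0)"

lemma weight_radon_pos:
  assumes "\<mu> \<in> radon_pos" "continuous_on UNIV g" "\<And>x. 0 \<le> g x"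
  shows "weight g \<mu> \<in> radon_pos"
proof -
  note l = radon_posD[OF assms(1)] and C = Cc_mult_continuous[OF _ assms(2)]
  have "positive_linear (weight g \<mu>)"
  proof (rule positive_linearI)
    fix \<phi> :: "'a \<Rightarrow> real" assume \<phi>: "\<phi> \<in> Cc"
    show "weight g \<mu> (\<lambda>x. \<phi> x + \<psi> x) = weight g \<mu> \<phi> + weight g \<mu> \<psi>" if "\<psi> \<in> Cc" for \<psi>
      using \<phi> that by (simp add: weight_def Cc_add distrib_left pl_add[OF l C C])
    show "weight g \<mu> (\<lambda>x. c * \<phi> x) = c * weight g \<mu> \<phi>" for c
      using pl_cmult[OF l C[OF \<phi>], of c] by (simp add: weight_def \<phi> Cc_cmult mult_ac)
    show "0 \<le> weight g \<mu> \<phi>" if "\<And>x. 0 \<le> \<phi> x"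
      using \<phi> that assms(3) by (simp add: weight_def) (intro pl_nonneg[OF l C], auto)
  qed
  then show ?thesis by (simp add: radon_pos_iff[OF lc] weight_def)
qed

lemma weight_le:
  assumes "\<mu> \<in> radon_pos" "continuous_on UNIV g" "\<And>x. g x \<le> 1" "\<phi> \<in> Cc" "\<And>x. 0 \<le> \<phi> x"
  shows "weight g \<mu> \<phi> \<le> \<mu> \<phi>"
proof -
  have "g x * \<phi> x \<le> \<phi> x" for x using mult_right_mono[OF assms(3,5)] by simp
  then show ?thesis
    using pl_mono[OF radon_posD[OF assms(1)] Cc_mult_continuous[OF assms(4,2)] assms(4)] assms(4)
    by (simp add: weight_def)
qed

text \<open>Taking t g\<mu> away from \<mu> is expressed as a sum, so that the bilinear calculus
  stays among positive measures.\<close>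

lemma weight_complement:
  assumes "\<mu> \<in> radon_pos" "continuous_on UNIV g"
  shows "madd (weight (\<lambda>x. 1 - t * g x) \<mu>) (mscale t (weight g \<mu>)) = \<mu>"
  unfolding madd_def mscale_def
proof
  fix \<phi>
  show "weight (\<lambda>x. 1 - t * g x) \<mu> \<phi> + t * weight g \<mu> \<phi> = \<mu> \<phi>"
  proof (cases "\<phi> \<in> Cc")
    case True
    note l = radon_posD[OF assms(1)] and C = Cc_mult_continuous[OF True assms(2)]
    have "\<mu> (\<lambda>x. \<phi> x - t * (g x * \<phi> x)) = \<mu> \<phi> - t * \<mu> (\<lambda>x. g x * \<phi> x)"
      by (simp add: pl_diff[OF l True Cc_cmult[OF C]] pl_cmult[OF l C])
    then show ?thesis using True by (simp add: weight_def algebra_simps)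
  qed (use assms in \<open>simp add: weight_def radon_pos_iff[OF lc]\<close>)
qed

text \<open>The energy need not be monotone in the measure when the kernel takes negative values.
  The integral of its positive part is monotone, and it is finite for \<mu> because the negative
  part has a finite integral.\<close>

lemma fin_energy_pos_mono:
  assumes \<mu>: "\<mu> \<in> fin_energy_pos \<kappa>" and \<sigma>: "\<sigma> \<in> radon_pos"
    and le: "\<And>\<phi>. \<phi> \<in> Cc \<Longrightarrow> (\<And>x. 0 \<le> \<phi> x) \<Longrightarrow> \<sigma> \<phi> \<le> \<mu> \<phi>"
  shows "\<sigma> \<in> fin_energy_pos \<kappa>"
proof -
  have r: "\<mu> \<in> radon_pos" using \<mu> by (simp add: fin_energy_pos_iff)
  note l = radon_posD[OF r] radon_posD[OF \<sigma>]
  note pl = positive_linear_radon_prod[OF lc lc l(1) l(1)] positive_linear_radon_prod[OF lc lc l(2) l(2)]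
  have "radon_prod \<sigma> \<sigma> \<Phi> \<le> radon_prod \<mu> \<mu> \<Phi>" if \<Phi>: "\<Phi> \<in> Cc" "\<And>p. 0 \<le> \<Phi> p" for \<Phi>
  proof -
    note F = Cc_fiber_integral[OF lc _ \<Phi>(1)] and S = Cc_section[OF \<Phi>(1)]
    have "\<sigma> (\<lambda>x. \<sigma> (\<lambda>y. \<Phi> (x, y))) \<le> \<mu> (\<lambda>x. \<sigma> (\<lambda>y. \<Phi> (x, y)))"
      by (intro le F l pl_nonneg[OF l(2)] S \<Phi>)
    also have "\<dots> \<le> \<mu> (\<lambda>x. \<mu> (\<lambda>y. \<Phi> (x, y)))"
      by (intro pl_mono[OF l(1)] F l le S \<Phi>)
    finally show ?thesis using \<Phi>(1) by (simp add: radon_prod_def)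
  qed
  then have "lint (radon_prod \<sigma> \<sigma>) (\<lambda>p. max 0 (\<kappa> p)) \<le> lint (radon_prod \<mu> \<mu>) (\<lambda>p. max 0 (\<kappa> p))"
    by (intro lint_mono_measure pl(2)) auto
  moreover have "lint (radon_prod \<mu> \<mu>) (\<lambda>p. max 0 (\<kappa> p)) < \<infinity>"
    using \<mu> lint_pos_neg_parts[OF lcp pl(1) kernel_envelope]
    by (cases "lint (radon_prod \<mu> \<mu>) (\<lambda>p. min 0 (\<kappa> p))")
      (auto simp: fin_energy_pos_iff mutual_energy_eq_lint_prod)
  moreover have "lint (radon_prod \<sigma> \<sigma>) \<kappa> \<le> lint (radon_prod \<sigma> \<sigma>) (\<lambda>p. max 0 (\<kappa> p))"
    by (rule lint_mono) simp
  ultimately show ?thesis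
    using \<sigma> by (auto simp: fin_energy_pos_iff mutual_energy_eq_lint_prod)
qed

end

section \<open>The strong inner product on the cone\<close>

locale energy_kernel = lc_kernel +
  assumes energy_principle: "energy_principle \<kappa>"
begin

abbreviation "E \<equiv> fin_energy_pos \<kappa>"

text \<open>\<open>real_of_ereal\<close> sends infinite values to 0, so \<open>B\<close> is
  informative on \<open>E\<close>, where the mutual energy is finite by
  \<open>mutual_energy_eq_B\<close>.\<close>

definition B :: "(('a \<Rightarrow> real) \<Rightarrow> real) \<Rightarrow> (('a \<Rightarrow> real) \<Rightarrow> real) \<Rightarrow> real" where
  "B \<mu> \<nu> = real_of_ereal (mutual_energy \<kappa> \<mu> \<nu>)"

lemma E_radon_pos: "\<mu> \<in> E \<Longrightarrow> \<mu> \<in> radon_pos"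
  by (simp add: fin_energy_pos_iff)

lemma E_linear: "\<mu> \<in> E \<Longrightarrow> positive_linear \<mu>"
  by (simp add: E_radon_pos radon_posD)

lemma difference_principle:
  assumes "\<mu> \<in> E" "\<nu> \<in> E"
  shows "0 \<le> energy \<kappa> (\<lambda>\<phi>. \<mu> \<phi> - \<nu> \<phi>)"
    and "energy \<kappa> (\<lambda>\<phi>. \<mu> \<phi> - \<nu> \<phi>) = 0 \<Longrightarrow> \<mu> = \<nu>"
proof -
  have r: "(\<lambda>\<phi>. \<mu> \<phi> - \<nu> \<phi>) \<in> radon"
    using assms by (intro radon_diff) (auto simp: fin_energy_pos_iff radon_pos_def)
  note ep = energy_principle[unfolded energy_principle_def, rule_format, OF r energy_difference(1)[OF assms]]
  show "0 \<le> energy \<kappa> (\<lambda>\<phi>. \<mu> \<phi> - \<nu> \<phi>)" using ep by simp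
  assume "energy \<kappa> (\<lambda>\<phi>. \<mu> \<phi> - \<nu> \<phi>) = 0"
  then have 0: "(\<lambda>\<phi>. \<mu> \<phi> - \<nu> \<phi>) = (\<lambda>_. 0)" using ep by blast
  show "\<mu> = \<nu>"
  proof
    fix \<phi>
    show "\<mu> \<phi> = \<nu> \<phi>" using fun_cong[OF 0, of \<phi>] by simp
  qed
qed

text \<open>An infinite mutual energy would make the energy of \<mu> - \<nu> equal to -\<infinity>,
  against the energy principle.\<close>

lemma mutual_energy_eq_B:
  assumes "\<mu> \<in> E" "\<nu> \<in> E"
  shows "mutual_energy \<kappa> \<mu> \<nu> = ereal (B \<mu> \<nu>)"
proof -
  note r = E_radon_pos[OF assms(1)] E_radon_pos[OF assms(2)]
  have not_PInf: "c \<noteq> \<infinity>" if "s < \<infinity>" "0 \<le> s - (c + c)" for s c :: ereal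
    using that by (cases s; cases c) auto
  have "mutual_energy \<kappa> \<mu> \<mu> < \<infinity>" "mutual_energy \<kappa> \<nu> \<nu> < \<infinity>"
    using assms unfolding fin_energy_pos_iff by blast+
  then have "mutual_energy \<kappa> \<mu> \<mu> + mutual_energy \<kappa> \<nu> \<nu> < \<infinity>" by simp
  moreover have "0 \<le> (mutual_energy \<kappa> \<mu> \<mu> + mutual_energy \<kappa> \<nu> \<nu>)
      - (mutual_energy \<kappa> \<mu> \<nu> + mutual_energy \<kappa> \<mu> \<nu>)"
    using difference_principle(1)[OF assms] unfolding energy_difference(2)[OF assms] .
  ultimately have "mutual_energy \<kappa> \<mu> \<nu> \<noteq> \<infinity>"
    by (rule not_PInf)
  then have "\<bar>mutual_energy \<kappa> \<mu> \<nu>\<bar> \<noteq> \<infinity>" using mutual_energy_not_MInf[OF r] by (rule ereal_infinity_cases)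
  then show ?thesis unfolding B_def by (simp add: ereal_real)
qed

lemma lint_potential_eq_B: "\<mu> \<in> E \<Longrightarrow> \<nu> \<in> E \<Longrightarrow> lint \<mu> (potential \<kappa> \<nu>) = ereal (B \<mu> \<nu>)"
  using mutual_energy_eq_B[of \<mu> \<nu>] by (simp add: mutual_energy_eq_lint E_radon_pos)

lemma B_commute: "\<mu> \<in> E \<Longrightarrow> \<nu> \<in> E \<Longrightarrow> B \<mu> \<nu> = B \<nu> \<mu>"
  unfolding B_def by (simp add: mutual_energy_commute E_radon_pos)

lemma mutual_energy_madd_left:
  assumes "\<mu> \<in> radon_pos" "\<nu> \<in> radon_pos" "\<sigma> \<in> radon_pos"
  shows "mutual_energy \<kappa> (madd \<mu> \<nu>) \<sigma> = mutual_energy \<kappa> \<mu> \<sigma> + mutual_energy \<kappa> \<nu> \<sigma>"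
  unfolding mutual_energy_eq_lint[OF radon_pos_madd[OF assms(1,2)] assms(3)]
    mutual_energy_eq_lint[OF assms(1,3)] mutual_energy_eq_lint[OF assms(2,3)]
  unfolding madd_def
  by (intro lint_add_measure lc radon_posD potential_envelope assms)

lemma mutual_energy_mscale_left:
  assumes "\<mu> \<in> radon_pos" "\<sigma> \<in> radon_pos" "0 \<le> c"
  shows "mutual_energy \<kappa> (mscale c \<mu>) \<sigma> = ereal c * mutual_energy \<kappa> \<mu> \<sigma>"
  unfolding mutual_energy_eq_lint[OF radon_pos_mscale[OF assms(1,3)] assms(2)]
    mutual_energy_eq_lint[OF assms(1,2)]
  unfolding mscale_def
  by (intro lint_cmult_measure potential_envelope assms)

lemma E_madd:
  assumes "\<mu> \<in> E" "\<nu> \<in> E" shows "madd \<mu> \<nu> \<in> E"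
proof -
  note r = E_radon_pos[OF assms(1)] E_radon_pos[OF assms(2)]
  note s = radon_pos_madd[OF r]
  have "mutual_energy \<kappa> (madd \<mu> \<nu>) (madd \<mu> \<nu>)
      = (mutual_energy \<kappa> \<mu> \<mu> + mutual_energy \<kappa> \<nu> \<mu>) + (mutual_energy \<kappa> \<mu> \<nu> + mutual_energy \<kappa> \<nu> \<nu>)"
    unfolding mutual_energy_madd_left[OF r s] mutual_energy_commute[OF r(1) s] mutual_energy_commute[OF r(2) s]
      mutual_energy_madd_left[OF r r(1)] mutual_energy_madd_left[OF r r(2)] ..
  also have "\<dots> < \<infinity>" by (simp add: mutual_energy_eq_B assms)
  finally show ?thesis using s by (simp add: fin_energy_pos_iff)
qed

lemma E_mscale:
  assumes "\<mu> \<in> E" "0 \<le> c" shows "mscale c \<mu> \<in> E"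
proof -
  note r = E_radon_pos[OF assms(1)]
  note s = radon_pos_mscale[OF r assms(2)]
  have "mutual_energy \<kappa> (mscale c \<mu>) (mscale c \<mu>) = ereal c * (ereal c * mutual_energy \<kappa> \<mu> \<mu>)"
    unfolding mutual_energy_mscale_left[OF r s assms(2)] mutual_energy_commute[OF r s]
      mutual_energy_mscale_left[OF r r assms(2)] ..
  also have "\<dots> < \<infinity>" by (simp add: mutual_energy_eq_B assms)
  finally show ?thesis using s by (simp add: fin_energy_pos_iff)
qed

lemma B_madd_left:
  assumes "\<mu> \<in> E" "\<nu> \<in> E" "\<sigma> \<in> E"
  shows "B (madd \<mu> \<nu>) \<sigma> = B \<mu> \<sigma> + B \<nu> \<sigma>"
  using mutual_energy_madd_left[OF assms[THEN E_radon_pos]]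
  by (simp add: mutual_energy_eq_B E_madd assms)

lemma B_mscale_left:
  assumes "\<mu> \<in> E" "\<sigma> \<in> E" "0 \<le> c"
  shows "B (mscale c \<mu>) \<sigma> = c * B \<mu> \<sigma>"
  using mutual_energy_mscale_left[OF assms(1,2)[THEN E_radon_pos] assms(3)]
  by (simp add: mutual_energy_eq_B E_mscale assms)

lemma B_madd_right:
  assumes "\<mu> \<in> E" "\<nu> \<in> E" "\<sigma> \<in> E"
  shows "B \<sigma> (madd \<mu> \<nu>) = B \<sigma> \<mu> + B \<sigma> \<nu>"
  using B_madd_left[OF assms] by (simp add: B_commute[OF assms(3)] E_madd assms)

lemma B_mscale_right:
  assumes "\<mu> \<in> E" "\<sigma> \<in> E" "0 \<le> c"
  shows "B \<sigma> (mscale c \<mu>) = c * B \<sigma> \<mu>"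
  using B_mscale_left[OF assms] by (simp add: B_commute[OF assms(2)] E_mscale assms)

lemmas B_linear = B_madd_left B_madd_right B_mscale_left B_mscale_right E_madd E_mscale

text \<open>The squared strong norm of \<mu> - \<nu>, expanded so that it involves members of the
  cone only.\<close>

definition q :: "(('a \<Rightarrow> real) \<Rightarrow> real) \<Rightarrow> (('a \<Rightarrow> real) \<Rightarrow> real) \<Rightarrow> real" where
  "q \<mu> \<nu> = B \<mu> \<mu> + B \<nu> \<nu> - 2 * B \<mu> \<nu>"

lemma energy_difference_eq_q:
  assumes "\<mu> \<in> E" "\<nu> \<in> E"
  shows "energy \<kappa> (\<lambda>\<phi>. \<mu> \<phi> - \<nu> \<phi>) = ereal (q \<mu> \<nu>)"
  by (simp add: energy_difference(2)[OF assms] mutual_energy_eq_B assms q_def)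

lemma q_nonneg: "\<mu> \<in> E \<Longrightarrow> \<nu> \<in> E \<Longrightarrow> 0 \<le> q \<mu> \<nu>"
  using difference_principle(1)[of \<mu> \<nu>] by (simp add: energy_difference_eq_q)

lemma q_zero_iff: "\<mu> \<in> E \<Longrightarrow> \<nu> \<in> E \<Longrightarrow> q \<mu> \<nu> = 0 \<longleftrightarrow> \<mu> = \<nu>"
  using difference_principle(2)[of \<mu> \<nu>] by (auto simp: energy_difference_eq_q q_def)

lemma q_commute: "\<mu> \<in> E \<Longrightarrow> \<nu> \<in> E \<Longrightarrow> q \<mu> \<nu> = q \<nu> \<mu>"
  by (simp add: q_def B_commute[of \<mu> \<nu>])

lemma strong_dist_eq_q: "\<mu> \<in> E \<Longrightarrow> \<nu> \<in> E \<Longrightarrow> strong_dist \<kappa> \<mu> \<nu> = sqrt (q \<mu> \<nu>)"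
  by (simp add: strong_dist_def fin_energy_pos_def[of \<kappa>] energy_norm_def)
    (simp add: energy_difference_eq_q fin_energy_pos_def)

text \<open>Cauchy--Schwarz for \<open>\<mu> - \<nu>\<close> and \<open>\<nu> - \<sigma>\<close>; \<open>s (\<mu> - \<nu>) - t (\<nu> - \<sigma>)\<close> is again a difference of
  elements of the cone.\<close>

lemma sqrt_q_triangle:
  assumes E: "\<mu> \<in> E" "\<nu> \<in> E" "\<sigma> \<in> E"
  shows "sqrt (q \<mu> \<sigma>) \<le> sqrt (q \<mu> \<nu>) + sqrt (q \<nu> \<sigma>)"
proof -
  \<comment> \<open>The inner product of \<mu> - \<nu> and \<nu> - \<sigma>.\<close>
  define c where "c = B \<mu> \<nu> - B \<mu> \<sigma> - B \<nu> \<nu> + B \<nu> \<sigma>"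
  have exp: "q \<mu> \<sigma> = q \<mu> \<nu> + q \<nu> \<sigma> + 2 * c"
    by (simp add: q_def c_def B_commute[of \<sigma> \<nu>] B_commute[of \<sigma> \<mu>] B_commute[of \<nu> \<mu>] E)
  have quad: "2 * (s * t) * c \<le> s\<^sup>2 * q \<mu> \<nu> + t\<^sup>2 * q \<nu> \<sigma>" if st: "0 \<le> s" "0 \<le> t" for s t
  proof -
    \<comment> \<open>Here a - b equals s (\<mu> - \<nu>) - t (\<nu> - \<sigma>), with the positive
      and the negative terms collected.\<close>
    define a where "a = madd (mscale s \<mu>) (mscale t \<sigma>)"
    define b where "b = mscale (s + t) \<nu>"
    have ab: "a \<in> E" "b \<in> E" unfolding a_def b_def using st E by (simp_all add: E_madd E_mscale)
    have aa: "B a a = s\<^sup>2 * B \<mu> \<mu> + 2 * s * t * B \<mu> \<sigma> + t\<^sup>2 * B \<sigma> \<sigma>"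
      using st E by (simp add: a_def B_linear B_commute[of \<sigma> \<mu>] power2_eq_square algebra_simps)
    have bb: "B b b = (s + t)\<^sup>2 * B \<nu> \<nu>"
      using st E by (simp add: b_def B_linear power2_eq_square)
    have abv: "B a b = (s + t) * (s * B \<mu> \<nu> + t * B \<nu> \<sigma>)"
      using st E by (simp add: a_def b_def B_linear B_commute[of \<sigma> \<nu>] algebra_simps)
    have "0 \<le> q a b" by (rule q_nonneg[OF ab])
    also have "q a b = s\<^sup>2 * q \<mu> \<nu> + t\<^sup>2 * q \<nu> \<sigma> - 2 * (s * t) * c"
      by (simp add: q_def aa bb abv c_def power2_eq_square algebra_simps)
    finally show ?thesis by simp
  qed
  define m where "m = sqrt (q \<mu> \<nu>)"
  define n where "n = sqrt (q \<nu> \<sigma>)"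
  have mn: "0 \<le> m" "0 \<le> n" "m\<^sup>2 = q \<mu> \<nu>" "n\<^sup>2 = q \<nu> \<sigma>"
    using q_nonneg E by (auto simp: m_def n_def)
  have "c \<le> m * n"
  proof (cases "m = 0 \<or> n = 0")
    case True
    then have "\<mu> = \<nu> \<or> \<nu> = \<sigma>" using mn q_zero_iff E by auto
    then have "c = 0" by (auto simp: c_def B_commute E)
    then show ?thesis using mn by simp
  next
    case False
    then have pos: "0 < m * n" using mn by (simp add: less_le)
    \<comment> \<open>The choice s = n, t = m makes the two squares equal, so that dividing by 2 m n
      leaves Cauchy--Schwarz.\<close>
    have "2 * (n * m) * c \<le> n\<^sup>2 * m\<^sup>2 + m\<^sup>2 * n\<^sup>2"
      using quad[OF mn(2,1)] mn by simp
    then have "(2 * (m * n)) * c \<le> (2 * (m * n)) * (m * n)"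
      by (simp add: power2_eq_square algebra_simps)
    then show ?thesis using pos by (subst (asm) mult_le_cancel_left_pos) auto
  qed
  then have "q \<mu> \<sigma> \<le> (m + n)\<^sup>2" unfolding exp mn(3,4)[symmetric] by (simp add: power2_sum)
  then show ?thesis using real_le_lsqrt[of "q \<mu> \<sigma>" "m + n"] mn by (simp add: m_def n_def real_sqrt_le_iff real_le_lsqrt)
qed

lemma Metric_space_strong: "Metric_space E (strong_dist \<kappa>)"
proof
  fix \<mu> \<nu> :: "('a \<Rightarrow> real) \<Rightarrow> real"
  show "0 \<le> strong_dist \<kappa> \<mu> \<nu>"
  proof (cases "\<mu> \<in> fin_energy \<kappa> \<and> \<nu> \<in> fin_energy \<kappa>")
    case True
    then have r: "(\<lambda>\<phi>. \<mu> \<phi> - \<nu> \<phi>) \<in> radon" by (intro radon_diff) (auto simp: fin_energy_def)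
    have "0 \<le> energy \<kappa> (\<lambda>\<phi>. \<mu> \<phi> - \<nu> \<phi>)"
    proof (cases "energy_defined \<kappa> (\<lambda>\<phi>. \<mu> \<phi> - \<nu> \<phi>)")
      case True
      then show ?thesis using energy_principle r by (auto simp: energy_principle_def)
    next
      \<comment> \<open>Where the energy is undefined, its formal value \<infinity> - \<infinity> is
        \<infinity> in \<open>ereal\<close>, which is still nonnegative.\<close>
      case False
      then show ?thesis
        by (simp add: energy_def mutual_energy_def energy_defined_def integral_defined_def radon_integral_def)
    qed
    then show ?thesis using True by (simp add: strong_dist_def energy_norm_def real_of_ereal_pos)
  qed (auto simp: strong_dist_def)
  show "strong_dist \<kappa> \<mu> \<nu> = strong_dist \<kappa> \<nu> \<mu>"
  proof (cases "\<mu> \<in> fin_energy \<kappa> \<and> \<nu> \<in> fin_energy \<kappa>")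
    case True
    then have r: "(\<lambda>\<phi>. \<mu> \<phi> - \<nu> \<phi>) \<in> radon" by (intro radon_diff) (auto simp: fin_energy_def)
    show ?thesis
      using True radon_prod_minus_minus[OF r]
      by (simp add: strong_dist_def energy_norm_def energy_def mutual_energy_def)
  qed (auto simp: strong_dist_def)
next
  fix \<mu> \<nu> assume "\<mu> \<in> E" "\<nu> \<in> E"
  then show "strong_dist \<kappa> \<mu> \<nu> = 0 \<longleftrightarrow> \<mu> = \<nu>"
    by (simp add: strong_dist_eq_q q_zero_iff)
next
  fix \<mu> \<nu> \<sigma> assume "\<mu> \<in> E" "\<nu> \<in> E" "\<sigma> \<in> E"
  then show "strong_dist \<kappa> \<mu> \<sigma> \<le> strong_dist \<kappa> \<mu> \<nu> + strong_dist \<kappa> \<nu> \<sigma>"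
    by (simp add: strong_dist_eq_q sqrt_q_triangle)
qed

end

section \<open>Positivity of mass\<close>

text \<open>2 a is the derivative of the quadratic at t = 0, the form in which every variation below
  arises. Only t \<le> 1 is tested, since a density 1 - t g must stay nonnegative.\<close>

lemma nonneg_slope:
  fixes a b :: real
  assumes "\<And>t. 0 < t \<Longrightarrow> t \<le> 1 \<Longrightarrow> 0 \<le> 2 * t * a + t\<^sup>2 * b"
  shows "0 \<le> a"
proof (rule ccontr)
  assume "\<not> 0 \<le> a"
  then have a: "a < 0" by simp
  \<comment> \<open>Small enough that t (|b| + 1) \<le> -a, so that 2 a outweighs t b.\<close>
  define t where "t = min 1 (- a / (\<bar>b\<bar> + 1))"
  have t: "0 < t" "t \<le> 1" using a by (auto simp: t_def divide_neg_pos)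
  have "t \<le> - a / (\<bar>b\<bar> + 1)" by (simp add: t_def)
  then have "t * (\<bar>b\<bar> + 1) \<le> - a" by (subst (asm) pos_le_divide_eq) simp_all
  moreover have "t * b \<le> t * (\<bar>b\<bar> + 1)" using t by (intro mult_left_mono) auto
  ultimately have "2 * a + t * b < 0" using a by linarith
  then have "t * (2 * a + t * b) < 0" using t by (simp add: mult_pos_neg)
  then show False using assms[OF t] by (simp add: power2_eq_square algebra_simps)
qed

lemma Cc_bounded:
  fixes \<phi> :: "'a::t2_space \<Rightarrow> real"
  assumes "\<phi> \<in> Cc"
  shows "\<exists>M>0. \<forall>x. \<bar>\<phi> x\<bar> \<le> M"
proof -
  obtain K where K: "compact K" "\<And>x. x \<notin> K \<Longrightarrow> \<phi> x = 0" using Cc_vanishes[OF assms] by auto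
  have "continuous_on K \<phi>" using Cc_continuous[OF assms] by (rule continuous_on_subset) simp
  then have "bounded (\<phi> ` K)" using K(1) by (intro compact_imp_bounded compact_continuous_image)
  then obtain M where M: "\<And>x. x \<in> K \<Longrightarrow> \<bar>\<phi> x\<bar> \<le> M" by (auto simp: bounded_iff)
  have "\<bar>\<phi> x\<bar> \<le> max 1 M" for x
    using M[of x] K(2)[of x] by (cases "x \<in> K") auto
  then show ?thesis by (intro exI[of _ "max 1 M"]) auto
qed

context energy_kernel
begin

definition zero_measure :: "('a \<Rightarrow> real) \<Rightarrow> real" where
  "zero_measure = (\<lambda>_. 0)"

lemma mscale_zero: "mscale 0 \<mu> = zero_measure"
  by (simp add: mscale_def zero_measure_def)

lemma zero_measure_E: "zero_measure \<in> E"
proof -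
  have r: "zero_measure \<in> radon_pos"
    unfolding radon_pos_iff[OF lc] zero_measure_def by (simp add: positive_linear_def)
  have "mutual_energy \<kappa> (mscale 0 zero_measure) zero_measure = 0"
    unfolding mutual_energy_mscale_left[OF r r order_refl] by (simp flip: zero_ereal_def)
  then show ?thesis using r unfolding fin_energy_pos_iff mscale_zero by simp
qed

lemma B_zero_left: "\<mu> \<in> E \<Longrightarrow> B zero_measure \<mu> = 0"
  using B_mscale_left[OF zero_measure_E, of \<mu> 0] by (simp add: mscale_zero)

lemma B_zero_right: "\<mu> \<in> E \<Longrightarrow> B \<mu> zero_measure = 0"
  using B_zero_left[of \<mu>] B_commute[of \<mu> zero_measure] by (simp add: zero_measure_E)

lemma q_zero_measure: "\<mu> \<in> E \<Longrightarrow> q \<mu> zero_measure = B \<mu> \<mu>" "\<mu> \<in> E \<Longrightarrow> q zero_measure \<mu> = B \<mu> \<mu>"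
  by (simp_all add: q_def B_zero_left B_zero_right zero_measure_E)

lemma B_self_nonneg: "\<mu> \<in> E \<Longrightarrow> 0 \<le> B \<mu> \<mu>"
  using q_nonneg[OF zero_measure_E, of \<mu>] by (simp add: q_zero_measure)

text \<open>The cone has no negatives, so the two signs are treated apart: the triangle inequality
  from \<mu> to \<nu> through 0 bounds -B, and from \<mu> + \<nu> to 0 through \<nu> it bounds
  B.\<close>

lemma B_Cauchy_Schwarz:
  assumes "\<mu> \<in> E" "\<nu> \<in> E"
  shows "\<bar>B \<mu> \<nu>\<bar> \<le> sqrt (B \<mu> \<mu>) * sqrt (B \<nu> \<nu>)"
proof -
  define m where "m = sqrt (B \<mu> \<mu>)"
  define n where "n = sqrt (B \<nu> \<nu>)"
  have mn: "0 \<le> m" "0 \<le> n" "m\<^sup>2 = B \<mu> \<mu>" "n\<^sup>2 = B \<nu> \<nu>"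
    using B_self_nonneg assms by (simp_all add: m_def n_def)
  have s: "madd \<mu> \<nu> \<in> E" by (rule E_madd[OF assms])
  have "sqrt (q \<mu> \<nu>) \<le> m + n"
    using sqrt_q_triangle[OF assms(1) zero_measure_E assms(2)]
    by (simp add: q_zero_measure assms m_def n_def)
  then have "q \<mu> \<nu> \<le> (m + n)\<^sup>2" using mn by (simp add: sqrt_le_D)
  then have 1: "- B \<mu> \<nu> \<le> m * n" by (simp add: q_def power2_sum mn)
  have "q (madd \<mu> \<nu>) \<nu> = B \<mu> \<mu>"
    by (simp add: q_def B_madd_left B_madd_right s assms B_commute[OF assms(2,1)])
  then have "sqrt (q (madd \<mu> \<nu>) zero_measure) \<le> m + n"
    using sqrt_q_triangle[OF s assms(2) zero_measure_E]
    by (simp add: q_zero_measure assms m_def n_def)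
  then have "q (madd \<mu> \<nu>) zero_measure \<le> (m + n)\<^sup>2" using mn by (simp add: sqrt_le_D)
  moreover have "q (madd \<mu> \<nu>) zero_measure = B \<mu> \<mu> + B \<nu> \<nu> + 2 * B \<mu> \<nu>"
    by (simp add: q_zero_measure s B_madd_left B_madd_right assms B_commute[OF assms(2,1)])
  ultimately have 2: "B \<mu> \<nu> \<le> m * n" by (simp add: power2_sum mn)
  show ?thesis using 1 2 by (simp add: m_def n_def)
qed

lemma weight_E:
  assumes "\<mu> \<in> E" "continuous_on UNIV g" "\<And>x. 0 \<le> g x" "\<And>x. g x \<le> 1"
  shows "weight g \<mu> \<in> E"
  by (rule fin_energy_pos_mono[OF assms(1) weight_radon_pos[OF E_radon_pos[OF assms(1)] assms(2,3)]
        weight_le[OF E_radon_pos[OF assms(1)] assms(2,4)]])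

text \<open>Since \<mu> = \<sigma> + t w, the pairings of \<sigma> follow by subtracting real
  numbers, which the finiteness of mutual energies on the cone permits.\<close>

lemma weight_split:
  assumes \<mu>: "\<mu> \<in> E" and g: "continuous_on UNIV g" "\<And>x. 0 \<le> g x" "\<And>x. g x \<le> 1" and t: "0 \<le> t" "t \<le> 1"
  defines "\<sigma> \<equiv> weight (\<lambda>x. 1 - t * g x) \<mu>" and "w \<equiv> weight g \<mu>"
  shows "\<sigma> \<in> E" "w \<in> E" "\<And>\<nu>. \<nu> \<in> E \<Longrightarrow> B \<sigma> \<nu> = B \<mu> \<nu> - t * B w \<nu>"
    "\<And>\<phi>. \<sigma> \<phi> = \<mu> \<phi> - t * w \<phi>"
proof -
  show w: "w \<in> E" unfolding w_def by (rule weight_E[OF \<mu> g])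
  have "t * g x \<le> 1" for x using t g(2,3)[of x] by (intro mult_le_one)
  then show \<sigma>: "\<sigma> \<in> E" unfolding \<sigma>_def
    using t g(2) by (intro weight_E[OF \<mu>] continuous_intros g(1)) auto
  have split: "madd \<sigma> (mscale t w) = \<mu>"
    unfolding \<sigma>_def w_def by (rule weight_complement[OF E_radon_pos[OF \<mu>] g(1)])
  show "B \<sigma> \<nu> = B \<mu> \<nu> - t * B w \<nu>" if \<nu>: "\<nu> \<in> E" for \<nu>
    using B_madd_left[OF \<sigma> E_mscale[OF w t(1)] \<nu>] B_mscale_left[OF w \<nu> t(1)] by (simp add: split)
  show "\<sigma> \<phi> = \<mu> \<phi> - t * w \<phi>" for \<phi>
    using fun_cong[OF split, of \<phi>] by (simp add: madd_def mscale_def)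
qed

end

locale perfect_kernel = lc_kernel +
  assumes perfect: "perfect \<kappa>"

sublocale perfect_kernel \<subseteq> energy_kernel
  by unfold_locales (use perfect in \<open>simp add: perfect_def\<close>)

section \<open>Strong completeness and the auxiliary minimum problem\<close>

context perfect_kernel
begin

text \<open>Evaluation at \<phi> is vaguely continuous, and perfectness makes vaguely open sets
  strongly open. The comparison of the two topologies enters through this lemma alone.\<close>

lemma openin_strong_evaluation:
  assumes "\<mu> \<in> E"
  shows "openin (strong_topology \<kappa>) {\<sigma> \<in> E. \<bar>\<sigma> \<phi> - \<mu> \<phi>\<bar> < e}"
proof -
  define V where "V = {\<sigma> :: ('a \<Rightarrow> real) \<Rightarrow> real. \<bar>\<sigma> \<phi> - \<mu> \<phi>\<bar> < e}"
  have "continuous_on UNIV (\<lambda>\<sigma> :: ('a \<Rightarrow> real) \<Rightarrow> real. \<sigma> \<phi>)" by (rule continuous_on_product_coordinates)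
  then have V: "open V" unfolding V_def by (intro open_Collect_less continuous_intros)
  have "\<sigma> \<in> radon" if "\<sigma> \<in> E" for \<sigma>
    using that unfolding fin_energy_pos_def fin_energy_def Int_iff mem_Collect_eq by simp
  then have "{\<sigma> \<in> E. \<bar>\<sigma> \<phi> - \<mu> \<phi>\<bar> < e} = (radon \<inter> V) \<inter> E" unfolding V_def by auto
  moreover have "openin vague_topology (radon \<inter> V)"
    using V unfolding vague_topology_def by (simp add: openin_open_Int)
  ultimately have "openin (subtopology vague_topology E) {\<sigma> \<in> E. \<bar>\<sigma> \<phi> - \<mu> \<phi>\<bar> < e}"
    unfolding openin_subtopology by (intro exI conjI)
  then show ?thesis using perfect unfolding perfect_def by simp
qed

text \<open>Continuity at 0 together with homogeneity, as for bounded linear forms: a strong ball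
  around 0 on which the evaluation stays below 1 is rescaled. A vanishing norm forces \<sigma> =
  0.\<close>

lemma evaluation_le_energy_norm:
  assumes \<phi>: "\<phi> \<in> Cc"
  shows "\<exists>C\<ge>0. \<forall>\<sigma>\<in>E. \<sigma> \<phi> \<le> C * sqrt (B \<sigma> \<sigma>)"
proof -
  interpret S: Metric_space E "strong_dist \<kappa>" by (rule Metric_space_strong)
  define U where "U = {\<sigma> \<in> E. \<bar>\<sigma> \<phi> - zero_measure \<phi>\<bar> < 1}"
  have U: "openin S.mtopology U"
    using openin_strong_evaluation[OF zero_measure_E] unfolding U_def strong_topology_def .
  have "zero_measure \<in> U" by (simp add: U_def zero_measure_E)
  then obtain r where r: "r > 0" "S.mball zero_measure r \<subseteq> U"
    using U unfolding S.openin_mtopology by metis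
  have "\<sigma> \<phi> \<le> (2 / r) * sqrt (B \<sigma> \<sigma>)" if \<sigma>: "\<sigma> \<in> E" for \<sigma>
  proof (cases "B \<sigma> \<sigma> = 0")
    case True
    then have "\<sigma> = zero_measure"
      using q_zero_iff[OF \<sigma> zero_measure_E] by (simp add: q_zero_measure \<sigma>)
    then show ?thesis using True by (simp add: zero_measure_def)
  next
    case False
    define s where "s = sqrt (B \<sigma> \<sigma>)"
    have s: "s > 0" "B \<sigma> \<sigma> = s\<^sup>2" using False B_self_nonneg[OF \<sigma>] by (auto simp: s_def)
    \<comment> \<open>Scales \<sigma> to strong norm r/2, inside the ball.\<close>
    define c where "c = r / (2 * s)"
    have c: "0 \<le> c" "c * s = r / 2" using r s by (auto simp: c_def)
    have cE: "mscale c \<sigma> \<in> E" by (rule E_mscale[OF \<sigma> c(1)])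
    have "q zero_measure (mscale c \<sigma>) = (c * s)\<^sup>2"
      using s c by (simp add: q_zero_measure cE B_mscale_left B_mscale_right \<sigma> power2_eq_square)
    then have "strong_dist \<kappa> zero_measure (mscale c \<sigma>) = r / 2"
      using c r by (simp add: strong_dist_eq_q zero_measure_E cE)
    then have "mscale c \<sigma> \<in> S.mball zero_measure r"
      using r by (simp add: S.in_mball zero_measure_E cE)
    then have "mscale c \<sigma> \<in> U" using r(2) by (rule subsetD[rotated])
    then have "\<bar>c * \<sigma> \<phi>\<bar> < 1" unfolding U_def by (simp add: mscale_def zero_measure_def)
    then have "c * \<sigma> \<phi> < 1" by linarith
    then have "r * \<sigma> \<phi> < 2 * s" using s r by (simp add: c_def field_simps)
    then show ?thesis using r by (simp add: s_def[symmetric] field_simps)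
  qed
  then show ?thesis using r by (intro exI[of _ "2 / r"]) auto
qed

text \<open>The functional is a squared norm minus twice a linear form bounded by the norm, hence
  bounded below. The parallelogram law makes a minimizing sequence strongly Cauchy, completeness of
  the cone gives a limit, and both terms are strongly continuous.\<close>

lemma equilibrium_exists:
  assumes \<phi>: "\<phi> \<in> Cc"
  shows "\<exists>\<gamma>\<in>E. \<forall>\<sigma>\<in>E. B \<gamma> \<gamma> - 2 * \<gamma> \<phi> \<le> B \<sigma> \<sigma> - 2 * \<sigma> \<phi>"
proof -
  interpret S: Metric_space E "strong_dist \<kappa>" by (rule Metric_space_strong)
  define J where "J = (\<lambda>\<sigma>. B \<sigma> \<sigma> - 2 * \<sigma> \<phi>)"
  obtain C where C: "C \<ge> 0" "\<forall>\<sigma>\<in>E. \<sigma> \<phi> \<le> C * sqrt (B \<sigma> \<sigma>)" using evaluation_le_energy_norm[OF \<phi>] by auto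
  \<comment> \<open>From s^2 - 2 C s \<ge> -C^2.\<close>
  have lower: "- (C\<^sup>2) \<le> J \<sigma>" if \<sigma>: "\<sigma> \<in> E" for \<sigma>
  proof -
    define s where "s = sqrt (B \<sigma> \<sigma>)"
    have s: "B \<sigma> \<sigma> = s\<^sup>2" using B_self_nonneg[OF \<sigma>] by (simp add: s_def)
    have "\<sigma> \<phi> \<le> C * s" using C(2) \<sigma> by (simp add: s_def)
    moreover have "0 \<le> (s - C)\<^sup>2" by simp
    ultimately show ?thesis unfolding J_def s by (simp add: power2_diff algebra_simps)
  qed
  define m where "m = Inf (J ` E)"
  have bdd: "bdd_below (J ` E)" using lower by (intro bdd_belowI2)
  have m_le: "m \<le> J \<sigma>" if "\<sigma> \<in> E" for \<sigma> unfolding m_def using that bdd by (intro cINF_lower)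
  have "\<exists>\<sigma>\<in>E. J \<sigma> < m + inverse (real (Suc n))" for n
  proof -
    have "Inf (J ` E) < m + inverse (real (Suc n))" by (simp add: m_def)
    moreover have "J ` E \<noteq> {}" using zero_measure_E by auto
    ultimately show ?thesis using bdd by (simp add: cInf_less_iff)
  qed
  then have "\<forall>n. \<exists>\<sigma>. \<sigma> \<in> E \<and> J \<sigma> < m + inverse (real (Suc n))" unfolding Bex_def ..
  from choice[OF this] obtain S where "\<forall>n. S n \<in> E \<and> J (S n) < m + inverse (real (Suc n))" ..
  then have S: "S n \<in> E" "J (S n) < m + inverse (real (Suc n))" for n by simp_all
  have parallelogram: "q (S i) (S j) \<le> 2 * inverse (real (Suc i)) + 2 * inverse (real (Suc j))" for i j
  proof -
    \<comment> \<open>The midpoint stays in the convex cone, so its value is at least m.\<close>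
    define a where "a = mscale (1/2) (madd (S i) (S j))"
    have a: "a \<in> E" unfolding a_def by (intro E_mscale E_madd S) simp
    have ab: "madd (S i) (S j) \<in> E" by (intro E_madd S)
    have "4 * B a a = B (S i) (S i) + B (S j) (S j) + 2 * B (S i) (S j)"
      unfolding a_def
      by (simp add: B_mscale_left B_mscale_right B_madd_left B_madd_right ab E_mscale S
          B_commute[of "S j" "S i"] field_simps)
    moreover have "2 * a \<phi> = S i \<phi> + S j \<phi>" by (simp add: a_def mscale_def madd_def)
    ultimately have "q (S i) (S j) = 2 * J (S i) + 2 * J (S j) - 4 * J a"
      unfolding q_def J_def by simp
    then show ?thesis using m_le[OF a] S(2)[of i] S(2)[of j] by linarith
  qed
  have "S.MCauchy S"
    unfolding S.MCauchy_def
  proof (intro conjI allI impI)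
    show "range S \<subseteq> E" using S by auto
    fix e :: real assume e: "e > 0"
    then obtain N where N: "inverse (real (Suc N)) < e\<^sup>2 / 4" using reals_Archimedean[of "e\<^sup>2 / 4"] by auto
    show "\<exists>N. \<forall>i j. N \<le> i \<longrightarrow> N \<le> j \<longrightarrow> strong_dist \<kappa> (S i) (S j) < e"
    proof (intro exI[of _ N] allI impI)
      fix i j assume ij: "N \<le> i" "N \<le> j"
      have "inverse (real (Suc k)) \<le> inverse (real (Suc N))" if "N \<le> k" for k
        using that by (intro le_imp_inverse_le) auto
      from this[OF ij(1)] this[OF ij(2)] have "q (S i) (S j) < e\<^sup>2"
        using parallelogram[of i j] N by linarith
      then have "sqrt (q (S i) (S j)) < e" using e by (simp add: real_less_lsqrt q_nonneg S)
      then show "strong_dist \<kappa> (S i) (S j) < e" by (simp add: strong_dist_eq_q S)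
    qed
  qed
  then obtain \<gamma> where lim: "limitin S.mtopology S \<gamma> sequentially"
    using perfect unfolding perfect_def S.mcomplete_def by metis
  then have \<gamma>: "\<gamma> \<in> E" using S.limitin_mspace by metis
  have conv: "(\<lambda>n. S n \<phi>) \<longlonglongrightarrow> \<gamma> \<phi>"
  proof (rule tendstoI)
    fix e :: real assume e: "e > 0"
    have "openin S.mtopology {\<sigma> \<in> E. \<bar>\<sigma> \<phi> - \<gamma> \<phi>\<bar> < e}"
      using openin_strong_evaluation[OF \<gamma>] unfolding strong_topology_def .
    moreover have "\<gamma> \<in> {\<sigma> \<in> E. \<bar>\<sigma> \<phi> - \<gamma> \<phi>\<bar> < e}" using \<gamma> e by simp
    ultimately have "\<forall>\<^sub>F n in sequentially. S n \<in> {\<sigma> \<in> E. \<bar>\<sigma> \<phi> - \<gamma> \<phi>\<bar> < e}"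
      by (intro lim[unfolded limitin_def, THEN conjunct2, THEN spec, THEN mp] conjI)
    then show "\<forall>\<^sub>F n in sequentially. dist (S n \<phi>) (\<gamma> \<phi>) < e"
      by (rule eventually_mono) (simp add: dist_real_def)
  qed
  have dist0: "(\<lambda>n. sqrt (q (S n) \<gamma>)) \<longlonglongrightarrow> 0"
  proof (rule tendstoI)
    fix e :: real assume e: "e > 0"
    have "\<forall>\<^sub>F n in sequentially. S n \<in> E \<and> strong_dist \<kappa> (S n) \<gamma> < e"
      by (rule lim[unfolded S.limitin_metric, THEN conjunct2, rule_format, OF e])
    then show "\<forall>\<^sub>F n in sequentially. dist (sqrt (q (S n) \<gamma>)) 0 < e"
      by (rule eventually_mono) (simp add: strong_dist_eq_q S \<gamma> q_nonneg)
  qed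
  \<comment> \<open>The strong norm is the distance to 0, hence 1-Lipschitz for the strong
    distance.\<close>
  have "(\<lambda>n. sqrt (B (S n) (S n))) \<longlonglongrightarrow> sqrt (B \<gamma> \<gamma>)"
  proof (rule LIM_zero_cancel, rule tendsto_rabs_zero_cancel, rule tendsto_sandwich[OF _ _ tendsto_const dist0])
    have "\<bar>sqrt (B (S n) (S n)) - sqrt (B \<gamma> \<gamma>)\<bar> \<le> sqrt (q (S n) \<gamma>)" for n
      using sqrt_q_triangle[OF S(1)[of n] \<gamma> zero_measure_E] sqrt_q_triangle[OF \<gamma> S(1)[of n] zero_measure_E]
      by (simp add: q_zero_measure S \<gamma> q_commute[OF \<gamma> S(1)])
    then show "\<forall>\<^sub>F n in sequentially. \<bar>sqrt (B (S n) (S n)) - sqrt (B \<gamma> \<gamma>)\<bar> \<le> sqrt (q (S n) \<gamma>)"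
      by simp
  qed simp
  then have "(\<lambda>n. (sqrt (B (S n) (S n)))\<^sup>2 - 2 * S n \<phi>) \<longlonglongrightarrow> (sqrt (B \<gamma> \<gamma>))\<^sup>2 - 2 * \<gamma> \<phi>"
    by (intro tendsto_diff tendsto_power tendsto_mult tendsto_const conv)
  then have lim1: "(\<lambda>n. J (S n)) \<longlonglongrightarrow> J \<gamma>" by (simp add: J_def B_self_nonneg S \<gamma>)
  have "(\<lambda>n. m + inverse (real (Suc n))) \<longlonglongrightarrow> m + 0"
    by (intro tendsto_intros LIMSEQ_inverse_real_of_nat)
  then have "J \<gamma> \<le> m + 0"
    using lim1 S(2) by (intro LIMSEQ_le) (auto intro: less_imp_le)
  then have "J \<gamma> \<le> J \<sigma>" if "\<sigma> \<in> E" for \<sigma> using m_le[OF that] by simp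
  then show ?thesis unfolding J_def by (intro bexI[OF _ \<gamma>] ballI)
qed

end

section \<open>Equilibrium potentials and positivity of mass\<close>

locale max_kernel = perfect_kernel +
  assumes first_max: "first_max_principle \<kappa>"
begin

text \<open>Removing a small multiple of g\<gamma> is an admissible variation, and minimality shows
  that the integral of g times the potential of \<gamma> against \<gamma> is at most that of g
  \<phi>. If the potential exceeded 1 at a point of the support, it would do so on an open set
  charged by \<gamma>, by lower semicontinuity, and a g living there would contradict \<phi> \<le>
  1.\<close>

lemma equilibrium_potential_le_1:
  assumes \<phi>: "\<phi> \<in> Cc" "\<And>x. \<phi> x \<le> 1" and \<gamma>: "\<gamma> \<in> E"
    and min: "\<And>\<sigma>. \<sigma> \<in> E \<Longrightarrow> B \<gamma> \<gamma> - 2 * \<gamma> \<phi> \<le> B \<sigma> \<sigma> - 2 * \<sigma> \<phi>"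
  shows "potential \<kappa> \<gamma> x \<le> 1"
proof -
  note l = E_linear[OF \<gamma>] and env = potential_envelope[OF E_radon_pos[OF \<gamma>]]
  have weight_le: "B (weight g \<gamma>) \<gamma> \<le> weight g \<gamma> \<phi>"
    if g: "continuous_on UNIV g" "\<And>x. 0 \<le> g x" "\<And>x. g x \<le> 1" for g
  proof -
    define w where "w = weight g \<gamma>"
    have "0 \<le> w \<phi> - B w \<gamma>"
    proof (rule nonneg_slope[of _ "B w w"])
      fix t :: real assume t: "0 < t" "t \<le> 1"
      define \<sigma> where "\<sigma> = weight (\<lambda>x. 1 - t * g x) \<gamma>"
      note s = weight_split[OF \<gamma> g less_imp_le[OF t(1)] t(2), folded \<sigma>_def w_def]
      have "B \<sigma> \<sigma> = B \<gamma> \<gamma> - 2 * t * B w \<gamma> + t\<^sup>2 * B w w"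
        unfolding s(3)[OF s(1)] B_commute[OF \<gamma> s(1)] B_commute[OF s(2,1)] s(3)[OF \<gamma>] s(3)[OF s(2)]
          B_commute[OF \<gamma> s(2)]
        by (simp add: power2_eq_square algebra_simps)
      then show "0 \<le> 2 * t * (w \<phi> - B w \<gamma>) + t\<^sup>2 * B w w"
        using min[OF s(1)] s(4)[of \<phi>] by (simp add: algebra_simps)
    qed
    then show ?thesis by (simp add: w_def)
  qed
  have "potential \<kappa> \<gamma> x0 \<le> 1" if x0: "x0 \<in> msupport \<gamma>" for x0
  proof (rule ccontr)
    assume "\<not> potential \<kappa> \<gamma> x0 \<le> 1"
    define V where "V = {x. 1 < potential \<kappa> \<gamma> x}"
    have V: "open V" "x0 \<in> V"
      using Cc_envelope_imp_lower_semicont[OF env] \<open>\<not> _ \<le> 1\<close> by (auto simp: V_def lower_semicont_def)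
    have "\<not> (\<forall>\<psi>\<in>Cc. closure {x. \<psi> x \<noteq> 0} \<subseteq> V \<longrightarrow> \<gamma> \<psi> = 0)"
    proof
      assume "\<forall>\<psi>\<in>Cc. closure {x. \<psi> x \<noteq> 0} \<subseteq> V \<longrightarrow> \<gamma> \<psi> = 0"
      then have "x0 \<in> \<Union>{V. open V \<and> (\<forall>\<phi>\<in>Cc. closure {x. \<phi> x \<noteq> 0} \<subseteq> V \<longrightarrow> \<gamma> \<phi> = 0)}"
        using V by (intro UnionI[of V]) (simp only: mem_Collect_eq conj_absorb HOL.simp_thms)
      then show False using x0 unfolding msupport_def Compl_iff by (rule notE[rotated])
    qed
    then obtain \<psi> where \<psi>: "\<psi> \<in> Cc" "closure {x. \<psi> x \<noteq> 0} \<subseteq> V" "\<gamma> \<psi> \<noteq> 0" by blast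
    define K where "K = closure {x. \<psi> x \<noteq> 0}"
    have K: "compact K" "K \<subseteq> V" "\<And>x. x \<notin> K \<Longrightarrow> \<psi> x = 0"
      using \<psi> closure_subset[of "{x. \<psi> x \<noteq> 0}"] by (auto simp: K_def Cc_def)
    obtain M where M: "M > 0" "\<forall>x. \<bar>\<psi> x\<bar> \<le> M" using Cc_bounded[OF \<psi>(1)] by auto
    \<comment> \<open>A test function with \<gamma>(\<psi>) \<noteq> 0 may change sign; its modulus
      does not, is charged by \<gamma> as well, and becomes a density between 0 and 1 after division
      by M.\<close>
    have "max (\<psi> x) (- \<psi> x) = \<bar>\<psi> x\<bar>" for x by linarith
    then have abs: "(\<lambda>x. \<bar>\<psi> x\<bar>) \<in> Cc"
      using Cc_max[OF \<psi>(1) Cc_uminus[OF \<psi>(1)]] by simp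
    define g where "g = (\<lambda>x. (1 / M) * \<bar>\<psi> x\<bar>)"
    have gC: "g \<in> Cc" unfolding g_def by (rule Cc_cmult[OF abs])
    have g: "\<And>x. 0 \<le> g x" "\<And>x. g x \<le> 1" "\<And>x. x \<notin> K \<Longrightarrow> g x = 0"
      using M K by (auto simp: g_def)
    have "\<bar>\<gamma> \<psi>\<bar> \<le> \<gamma> (\<lambda>x. \<bar>\<psi> x\<bar>)" by (rule pl_abs_le[OF l \<psi>(1) abs]) simp
    then have \<gamma>g: "\<gamma> g > 0" unfolding g_def pl_cmult[OF l abs] using \<psi>(3) M(1) by simp
    \<comment> \<open>The potential is only lower semicontinuous. Dini's theorem supplies a
      continuous minorant still above 1 on the compact K, and its minimum d y there gives a uniform
      strict bound.\<close>
    have "\<exists>d\<in>Cc_below (potential \<kappa> \<gamma>). \<forall>x\<in>K. 1 < d x"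
    proof (rule dini_directed[of _ "\<lambda>_. 1", OF _ _ _ continuous_on_const K(1)])
      show "Cc_below (potential \<kappa> \<gamma>) \<noteq> {}" using env by (simp add: Cc_envelope_def)
      show "\<exists>c\<in>Cc_below (potential \<kappa> \<gamma>). \<forall>x. a x \<le> c x \<and> b x \<le> c x"
        if "a \<in> Cc_below (potential \<kappa> \<gamma>)" "b \<in> Cc_below (potential \<kappa> \<gamma>)" for a b
        by (rule bexI[OF _ Cc_below_max[OF that]]) simp
      show "continuous_on UNIV d" if "d \<in> Cc_below (potential \<kappa> \<gamma>)" for d
        using that by (intro Cc_continuous) (rule Cc_belowD)
      show "\<exists>d\<in>Cc_below (potential \<kappa> \<gamma>). 1 < d x" if "x \<in> K" for x
        using that K(2) by (intro Cc_envelopeD[OF env]) (auto simp: V_def one_ereal_def)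
    qed
    then obtain d where d: "d \<in> Cc_below (potential \<kappa> \<gamma>)" "\<forall>x\<in>K. 1 < d x" by blast
    have dC: "d \<in> Cc" using d(1) by (rule Cc_belowD)
    have "K \<noteq> {}" using \<gamma>g g(3) pl_zero[OF l] by (metis empty_iff ext less_irrefl)
    then obtain y where y: "y \<in> K" "\<forall>x\<in>K. d y \<le> d x"
      using continuous_attains_inf[OF K(1) _ continuous_on_subset[OF Cc_continuous[OF dC]]] by auto
    have gd: "(\<lambda>x. g x * d x) \<in> Cc" "(\<lambda>x. g x * \<phi> x) \<in> Cc" by (intro Cc_mult gC dC \<phi>)+
    note gc = Cc_continuous[OF gC]
    have w: "weight g \<gamma> \<in> E" by (rule weight_E[OF \<gamma> gc g(1,2)])
    have "d y * \<gamma> g = \<gamma> (\<lambda>x. d y * g x)" by (simp add: pl_cmult[OF l gC])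
    also have "\<dots> \<le> \<gamma> (\<lambda>x. g x * d x)"
    proof (rule pl_mono[OF l Cc_cmult[OF gC] gd(1)])
      show "d y * g x \<le> g x * d x" for x
        using y(2) g(1)[of x] g(3)[of x] by (cases "x \<in> K") (auto simp: mult.commute intro: mult_right_mono)
    qed
    also have "\<dots> = weight g \<gamma> d" by (simp add: weight_def dC)
    also have "ereal (weight g \<gamma> d) \<le> ereal (B (weight g \<gamma>) \<gamma>)"
      using lint_upper[OF d(1), of "weight g \<gamma>"] by (simp add: lint_potential_eq_B[OF w \<gamma>])
    then have "weight g \<gamma> d \<le> B (weight g \<gamma>) \<gamma>" by simp
    also have "\<dots> \<le> weight g \<gamma> \<phi>" by (rule weight_le[OF gc g(1,2)])
    also have "\<dots> = \<gamma> (\<lambda>x. g x * \<phi> x)" by (simp add: weight_def \<phi>)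
    also have "\<dots> \<le> \<gamma> g"
      using mult_left_mono[OF \<phi>(2) g(1)] by (intro pl_mono[OF l gd(2) gC]) simp
    finally have "d y * \<gamma> g \<le> 1 * \<gamma> g" by simp
    then have "d y \<le> 1" using \<gamma>g by (simp only: mult_le_cancel_right_pos)
    then show False using d(2) y(1) by auto
  qed
  then show ?thesis using first_max \<gamma> unfolding first_max_principle_def by simp
qed

theorem positivity_of_mass:
  assumes \<mu>: "\<mu> \<in> E" and \<nu>: "\<nu> \<in> E" and le: "\<And>x. potential \<kappa> \<mu> x \<le> potential \<kappa> \<nu> x"
  shows "total_mass \<mu> \<le> total_mass \<nu>"
  unfolding total_mass_eq_lint[OF E_linear[OF \<mu>]]
proof (rule lint_least)
  fix \<phi> assume "\<phi> \<in> Cc_below (\<lambda>_::'a. 1)"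
  then have \<phi>: "\<phi> \<in> Cc" "\<And>x. \<phi> x \<le> 1" by (auto simp: Cc_below_def one_ereal_def)
  obtain \<gamma> where \<gamma>: "\<gamma> \<in> E" and min: "\<And>\<sigma>. \<sigma> \<in> E \<Longrightarrow> B \<gamma> \<gamma> - 2 * \<gamma> \<phi> \<le> B \<sigma> \<sigma> - 2 * \<sigma> \<phi>"
    using equilibrium_exists[OF \<phi>(1)] by metis
  \<comment> \<open>Adding t \<mu> to \<gamma> stays in the cone, which gives the first-order
    inequality in the direction \<mu>.\<close>
  have "0 \<le> B \<gamma> \<mu> - \<mu> \<phi>"
  proof (rule nonneg_slope[of _ "B \<mu> \<mu>"])
    fix t :: real assume t: "0 < t" "t \<le> 1"
    note s = E_mscale[OF \<mu> less_imp_le[OF t(1)]]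
    have "B (madd \<gamma> (mscale t \<mu>)) (madd \<gamma> (mscale t \<mu>)) = B \<gamma> \<gamma> + 2 * t * B \<gamma> \<mu> + t\<^sup>2 * B \<mu> \<mu>"
      using t by (simp add: B_madd_left B_madd_right B_mscale_left B_mscale_right E_madd s \<gamma> \<mu>
          B_commute[OF \<mu> \<gamma>] power2_eq_square algebra_simps)
    then show "0 \<le> 2 * t * (B \<gamma> \<mu> - \<mu> \<phi>) + t\<^sup>2 * B \<mu> \<mu>"
      using min[OF E_madd[OF \<gamma> s]] by (simp add: madd_def mscale_def algebra_simps)
  qed
  then have "ereal (\<mu> \<phi>) \<le> ereal (B \<gamma> \<mu>)" by simp
  also have "\<dots> = lint \<gamma> (potential \<kappa> \<mu>)" by (simp add: lint_potential_eq_B \<gamma> \<mu>)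
  also have "\<dots> \<le> lint \<gamma> (potential \<kappa> \<nu>)" by (rule lint_mono[OF le])
  also have "\<dots> = lint \<nu> (potential \<kappa> \<gamma>)" by (simp add: lint_potential_eq_B \<gamma> \<nu> B_commute[OF \<gamma> \<nu>])
  also have "\<dots> \<le> lint \<nu> (\<lambda>_. 1)"
    by (rule lint_mono) (rule equilibrium_potential_le_1[OF \<phi> \<gamma> min])
  also have "\<dots> = total_mass \<nu>" by (simp add: total_mass_eq_lint[OF E_linear[OF \<nu>]])
  finally show "ereal (\<mu> \<phi>) \<le> total_mass \<nu>" .
qed

end

section \<open>Negligible sets\<close>

lemma outer_meas_nonneg:
  assumes "positive_linear (\<mu> :: ('a::t2_space \<Rightarrow> real) \<Rightarrow> real)"
  shows "0 \<le> outer_meas \<mu> N"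
proof -
  have "0 \<le> lint \<mu> (\<lambda>_. 0)" by (rule lint_nonneg[OF assms]) simp
  also have "\<dots> = upper_integral \<mu> (\<lambda>_. 0)"
    by (rule upper_integral_eq_lint[OF assms, symmetric]) (simp_all add: lower_semicont_def)
  also have "\<dots> \<le> outer_meas \<mu> N"
    unfolding outer_meas_def by (rule upper_integral_mono) simp
  finally show ?thesis .
qed

text \<open>Majorants H n of integral at most e / 2^(n+1) are summed. At each point of N all of them
  are at least the fixed \<delta> x > 0, so the sum is infinite there and majorises the indicator,
  while its integral is at most e. No measurability of N or \<delta> is involved.\<close>

lemma negligible_of_small_majorants:
  fixes \<mu> :: "('a::t2_space \<Rightarrow> real) \<Rightarrow> real" and \<delta> :: "'a \<Rightarrow> ereal"
  assumes lc: "locally_compact_space (euclidean :: 'a topology)" and \<mu>: "positive_linear \<mu>"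
    and pos: "\<And>x. x \<in> N \<Longrightarrow> 0 < \<delta> x"
    and maj: "\<And>e. e > 0 \<Longrightarrow> \<exists>H. Cc_envelope H \<and> (\<forall>x. 0 \<le> H x) \<and> lint \<mu> H \<le> ereal e \<and> (\<forall>x\<in>N. \<delta> x \<le> H x)"
  shows "negligible_for \<mu> N"
proof -
  have le: "outer_meas \<mu> N \<le> ereal e" if e: "e > 0" for e
  proof -
    have "\<forall>n. \<exists>H. Cc_envelope H \<and> (\<forall>x. 0 \<le> H x) \<and> lint \<mu> H \<le> ereal (e * (1/2) ^ Suc n) \<and> (\<forall>x\<in>N. \<delta> x \<le> H x)"
      by (rule allI, rule maj) (use e in simp)
    from choice[OF this] obtain H where "\<forall>n. Cc_envelope (H n) \<and> (\<forall>x. 0 \<le> H n x) \<and>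
      lint \<mu> (H n) \<le> ereal (e * (1/2) ^ Suc n) \<and> (\<forall>x\<in>N. \<delta> x \<le> H n x)" ..
    then have H: "Cc_envelope (H n)" "\<And>x. 0 \<le> H n x" "lint \<mu> (H n) \<le> ereal (e * (1/2) ^ Suc n)"
      "\<And>x. x \<in> N \<Longrightarrow> \<delta> x \<le> H n x" for n
      by blast+
    define S where "S = (\<lambda>n x. \<Sum>i<n. H i x)"
    have S_Suc: "S (Suc n) = (\<lambda>x. S n x + H n x)" for n by (simp add: S_def)
    have S: "Cc_envelope (S n) \<and> lint \<mu> (S n) \<le> ereal (e * (1 - (1/2) ^ n))" for n
    proof (induction n)
      case 0
      have "S 0 = (\<lambda>x. ereal 0)" by (simp add: S_def zero_ereal_def)
      then show ?case
        using Cc_envelope_Cc[OF Cc_zero] lint_Cc[OF \<mu> Cc_zero] by (simp add: pl_zero[OF \<mu>])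
    next
      case (Suc n)
      have "lint \<mu> (S (Suc n)) = lint \<mu> (S n) + lint \<mu> (H n)"
        unfolding S_Suc using Suc.IH by (intro lint_add[OF lc \<mu>] H(1)) simp
      also have "\<dots> \<le> ereal (e * (1 - (1/2) ^ n)) + ereal (e * (1/2) ^ Suc n)"
        using Suc.IH H(3) by (intro add_mono) auto
      also have "\<dots> = ereal (e * (1 - (1/2) ^ Suc n))" by (simp add: algebra_simps)
      finally show ?case using Suc.IH H(1) unfolding S_Suc by (simp add: Cc_envelope_add)
    qed
    have env: "Cc_envelope (S n)" for n using S by blast
    have mono: "S m x \<le> S n x" if "m \<le> n" for m n x
      unfolding S_def using that H(2) by (intro sum_mono2) auto
    have "S 0 x = 0" for x by (simp add: S_def)
    then have nonneg: "0 \<le> (SUP n. S n x)" for x by (metis SUP_upper UNIV_I)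
    have "indicator N x \<le> (SUP n. S n x)" for x
    proof (cases "x \<in> N")
      case True
      obtain r where r: "0 < r" "ereal r < \<delta> x"
        using ereal_dense2[OF pos[OF True]] by auto
      obtain n where n: "1 < real n * r" using ex_less_of_nat_mult[OF r(1)] by auto
      have "ereal r \<le> H i x" for i using r(2) H(4)[OF True] by (meson less_imp_le order_trans)
      then have "(\<Sum>i<n. ereal r) \<le> S n x" unfolding S_def by (intro sum_mono)
      then have "ereal (real n * r) \<le> S n x" by simp
      moreover have "1 \<le> ereal (real n * r)" using n by (simp add: one_ereal_def)
      ultimately have "1 \<le> S n x" by (rule order_trans[rotated])
      also have "\<dots> \<le> (SUP n. S n x)" by (rule SUP_upper) simp
      finally show ?thesis using True by simp
    qed (use nonneg in simp)
    then have "outer_meas \<mu> N \<le> upper_integral \<mu> (\<lambda>x. SUP n. S n x)"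
      unfolding outer_meas_def by (rule upper_integral_mono)
    also have "\<dots> = lint \<mu> (\<lambda>x. SUP n. S n x)"
      by (intro upper_integral_eq_lint[OF \<mu> nonneg] Cc_envelope_imp_lower_semicont
          lint_sup_sequence(1)[OF lc \<mu> env mono])
    also have "\<dots> \<le> (SUP n. lint \<mu> (S n))" by (rule lint_sup_sequence(2)[OF lc \<mu> env mono])
    also have "\<dots> \<le> ereal e"
    proof (rule SUP_least)
      fix n
      have "lint \<mu> (S n) \<le> ereal (e * (1 - (1/2) ^ n))" using S by blast
      also have "\<dots> \<le> ereal e" using e by (simp add: mult_left_le)
      finally show "lint \<mu> (S n) \<le> ereal e" .
    qed
    finally show ?thesis .
  qed
  have "outer_meas \<mu> N \<le> 0"
    by (rule ereal_le_epsilon2) (use le in simp)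
  then show ?thesis
    using outer_meas_nonneg[OF \<mu>, of N] unfolding negligible_for_def by (intro antisym)
qed

text \<open>The minimum of a small majorant for \<mu> and one for \<nu> is lower semicontinuous and
  small for both, hence for anything dominated by \<mu> + \<nu>.\<close>

lemma negligible_for_add:
  fixes \<mu> \<nu> \<sigma> :: "('a::t2_space \<Rightarrow> real) \<Rightarrow> real"
  assumes lc: "locally_compact_space (euclidean :: 'a topology)"
    and l: "positive_linear \<mu>" "positive_linear \<nu>" "positive_linear \<sigma>"
    and le: "\<And>\<phi>. \<phi> \<in> Cc \<Longrightarrow> (\<And>x. 0 \<le> \<phi> x) \<Longrightarrow> \<sigma> \<phi> \<le> \<mu> \<phi> + \<nu> \<phi>"
    and N: "negligible_for \<mu> N" "negligible_for \<nu> N"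
  shows "negligible_for \<sigma> N"
proof -
  have small: "\<exists>h. lower_semicont h \<and> (\<forall>x. indicator N x \<le> h x) \<and> lsc_integral \<tau> h < ereal e"
    if "negligible_for \<tau> N" "e > 0" for \<tau> e
  proof -
    have "upper_integral \<tau> (indicator N) < ereal e"
      using that unfolding negligible_for_def outer_meas_def by simp
    then show ?thesis unfolding upper_integral_def INF_less_iff by blast
  qed
  have "outer_meas \<sigma> N \<le> 0 + ereal e" if e: "e > 0" for e
  proof -
    obtain h1 where h1: "lower_semicont h1" "\<And>x. indicator N x \<le> h1 x" "lsc_integral \<mu> h1 < ereal (e/2)"
      using small[OF N(1), of "e/2"] e by auto
    obtain h2 where h2: "lower_semicont h2" "\<And>x. indicator N x \<le> h2 x" "lsc_integral \<nu> h2 < ereal (e/2)"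
      using small[OF N(2), of "e/2"] e by auto
    define h where "h = (\<lambda>x. min (h1 x) (h2 x))"
    have "{x. a < h x} = {x. a < h1 x} \<inter> {x. a < h2 x}" for a by (auto simp: h_def)
    then have lsc: "lower_semicont h" using h1(1) h2(1) unfolding lower_semicont_def by (simp add: open_Int)
    have h0: "0 \<le> h1 x" "0 \<le> h2 x" "0 \<le> h x" for x
    proof -
      have i: "0 \<le> (indicator N x :: ereal)" by simp
      show "0 \<le> h1 x" "0 \<le> h2 x" by (rule order_trans[OF i h1(2)] order_trans[OF i h2(2)])+
      then show "0 \<le> h x" by (simp add: h_def)
    qed
    have env: "Cc_envelope h"
      unfolding Cc_envelope_iff[OF lc] using lsc h0 by (auto intro!: bexI[of _ "\<lambda>_. 0"] simp flip: zero_ereal_def)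
    have "outer_meas \<sigma> N \<le> upper_integral \<sigma> h"
      unfolding outer_meas_def using h1(2) h2(2) by (intro upper_integral_mono) (simp add: h_def)
    also have "\<dots> = lint \<sigma> h" by (rule upper_integral_eq_lint[OF l(3) h0(3) lsc])
    also have "\<dots> \<le> lint (\<lambda>\<phi>. \<mu> \<phi> + \<nu> \<phi>) h" by (rule lint_mono_measure[OF l(3) le h0(3)])
    also have "\<dots> = lint \<mu> h + lint \<nu> h" by (rule lint_add_measure[OF lc l(1,2) env])
    also have "\<dots> \<le> lint \<mu> h1 + lint \<nu> h2" by (intro add_mono lint_mono) (simp_all add: h_def)
    also have "\<dots> \<le> ereal (e/2) + ereal (e/2)"
      using h1(3) h2(3) by (intro add_mono) (simp_all add: lsc_integral_eq_lint[OF l(1) h0(1)]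
        lsc_integral_eq_lint[OF l(2) h0(2)])
    finally show ?thesis by simp
  qed
  then have "outer_meas \<sigma> N \<le> 0" by (rule ereal_le_epsilon2)
  then show ?thesis
    using outer_meas_nonneg[OF l(3), of N] unfolding negligible_for_def by (intro antisym)
qed

context lc_kernel
begin

lemma Cc_envelope_one: "Cc_envelope (\<lambda>_::'a. 1)"
  unfolding Cc_envelope_iff[OF lc]
  by (auto simp: lower_semicont_def zero_ereal_def[symmetric] intro!: bexI[of _ "\<lambda>_. 0"])

text \<open>The supremum is attained at a cutoff equal to 1 wherever g is nonzero.\<close>

lemma lint_weight_one:
  assumes \<mu>: "\<mu> \<in> radon_pos" and g: "g \<in> Cc" "\<And>x. 0 \<le> g x"
  shows "lint (weight g \<mu>) (\<lambda>_. 1) = ereal (\<mu> g)"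
proof (rule antisym)
  note l = radon_posD[OF \<mu>]
  show "lint (weight g \<mu>) (\<lambda>_. 1) \<le> ereal (\<mu> g)"
  proof (rule lint_least)
    fix \<phi> assume "\<phi> \<in> Cc_below (\<lambda>_::'a. 1)"
    then have \<phi>: "\<phi> \<in> Cc" "\<And>x. \<phi> x \<le> 1" by (auto simp: Cc_below_def one_ereal_def)
    have "\<mu> (\<lambda>x. g x * \<phi> x) \<le> \<mu> g"
      using mult_left_mono[OF \<phi>(2) g(2)] by (intro pl_mono[OF l Cc_mult[OF g(1) \<phi>(1)] g(1)]) simp
    then show "ereal (weight g \<mu> \<phi>) \<le> ereal (\<mu> g)" by (simp add: weight_def \<phi>)
  qed
  obtain K where K: "compact K" "\<And>x. x \<notin> K \<Longrightarrow> g x = 0" using Cc_vanishes[OF g(1)] by auto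
  obtain \<eta> where \<eta>: "\<eta> \<in> Cc" "\<And>x. \<eta> x \<le> 1" "\<And>x. x \<in> K \<Longrightarrow> \<eta> x = 1"
    by (rule urysohn_Cc[OF lc K(1) open_UNIV]) auto
  have "g x * \<eta> x = g x" for x using K(2)[of x] \<eta>(3)[of x] by (cases "x \<in> K") auto
  then have "(\<lambda>x. g x * \<eta> x) = g" by (rule ext)
  then have "weight g \<mu> \<eta> = \<mu> g" by (simp add: weight_def \<eta>)
  moreover have "\<eta> \<in> Cc_below (\<lambda>_. 1)" using \<eta> by (intro Cc_belowI) (auto simp: one_ereal_def)
  ultimately show "ereal (\<mu> g) \<le> lint (weight g \<mu>) (\<lambda>_. 1)" using lint_upper by metis
qed

text \<open>With \<open>a \<le> f\<close> and \<open>b \<le> h\<close> in \<^const>\<open>Cc\<close> close to \<open>f\<close> and \<open>h\<close> in \<open>L\<^sup>1(\<mu>)\<close>, test the hypothesis against a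
  regularised sign \<open>g = (a - b)\<^sup>+ / ((a - b)\<^sup>+ + e)\<close>.\<close>

lemma negligible_of_weighted_le:
  assumes \<mu>: "\<mu> \<in> radon_pos" and mass: "\<And>g. g \<in> Cc \<Longrightarrow> (\<And>x. 0 \<le> g x) \<Longrightarrow> (\<And>x. g x \<le> 1) \<Longrightarrow> \<mu> g \<le> 1"
    and f: "Cc_envelope f" "lint \<mu> f < \<infinity>" and h: "Cc_envelope h" "lint \<mu> h < \<infinity>"
    and le: "\<And>g. g \<in> Cc \<Longrightarrow> (\<And>x. 0 \<le> g x) \<Longrightarrow> (\<And>x. g x \<le> 1) \<Longrightarrow> lint (weight g \<mu>) f \<le> lint (weight g \<mu>) h"
  shows "negligible_for \<mu> {x. \<not> f x \<le> h x}"
proof (rule negligible_of_small_majorants[OF lc radon_posD[OF \<mu>], of _ "\<lambda>x. f x - h x"])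
  note l = radon_posD[OF \<mu>]
  show "0 < f x - h x" if "x \<in> {x. \<not> f x \<le> h x}" for x
    using that Cc_envelope_not_MInf[OF h(1), of x] by (cases "f x"; cases "h x") auto
  fix e0 :: real assume e0: "e0 > 0"
  \<comment> \<open>The final majorant costs 2 e for p and e for f - a.\<close>
  define e where "e = e0 / 3"
  have e: "e > 0" "3 * e = e0" using e0 by (auto simp: e_def)
  have approx: "\<exists>a\<in>Cc_below k. lint \<mu> (\<lambda>x. k x - ereal (a x)) \<le> ereal e"
    if k: "Cc_envelope k" "lint \<mu> k < \<infinity>" for k
  proof -
    obtain r where r: "lint \<mu> k = ereal r" using k(2) lint_not_MInf[OF k(1), of \<mu>] by (cases "lint \<mu> k") auto
    have "ereal (r - e) < lint \<mu> k" using e r by simp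
    then obtain a where a: "a \<in> Cc_below k" "r - e < \<mu> a" by (auto dest!: lint_lessD)
    have "lint \<mu> (\<lambda>x. k x - ereal (a x)) = ereal r - ereal (\<mu> a)"
      unfolding lint_diff_Cc[OF lc l k(1) Cc_belowD(1)[OF a(1)]] r ..
    also have "\<dots> \<le> ereal e" using a(2) by simp
    finally show ?thesis by (rule bexI[OF _ a(1)])
  qed
  obtain a where a: "a \<in> Cc_below f" "lint \<mu> (\<lambda>x. f x - ereal (a x)) \<le> ereal e" using approx[OF f] by auto
  obtain b where b: "b \<in> Cc_below h" "lint \<mu> (\<lambda>x. h x - ereal (b x)) \<le> ereal e" using approx[OF h] by auto
  note C = Cc_belowD(1)[OF a(1)] Cc_belowD(1)[OF b(1)]
  define p where "p = (\<lambda>x. max 0 (a x - b x))"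
  have p: "p \<in> Cc" "\<And>x. 0 \<le> p x" unfolding p_def by (intro Cc_max0 Cc_diff C) simp
  define g where "g = (\<lambda>x. p x / (p x + e))"
  have g01: "0 \<le> g x" "g x \<le> 1" for x using p(2)[of x] e by (auto simp: g_def)
  have gC: "g \<in> Cc"
  proof -
    obtain K where K: "compact K" "\<And>x. x \<notin> K \<Longrightarrow> p x = 0" using Cc_vanishes[OF p(1)] by auto
    have "p x + e \<noteq> 0" for x using p(2)[of x] e by linarith
    then have "continuous_on UNIV g" unfolding g_def
      by (intro continuous_on_divide continuous_on_add continuous_on_const Cc_continuous[OF p(1)]) simp
    then show ?thesis using K by (intro CcI[of _ K]) (simp_all add: g_def)
  qed
  define w where "w = weight g \<mu>"
  have wr: "w \<in> radon_pos" unfolding w_def by (rule weight_radon_pos[OF \<mu> Cc_continuous[OF gC] g01(1)])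
  note lw = radon_posD[OF wr]
  \<comment> \<open>The approximation of h by b passes from \<mu> to g\<mu> because g \<le>
    1.\<close>
  have "lint w (\<lambda>x. h x - ereal (b x)) \<le> lint \<mu> (\<lambda>x. h x - ereal (b x))"
  proof (rule lint_mono_measure[OF lw])
    show "w \<phi> \<le> \<mu> \<phi>" if "\<phi> \<in> Cc" "\<And>x. 0 \<le> \<phi> x" for \<phi>
      unfolding w_def by (rule weight_le[OF \<mu> Cc_continuous[OF gC] g01(2) that])
    show "0 \<le> h x - ereal (b x)" for x using Cc_belowD(2)[OF b(1), of x] by (cases "h x") auto
  qed
  then have "lint w h - ereal (w b) \<le> ereal e"
    using b(2) unfolding lint_diff_Cc[OF lc lw h(1) C(2)] by (rule order_trans)
  moreover have "ereal (w a) \<le> lint w h"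
    using lint_upper[OF a(1), of w] le[OF gC g01] unfolding w_def by (rule order_trans)
  ultimately have wab: "w a - w b \<le> e" by (cases "lint w h") auto
  have gab: "(\<lambda>x. g x * a x) \<in> Cc" "(\<lambda>x. g x * b x) \<in> Cc" by (intro Cc_mult gC C)+
  \<comment> \<open>Where a > b this is g (p + e) = p, and elsewhere both sides vanish. The term e g
    costs at most e by the mass bound.\<close>
  have "p x = (g x * a x - g x * b x) + e * g x" for x
  proof (cases "a x - b x \<le> 0")
    case False
    then have *: "p x = a x - b x" "p x + e \<noteq> 0" using e by (auto simp: p_def)
    then have "g x * (p x + e) = p x" by (simp add: g_def)
    then show ?thesis unfolding *(1) by (simp add: algebra_simps)
  qed (simp add: g_def p_def)
  then have "\<mu> p = \<mu> (\<lambda>x. (g x * a x - g x * b x) + e * g x)" by presburger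
  also have "\<dots> = (w a - w b) + e * \<mu> g"
    unfolding pl_add[OF l Cc_diff[OF gab] Cc_cmult[OF gC]] pl_diff[OF l gab] pl_cmult[OF l gC]
    by (simp add: w_def weight_def C)
  also have "\<dots> \<le> e + e * 1"
    using wab mass[OF gC g01] e by (intro add_mono mult_left_mono) auto
  finally have \<mu>p: "\<mu> p \<le> 2 * e" by simp
  \<comment> \<open>Since b \<le> h, the excess f - h is at most (f - a) + (a - b), hence at most
    H.\<close>
  define H where "H = (\<lambda>x. ereal (p x) + (f x - ereal (a x)))"
  have fa: "0 \<le> f x - ereal (a x)" for x using Cc_belowD(2)[OF a(1), of x] by (cases "f x") auto
  note envs = Cc_envelope_Cc[OF p(1)] Cc_envelope_diff_Cc[OF f(1) C(1)]
  show "\<exists>H. Cc_envelope H \<and> (\<forall>x. 0 \<le> H x) \<and> lint \<mu> H \<le> ereal e0 \<and> (\<forall>x\<in>{x. \<not> f x \<le> h x}. f x - h x \<le> H x)"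
  proof (intro exI[of _ H] conjI allI ballI)
    show "Cc_envelope H" unfolding H_def by (rule Cc_envelope_add[OF envs])
    show "0 \<le> H x" for x unfolding H_def using fa p(2) by (intro add_nonneg_nonneg) simp_all
    have "lint \<mu> H = ereal (\<mu> p) + lint \<mu> (\<lambda>x. f x - ereal (a x))"
      unfolding H_def lint_add[OF lc l envs] lint_Cc[OF l p(1)] ..
    also have "\<dots> \<le> ereal (2 * e) + ereal e" using \<mu>p a(2) by (intro add_mono) simp_all
    also have "\<dots> = ereal e0" using e by simp
    finally show "lint \<mu> H \<le> ereal e0" .
    show "f x - h x \<le> H x" if "x \<in> {x. \<not> f x \<le> h x}" for x
    proof -
      have "a x - b x \<le> p x" by (simp add: p_def)
      then show ?thesis
        using that Cc_belowD(2)[OF b(1), of x] by (cases "f x"; cases "h x") (auto simp: H_def)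
    qed
  qed
qed

end

section \<open>The Gauss functional\<close>

context energy_kernel
begin

lemma unit_energy_onD:
  assumes "\<mu> \<in> unit_energy_on \<kappa> A"
  shows "\<mu> \<in> E" "concentrated_on \<mu> A" "lint \<mu> (\<lambda>_. 1) = 1"
proof -
  have "\<mu> \<in> E \<and> concentrated_on \<mu> A \<and> total_mass \<mu> = 1"
    using assms unfolding unit_energy_on_def fin_energy_on_def mem_Collect_eq by simp
  then show E: "\<mu> \<in> E" and "concentrated_on \<mu> A" and "lint \<mu> (\<lambda>_. 1) = 1"
    using total_mass_eq_lint[OF E_linear, of \<mu>] by simp_all
qed

lemma unit_energy_onI:
  assumes "\<mu> \<in> E" "concentrated_on \<mu> A" "lint \<mu> (\<lambda>_. 1) = 1"
  shows "\<mu> \<in> unit_energy_on \<kappa> A"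
  unfolding unit_energy_on_def fin_energy_on_def mem_Collect_eq
  using assms total_mass_eq_lint[OF E_linear[OF assms(1)]] by simp

lemma unit_mass_bound:
  assumes \<mu>: "\<mu> \<in> E" "lint \<mu> (\<lambda>_. 1) = 1" and g: "g \<in> Cc" "\<And>x. g x \<le> 1"
  shows "\<mu> g \<le> 1"
proof -
  have "ereal (\<mu> g) \<le> lint \<mu> (\<lambda>_. 1)" using g by (intro lint_upper Cc_belowI) (auto simp: one_ereal_def)
  then have "ereal (\<mu> g) \<le> 1" unfolding \<mu>(2) .
  then show ?thesis by simp
qed

text \<open>The part t g\<mu> taken away has mass t \<mu>(g), exactly what the multiple of \<nu>
  returns. The result is dominated by \<mu> + \<nu>, so sets negligible for both remain negligible
  and it is concentrated on A.\<close>

lemma competitor: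
  assumes \<mu>: "\<mu> \<in> unit_energy_on \<kappa> A" and \<nu>: "\<nu> \<in> unit_energy_on \<kappa> A"
    and g: "g \<in> Cc" "\<And>x. 0 \<le> g x" "\<And>x. g x \<le> 1" and t: "0 \<le> t" "t \<le> 1"
  shows "madd (weight (\<lambda>x. 1 - t * g x) \<mu>) (mscale (t * \<mu> g) \<nu>) \<in> unit_energy_on \<kappa> A"
proof (rule unit_energy_onI)
  note m = unit_energy_onD[OF \<mu>] and n = unit_energy_onD[OF \<nu>] and gc = Cc_continuous[OF g(1)]
  define \<sigma> where "\<sigma> = weight (\<lambda>x. 1 - t * g x) \<mu>"
  define w where "w = weight g \<mu>"
  note s = weight_split[OF m(1) gc g(2,3) t, folded \<sigma>_def w_def]
  have \<mu>g: "0 \<le> \<mu> g" "\<mu> g \<le> 1"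
    by (rule pl_nonneg[OF E_linear[OF m(1)] g(1,2)]) (rule unit_mass_bound[OF m(1,3) g(1,3)])
  then have k: "0 \<le> t * \<mu> g" "t * \<mu> g \<le> 1" using t by (auto intro: mult_le_one)
  note \<tau> = E_mscale[OF n(1) k(1)]
  show in_E: "madd (weight (\<lambda>x. 1 - t * g x) \<mu>) (mscale (t * \<mu> g) \<nu>) \<in> E"
    using E_madd[OF s(1) \<tau>] unfolding \<sigma>_def .
  have "lint \<mu> (\<lambda>_. 1) = lint (madd \<sigma> (mscale t w)) (\<lambda>_. 1)"
    unfolding \<sigma>_def w_def weight_complement[OF E_radon_pos[OF m(1)] gc] ..
  also have "\<dots> = lint \<sigma> (\<lambda>_. 1) + lint (mscale t w) (\<lambda>_. 1)"
    unfolding madd_def by (rule lint_add_measure[OF lc E_linear[OF s(1)] E_linear[OF E_mscale[OF s(2) t(1)]] Cc_envelope_one])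
  also have "lint (mscale t w) (\<lambda>_. 1) = ereal t * ereal (\<mu> g)"
    unfolding mscale_def lint_cmult_measure[OF t(1) Cc_envelope_one]
    unfolding w_def lint_weight_one[OF E_radon_pos[OF m(1)] g(1,2)] ..
  finally have "1 = lint \<sigma> (\<lambda>_. 1) + ereal (t * \<mu> g)" by (simp add: m(3))
  moreover have "lint (madd \<sigma> (mscale (t * \<mu> g) \<nu>)) (\<lambda>_. 1) = lint \<sigma> (\<lambda>_. 1) + lint (mscale (t * \<mu> g) \<nu>) (\<lambda>_. 1)"
    unfolding madd_def by (rule lint_add_measure[OF lc E_linear[OF s(1)] E_linear[OF \<tau>] Cc_envelope_one])
  moreover have "lint (mscale (t * \<mu> g) \<nu>) (\<lambda>_. 1) = ereal (t * \<mu> g)"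
    unfolding mscale_def lint_cmult_measure[OF k(1) Cc_envelope_one] n(3) by simp
  ultimately show "lint (madd (weight (\<lambda>x. 1 - t * g x) \<mu>) (mscale (t * \<mu> g) \<nu>)) (\<lambda>_. 1) = 1"
    unfolding \<sigma>_def by simp
  show "concentrated_on (madd (weight (\<lambda>x. 1 - t * g x) \<mu>) (mscale (t * \<mu> g) \<nu>)) A"
    unfolding concentrated_on_def locally_negligible_for_def
  proof (intro allI impI)
    fix K :: "'a set" assume K: "compact K"
    show "negligible_for (madd (weight (\<lambda>x. 1 - t * g x) \<mu>) (mscale (t * \<mu> g) \<nu>)) ((UNIV - A) \<inter> K)"
    proof (rule negligible_for_add[OF lc E_linear[OF m(1)] E_linear[OF n(1)] E_linear[OF in_E]])
      show "negligible_for \<mu> ((UNIV - A) \<inter> K)" "negligible_for \<nu> ((UNIV - A) \<inter> K)"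
        using m(2) n(2) K unfolding concentrated_on_def locally_negligible_for_def by simp_all
      fix \<phi> :: "'a \<Rightarrow> real" assume \<phi>: "\<phi> \<in> Cc" "\<And>x. 0 \<le> \<phi> x"
      have "0 \<le> w \<phi>" by (rule pl_nonneg[OF E_linear[OF s(2)] \<phi>])
      then have "0 \<le> t * w \<phi>" using t by simp
      moreover have "0 \<le> \<nu> \<phi>" by (rule pl_nonneg[OF E_linear[OF n(1)] \<phi>])
      then have "t * \<mu> g * \<nu> \<phi> \<le> \<nu> \<phi>" using k by (intro mult_left_le_one_le)
      ultimately show "madd (weight (\<lambda>x. 1 - t * g x) \<mu>) (mscale (t * \<mu> g) \<nu>) \<phi> \<le> \<mu> \<phi> + \<nu> \<phi>"
        unfolding \<sigma>_def[symmetric] madd_def mscale_def s(4) by simp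
    qed
  qed
qed

section \<open>The external field generated by \<zeta>\<close>

context
  fixes \<zeta> :: "('a \<Rightarrow> real) \<Rightarrow> real" and f :: "'a \<Rightarrow> ereal"
  assumes \<zeta>: "\<zeta> \<in> E" and f: "f = (\<lambda>x. - potential \<kappa> \<zeta> x)"
begin

lemma gauss_functional_eq:
  assumes "\<mu> \<in> E"
  shows "gauss_functional \<kappa> f \<mu> = ereal (B \<mu> \<mu> - 2 * B \<mu> \<zeta>)"
proof -
  have "radon_integral \<mu> f = - ereal (B \<mu> \<zeta>)"
    unfolding f radon_integral_uminus_positive[OF E_linear[OF assms] lc potential_envelope[OF E_radon_pos[OF \<zeta>]]]
      lint_potential_eq_B[OF assms \<zeta>] ..
  then have "gauss_functional \<kappa> f \<mu> = ereal (B \<mu> \<mu>) + 2 * (- ereal (B \<mu> \<zeta>))"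
    unfolding gauss_functional_def energy_def mutual_energy_eq_B[OF assms assms] by simp
  also have "2 * (- ereal (B \<mu> \<zeta>)) = ereal (- 2 * B \<mu> \<zeta>)"
    by (simp flip: times_ereal.simps(1) numeral_eq_ereal uminus_ereal.simps(1))
  finally show ?thesis by simp
qed

text \<open>A measure of finite energy has finite mutual energy with \<zeta>, which is the integral
  of -f, so f is integrable for it.\<close>

lemma unit_energy_field_eq: "unit_energy_field \<kappa> f A = unit_energy_on \<kappa> A"
proof -
  have "radon_integrable \<mu> f" if "\<mu> \<in> unit_energy_on \<kappa> A" for \<mu>
    unfolding f
    by (rule radon_integrable_uminus_positive[OF E_linear lc potential_envelope[OF E_radon_pos[OF \<zeta>]]])
      (simp_all add: unit_energy_onD(1)[OF that] lint_potential_eq_B \<zeta>)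
  then show ?thesis unfolding unit_energy_field_def by auto
qed

lemma gauss_minimizer_iff:
  "gauss_minimizer \<kappa> f A \<mu> \<longleftrightarrow> \<mu> \<in> unit_energy_on \<kappa> A \<and>
     (\<forall>\<nu>\<in>unit_energy_on \<kappa> A. B \<mu> \<mu> - 2 * B \<mu> \<zeta> \<le> B \<nu> \<nu> - 2 * B \<nu> \<zeta>)"
proof -
  have "gauss_functional \<kappa> f \<mu> = min_gauss \<kappa> f A \<longleftrightarrow>
      (\<forall>\<nu>\<in>unit_energy_on \<kappa> A. gauss_functional \<kappa> f \<mu> \<le> gauss_functional \<kappa> f \<nu>)"
    if \<mu>: "\<mu> \<in> unit_energy_on \<kappa> A"
  proof
    assume "gauss_functional \<kappa> f \<mu> = min_gauss \<kappa> f A"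
    then show "\<forall>\<nu>\<in>unit_energy_on \<kappa> A. gauss_functional \<kappa> f \<mu> \<le> gauss_functional \<kappa> f \<nu>"
      unfolding min_gauss_def unit_energy_field_eq by (simp add: INF_lower)
  next
    assume "\<forall>\<nu>\<in>unit_energy_on \<kappa> A. gauss_functional \<kappa> f \<mu> \<le> gauss_functional \<kappa> f \<nu>"
    then show "gauss_functional \<kappa> f \<mu> = min_gauss \<kappa> f A"
      unfolding min_gauss_def unit_energy_field_eq using \<mu>
      by (intro antisym INF_greatest INF_lower) simp_all
  qed
  then show ?thesis
    unfolding gauss_minimizer_def unit_energy_field_eq
    by (auto simp: gauss_functional_eq unit_energy_onD(1))
qed

text \<open>The first-order condition along the competitors \<open>\<lambda> - t g\<lambda> + t \<lambda>(g) \<nu>\<close>; the mass moved to \<open>\<nu>\<close>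
  costs no energy in the limit.\<close>

lemma minimizer_weighted_le:
  assumes \<mu>: "\<mu> \<in> unit_energy_on \<kappa> A"
    and min: "\<And>\<nu>. \<nu> \<in> unit_energy_on \<kappa> A \<Longrightarrow> B \<mu> \<mu> - 2 * B \<mu> \<zeta> \<le> B \<nu> \<nu> - 2 * B \<nu> \<zeta>"
    and small: "\<And>e. e > 0 \<Longrightarrow> \<exists>\<nu>\<in>unit_energy_on \<kappa> A. B \<nu> \<nu> < e"
    and g: "g \<in> Cc" "\<And>x. 0 \<le> g x" "\<And>x. g x \<le> 1"
  shows "B (weight g \<mu>) \<mu> \<le> B (weight g \<mu>) \<zeta>"
proof (rule field_le_epsilon)
  note m = unit_energy_onD[OF \<mu>] and gc = Cc_continuous[OF g(1)]
  define w where "w = weight g \<mu>"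
  have w: "w \<in> E" unfolding w_def by (rule weight_E[OF m(1) gc g(2,3)])
  define k where "k = \<mu> g"
  have k: "0 \<le> k" "k \<le> 1" unfolding k_def
    by (rule pl_nonneg[OF E_linear[OF m(1)] g(1,2)]) (rule unit_mass_bound[OF m(1,3) g(1,3)])
  fix e :: real assume e: "e > 0"
  \<comment> \<open>The constant in the Cauchy--Schwarz bound of
    \<open>B \<mu> \<nu> - B \<nu> \<zeta>\<close> by the norm of \<nu>; accordingly \<nu> is taken
    with norm at most e / (C + 1).\<close>
  define C where "C = sqrt (B \<mu> \<mu>) + sqrt (B \<zeta> \<zeta>)"
  have C: "0 \<le> C" by (simp add: C_def B_self_nonneg m(1) \<zeta>)
  have "(e / (C + 1))\<^sup>2 > 0" using e C by simp
  from small[OF this] obtain \<nu> where \<nu>: "\<nu> \<in> unit_energy_on \<kappa> A" "B \<nu> \<nu> < (e / (C + 1))\<^sup>2" ..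
  note n = unit_energy_onD[OF \<nu>(1)]
  have "sqrt (B \<nu> \<nu>) \<le> e / (C + 1)" using \<nu>(2) e C by (intro real_le_lsqrt) auto
  then have "C * sqrt (B \<nu> \<nu>) \<le> C * (e / (C + 1))" using C by (rule mult_left_mono)
  also have "\<dots> \<le> e" using e C by (simp add: field_simps)
  finally have Ce: "C * sqrt (B \<nu> \<nu>) \<le> e" .
  \<comment> \<open>The expression is half the coefficient of t in the change of the functional
    along the competitor. Its first term pays for the mass moved to \<nu>; the quadratic coefficient
    depends on \<nu> but disappears as t tends to 0.\<close>
  have "0 \<le> k * (B \<mu> \<nu> - B \<nu> \<zeta>) - B w \<mu> + B w \<zeta>"
  proof (rule nonneg_slope[of _ "B w w - 2 * k * B w \<nu> + k\<^sup>2 * B \<nu> \<nu>"])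
    fix t :: real assume t: "0 < t" "t \<le> 1"
    note t' = less_imp_le[OF t(1)] t(2)
    define \<sigma> where "\<sigma> = weight (\<lambda>x. 1 - t * g x) \<mu>"
    define \<tau> where "\<tau> = mscale (t * k) \<nu>"
    note s = weight_split[OF m(1) gc g(2,3) t', folded \<sigma>_def w_def]
    have tk: "0 \<le> t * k" using t k by simp
    have \<tau>: "\<tau> \<in> E" unfolding \<tau>_def by (rule E_mscale[OF n(1) tk])
    have "B \<mu> \<mu> - 2 * B \<mu> \<zeta> \<le> B (madd \<sigma> \<tau>) (madd \<sigma> \<tau>) - 2 * B (madd \<sigma> \<tau>) \<zeta>"
      using min[OF competitor[OF \<mu> \<nu>(1) g t']] unfolding \<sigma>_def \<tau>_def k_def .
    moreover have "B (madd \<sigma> \<tau>) \<zeta> = B \<mu> \<zeta> - t * B w \<zeta> + t * k * B \<nu> \<zeta>"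
      unfolding B_madd_left[OF s(1) \<tau> \<zeta>] s(3)[OF \<zeta>] unfolding \<tau>_def B_mscale_left[OF n(1) \<zeta> tk] by simp
    moreover have "B (madd \<sigma> \<tau>) (madd \<sigma> \<tau>) = B \<sigma> \<sigma> + 2 * B \<sigma> \<tau> + B \<tau> \<tau>"
      by (simp add: B_madd_left B_madd_right s(1) \<tau> E_madd B_commute[OF \<tau> s(1)])
    moreover have "B \<sigma> \<sigma> = B \<mu> \<mu> - 2 * t * B w \<mu> + t\<^sup>2 * B w w"
      unfolding s(3)[OF s(1)] B_commute[OF m(1) s(1)] B_commute[OF w s(1)] s(3)[OF m(1)] s(3)[OF w]
        B_commute[OF m(1) w]
      by (simp add: power2_eq_square algebra_simps)
    moreover have "B \<sigma> \<tau> = t * k * (B \<mu> \<nu> - t * B w \<nu>)"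
      unfolding \<tau>_def B_mscale_right[OF n(1) s(1) tk] s(3)[OF n(1)] ..
    moreover have "B \<tau> \<tau> = (t * k)\<^sup>2 * B \<nu> \<nu>"
      using \<tau> unfolding \<tau>_def
      by (simp add: B_mscale_left B_mscale_right n(1) tk power2_eq_square)
    ultimately show "0 \<le> 2 * t * (k * (B \<mu> \<nu> - B \<nu> \<zeta>) - B w \<mu> + B w \<zeta>)
        + t\<^sup>2 * (B w w - 2 * k * B w \<nu> + k\<^sup>2 * B \<nu> \<nu>)"
      by (simp add: power2_eq_square algebra_simps)
  qed
  moreover have "k * (B \<mu> \<nu> - B \<nu> \<zeta>) \<le> e"
  proof -
    have "B \<mu> \<nu> - B \<nu> \<zeta> \<le> C * sqrt (B \<nu> \<nu>)"
      using B_Cauchy_Schwarz[OF m(1) n(1)] B_Cauchy_Schwarz[OF n(1) \<zeta>]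
      by (simp add: C_def algebra_simps)
    also have "\<dots> \<le> e" by (rule Ce)
    finally have "k * (B \<mu> \<nu> - B \<nu> \<zeta>) \<le> k * e" using k by (intro mult_left_mono)
    also have "\<dots> \<le> 1 * e" using k e by (intro mult_right_mono) auto
    finally show ?thesis by simp
  qed
  ultimately show "B (weight g \<mu>) \<mu> \<le> B (weight g \<mu>) \<zeta> + e" unfolding w_def by simp
qed

lemma minimizer_potential_le:
  assumes \<mu>: "\<mu> \<in> unit_energy_on \<kappa> A"
    and min: "\<And>\<nu>. \<nu> \<in> unit_energy_on \<kappa> A \<Longrightarrow> B \<mu> \<mu> - 2 * B \<mu> \<zeta> \<le> B \<nu> \<nu> - 2 * B \<nu> \<zeta>"
    and small: "\<And>e. e > 0 \<Longrightarrow> \<exists>\<nu>\<in>unit_energy_on \<kappa> A. B \<nu> \<nu> < e"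
  shows "negligible_for \<mu> {x. \<not> potential \<kappa> \<mu> x \<le> potential \<kappa> \<zeta> x}"
proof (rule negligible_of_weighted_le)
  note m = unit_energy_onD[OF \<mu>]
  show "\<mu> \<in> radon_pos" by (rule E_radon_pos[OF m(1)])
  show "\<mu> g \<le> 1" if "g \<in> Cc" "\<And>x. 0 \<le> g x" "\<And>x. g x \<le> 1" for g
    by (rule unit_mass_bound[OF m(1,3) that(1,3)])
  show "Cc_envelope (potential \<kappa> \<mu>)" "Cc_envelope (potential \<kappa> \<zeta>)"
    by (rule potential_envelope[OF E_radon_pos[OF m(1)]] potential_envelope[OF E_radon_pos[OF \<zeta>]])+
  show "lint \<mu> (potential \<kappa> \<mu>) < \<infinity>" "lint \<mu> (potential \<kappa> \<zeta>) < \<infinity>"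
    by (simp_all add: lint_potential_eq_B m(1) \<zeta>)
  show "lint (weight g \<mu>) (potential \<kappa> \<mu>) \<le> lint (weight g \<mu>) (potential \<kappa> \<zeta>)"
    if g: "g \<in> Cc" "\<And>x. 0 \<le> g x" "\<And>x. g x \<le> 1" for g
    using minimizer_weighted_le[OF \<mu> min small g] weight_E[OF m(1) Cc_continuous[OF g(1)] g(2,3)]
    by (simp add: lint_potential_eq_B m(1) \<zeta>)
qed

end

text \<open>In \<open>ereal\<close>, 1 / x is \<infinity> only for x = 0, so the infimum of the
  energies of unit measures on A is 0.\<close>

lemma small_energy_of_infinite_capacity:
  assumes "inner_capacity \<kappa> A = \<infinity>" "e > 0"
  shows "\<exists>\<nu>\<in>unit_energy_on \<kappa> A. B \<nu> \<nu> < e"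
proof -
  have "min_energy \<kappa> A = 0"
    using assms(1) unfolding inner_capacity_def by (cases "min_energy \<kappa> A") (auto split: if_splits)
  then have "(INF \<nu>\<in>unit_energy_on \<kappa> A. energy \<kappa> \<nu>) < ereal e"
    using assms(2) unfolding min_energy_def by simp
  then obtain \<nu> where \<nu>: "\<nu> \<in> unit_energy_on \<kappa> A" "energy \<kappa> \<nu> < ereal e"
    unfolding INF_less_iff ..
  then show ?thesis
    by (intro bexI[of _ \<nu>]) (simp_all add: energy_def mutual_energy_eq_B unit_energy_onD(1))
qed

end

theorem corollary1p8:
  fixes \<kappa> :: "'a::t2_space \<times> 'a \<Rightarrow> ereal"
    and A :: "'a set"
    and f :: "'a \<Rightarrow> ereal"
    and \<zeta> :: "('a \<Rightarrow> real) \<Rightarrow> real"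
  assumes "locally_compact_space (euclidean :: 'a topology)"
    and "kernel \<kappa>" and "perfect \<kappa>"
    and "first_max_principle \<kappa>" and "second_max_principle \<kappa>"
    and "closedin (strong_topology \<kappa>) (fin_energy_on \<kappa> A)"
    and "\<zeta> \<in> fin_energy_pos \<kappa>" and "total_mass \<zeta> \<le> 1"
    and "f = (\<lambda>x. - potential \<kappa> \<zeta> x)"
    and "-\<infinity> < min_gauss \<kappa> f A" and "min_gauss \<kappa> f A < \<infinity>"
    and "inner_capacity \<kappa> A = \<infinity>"
  shows "(total_mass \<zeta> < 1 \<longrightarrow> \<not> (\<exists>\<mu>. gauss_minimizer \<kappa> f A \<mu>)) \<and>
         (total_mass \<zeta> = 1 \<and> concentrated_on \<zeta> A \<longrightarrow>
            (\<exists>\<mu>. gauss_minimizer \<kappa> f A \<mu>) \<and> (\<forall>\<mu>. gauss_minimizer \<kappa> f A \<mu> \<longrightarrow> \<mu> = \<zeta>))"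
proof -
  interpret max_kernel \<kappa>
    by unfold_locales (rule assms)+
  note \<zeta> = assms(7) and min_iff = gauss_minimizer_iff[OF assms(7,9)]
  have none: "\<not> gauss_minimizer \<kappa> f A \<mu>" if mass: "total_mass \<zeta> < 1" for \<mu>
  proof
    assume "gauss_minimizer \<kappa> f A \<mu>"
    then have \<mu>: "\<mu> \<in> unit_energy_on \<kappa> A"
      and min: "\<And>\<nu>. \<nu> \<in> unit_energy_on \<kappa> A \<Longrightarrow> B \<mu> \<mu> - 2 * B \<mu> \<zeta> \<le> B \<nu> \<nu> - 2 * B \<nu> \<zeta>"
      unfolding min_iff by simp_all
    note m = unit_energy_onD[OF \<mu>]
    have negl: "negligible_for \<mu> {x. \<not> potential \<kappa> \<mu> x \<le> potential \<kappa> \<zeta> x}"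
      by (rule minimizer_potential_le[OF \<zeta> assms(9) \<mu> min small_energy_of_infinite_capacity[OF assms(12)]])
    have "potential \<kappa> \<mu> x \<le> potential \<kappa> \<zeta> x" for x
      by (rule assms(5)[unfolded second_max_principle_def, rule_format, OF m(1) \<zeta> negl])
    then have "total_mass \<mu> \<le> total_mass \<zeta>" by (rule positivity_of_mass[OF m(1) \<zeta>])
    then show False using mass m(3) total_mass_eq_lint[OF E_linear[OF m(1)]] by simp
  qed
  have ex: "gauss_minimizer \<kappa> f A \<zeta>" and uniq: "gauss_minimizer \<kappa> f A \<mu> \<Longrightarrow> \<mu> = \<zeta>"
    if mass: "total_mass \<zeta> = 1" and conc: "concentrated_on \<zeta> A" for \<mu>
  proof -
    have \<zeta>A: "\<zeta> \<in> unit_energy_on \<kappa> A"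
      using mass by (intro unit_energy_onI \<zeta> conc) (simp add: total_mass_eq_lint[OF E_linear[OF \<zeta>]])
    have gauss: "B \<nu> \<nu> - 2 * B \<nu> \<zeta> = q \<nu> \<zeta> - B \<zeta> \<zeta>" for \<nu> by (simp add: q_def)
    show "gauss_minimizer \<kappa> f A \<zeta>"
      unfolding min_iff gauss using \<zeta>A q_nonneg[OF unit_energy_onD(1) \<zeta>] q_zero_iff[OF \<zeta> \<zeta>] by simp
    assume "gauss_minimizer \<kappa> f A \<mu>"
    then have \<mu>: "\<mu> \<in> E" and "q \<mu> \<zeta> \<le> 0"
      using \<zeta>A q_zero_iff[OF \<zeta> \<zeta>] unfolding min_iff gauss by (auto dest: unit_energy_onD(1))
    then have "q \<mu> \<zeta> = 0" using q_nonneg[OF \<mu> \<zeta>] by simp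
    then show "\<mu> = \<zeta>" using q_zero_iff[OF \<mu> \<zeta>] by simp
  qed
  show ?thesis
  proof (intro conjI impI)
    assume "total_mass \<zeta> < 1"
    then show "\<not> (\<exists>\<mu>. gauss_minimizer \<kappa> f A \<mu>)" by (simp only: none not_ex simp_thms)
  next
    assume "total_mass \<zeta> = 1 \<and> concentrated_on \<zeta> A"
    then have *: "total_mass \<zeta> = 1" "concentrated_on \<zeta> A" by simp_all
    show "\<exists>\<mu>. gauss_minimizer \<kappa> f A \<mu>" by (intro exI[of _ \<zeta>] ex *)
    show "\<forall>\<mu>. gauss_minimizer \<kappa> f A \<mu> \<longrightarrow> \<mu> = \<zeta>" by (intro allI impI uniq[OF *])
  qed
qed

end
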